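(* Let $N\ge 3$. Locally (both in the base manifold $M$ and in the tangent spaces), an $N$-dimensional Finsler space $(M,F)$ is conformally automorphic to some Riemannian space $(M,S)$ if and only if, for every $x\in M$, the indicatrix $\{y\in T_xM: F(x,y)=1\}$ is a space of constant curvature (the constant, denoted $\mathcal C_{\rm Ind.}=\mathcal C_{\rm Ind.}(x)$, being allowed to depend on $x$). In this case, if $H=H(x)>0$ is the degree of conformal automorphism, then $$\mathcal C_{\rm Ind.}=H^2,$$ and the conformal multiplier is $p^2$ with $$p=\frac1H F^{1-H}.$$
   Context: $M$ is a $C^\infty$ manifold with local coordinates $x^i$, $y^i$ are the induced coordinates of tangent vectors $y\in T_xM\setminus 0$, indices run over $1,\dots,N$, and repeated indices are summed. A Finsler metric function $F(x,y)$ is smooth, positive, positively homogeneous of degree 1 in $y$ ($F(x,ky)=kF(x,y)$ for $k>0$), with (positive-definite) metric tensor $g_{ij}=\frac12\,\partial^2F^2/\partial y^i\partial y^j$. For fixed $x$ the tensor $g_{ij}(x,y)$ is a Riemannian metric on $T_xM\setminus 0$, and the indicatrix carries the induced metric; its curvature is meant with respect to this metric. A Riemannian metric function is $S(x,y)=\sqrt{a_{ij}(x)y^iy^j}$. Definition. $(M,F)$ is conformally automorphic to $(M,S)$, of degree $H=H(x)>0$, if there is a smooth family of invertible smooth transformations $y\mapsto t=t(x,y)$ of nonzero tangent vectors at $x$ into nonzero tangent vectors at the same $x$ (the points $x\in M$ are not moved) such that: (i) $t^m(x,ky)=k^{H}t^m(x,y)$ for all $k>0$; (ii) unit vectors correspond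 to unit vectors: $F(x,y)=1\iff S(x,t(x,y))=1$; (iii) the transformation is conformal: $g_{mn}(x,y)=p^2\,a_{ij}(x)\,t^i_m t^j_n$, where $t^i_m=\partial t^i/\partial y^m$ and $p=p(x,y)>0$. The factor $p^2$ is called the conformal multiplier. Throughout, only positive curvature values $\mathcal C_{\rm Ind.}>0$ are considered. *)

theory Defs
  imports "HOL-Analysis.Analysis"
begin

section \<open>Smooth maps and smooth manifolds\<close>

text \<open>The following notions of differentiability are meant for open sets only.\<close>

fun Ck_on :: "nat \<Rightarrow> ('a::real_normed_vector \<Rightarrow> 'b::real_normed_vector) \<Rightarrow> 'a set \<Rightarrow> bool" where
  "Ck_on 0 f S \<longleftrightarrow> continuous_on S f"
| "Ck_on (Suc k) f S \<longleftrightarrow>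
     (\<forall>x\<in>S. f differentiable (at x)) \<and> (\<forall>v. Ck_on k (\<lambda>x. frechet_derivative f (at x) v) S)"

definition smooth_map_on :: "'a set \<Rightarrow> ('a::real_normed_vector \<Rightarrow> 'b::real_normed_vector) \<Rightarrow> bool" where
  "smooth_map_on S f \<longleftrightarrow> (\<forall>k. Ck_on k f S)"

definition partial :: "'n \<Rightarrow> (real^'n \<Rightarrow> real) \<Rightarrow> real^'n::finite \<Rightarrow> real" where
  "partial i f x = frechet_derivative f (at x) (axis i 1)"

type_synonym ('a, 'n) chart = "'a set \<times> ('a \<Rightarrow> real^'n)"

definition transition :: "('a, 'n::finite) chart \<Rightarrow> ('a, 'n) chart \<Rightarrow> real^'n \<Rightarrow> real^'n" where
  "transition c d = snd d \<circ> inv_into (fst c) (snd c)"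

definition smooth_manifold :: "'a topology \<Rightarrow> ('a, 'n::finite) chart set \<Rightarrow> bool" where
  "smooth_manifold M A \<longleftrightarrow>
     Hausdorff_space M \<and>
     (\<exists>B. countable B \<and> (\<forall>b\<in>B. openin M b) \<and>
        (\<forall>U x. openin M U \<and> x \<in> U \<longrightarrow> (\<exists>b\<in>B. x \<in> b \<and> b \<subseteq> U))) \<and>
     \<Union> (fst ` A) = topspace M \<and>
     (\<forall>(U, \<phi>)\<in>A. openin M U \<and> open (\<phi> ` U) \<and>
        homeomorphic_map (subtopology M U) (top_of_set (\<phi> ` U)) \<phi>) \<and>
     (\<forall>(U, \<phi>)\<in>A. \<forall>(V, \<psi>)\<in>A. smooth_map_on (\<phi> ` (U \<inter> V)) (transition (U, \<phi>) (V, \<psi>)))"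


section \<open>Finsler metric functions\<close>

definition finsler_metric :: "(real^'n \<Rightarrow> real^'n \<Rightarrow> real) \<Rightarrow> real^'n::finite \<Rightarrow> real^'n \<Rightarrow> real^'n^'n" where
  "finsler_metric F x y = (\<chi> i j. 1/2 * partial i (partial j (\<lambda>z. (F x z)\<^sup>2)) y)"

definition finsler_function :: "(real^'n) set \<Rightarrow> (real^'n \<Rightarrow> real^'n::finite \<Rightarrow> real) \<Rightarrow> bool" where
  "finsler_function D F \<longleftrightarrow>
     smooth_map_on (D \<times> (UNIV - {0})) (\<lambda>(x, y). F x y) \<and>
     (\<forall>x\<in>D. \<forall>y. y \<noteq> 0 \<longrightarrow>
        F x y > 0 \<and>
        (\<forall>k>0. F x (k *\<^sub>R y) = k * F x y) \<and>
        (\<forall>v. v \<noteq> 0 \<longrightarrow> v \<bullet> (finsler_metric F x y *v v) > 0))"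

text \<open>
  A tangent vector of M at q is given by its induced coordinates y in each chart c around q; the
  coordinates in c and d are related by the Jacobian of the coordinate change. Accordingly a
  function on the nonzero tangent vectors of M is a family indexed by the charts, where F c x y is
  its value at the vector with coordinates (x, y) in the chart c, compatible with coordinate
  changes.
\<close>

definition finsler_space ::
  "'a topology \<Rightarrow> ('a, 'n::finite) chart set \<Rightarrow> (('a, 'n) chart \<Rightarrow> real^'n \<Rightarrow> real^'n \<Rightarrow> real) \<Rightarrow> bool" where
  "finsler_space M A F \<longleftrightarrow>
     smooth_manifold M A \<and>
     (\<forall>c\<in>A. finsler_function (snd c ` fst c) (F c)) \<and>
     (\<forall>c\<in>A. \<forall>d\<in>A. \<forall>q \<in> fst c \<inter> fst d. \<forall>y. y \<noteq> 0 \<longrightarrow>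
        F d (snd d q) (frechet_derivative (transition c d) (at (snd c q)) y) = F c (snd c q) y)"


section \<open>Curvature of a Riemannian metric in coordinates\<close>

definition christoffel :: "(real^'m \<Rightarrow> real^'m^'m) \<Rightarrow> real^'m::finite \<Rightarrow> 'm \<Rightarrow> 'm \<Rightarrow> 'm \<Rightarrow> real" where
  "christoffel h u d a b =
     1/2 * (\<Sum>e\<in>UNIV. matrix_inv (h u) $ d $ e *
       (partial a (\<lambda>w. h w $ e $ b) u + partial b (\<lambda>w. h w $ e $ a) u - partial e (\<lambda>w. h w $ a $ b) u))"

text \<open>
  riemann h u d c a b is the component of R(\<open>\<partial>\<^sub>a\<close>, \<open>\<partial>\<^sub>b\<close>) \<open>\<partial>\<^sub>c\<close> along \<open>\<partial>\<^sub>d\<close>, with the convention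
  R(X, Y) Z = \<open>\<nabla>\<^sub>X \<nabla>\<^sub>Y Z - \<nabla>\<^sub>Y \<nabla>\<^sub>X Z - \<nabla>\<^bsub>[X,Y]\<^esub> Z\<close>. The sectional curvature below is
  \<open>\<langle>\<close>R(v, w) w, v\<open>\<rangle>\<close> over the Gram determinant of v, w, so unit spheres have curvature 1.
\<close>

definition riemann :: "(real^'m \<Rightarrow> real^'m^'m) \<Rightarrow> real^'m::finite \<Rightarrow> 'm \<Rightarrow> 'm \<Rightarrow> 'm \<Rightarrow> 'm \<Rightarrow> real" where
  "riemann h u d c a b =
     partial a (\<lambda>w. christoffel h w d b c) u - partial b (\<lambda>w. christoffel h w d a c) u +
     (\<Sum>e\<in>UNIV. christoffel h u d a e * christoffel h u e b c -
                christoffel h u d b e * christoffel h u e a c)"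

definition sectional_curvature ::
  "(real^'m \<Rightarrow> real^'m^'m) \<Rightarrow> real^'m::finite \<Rightarrow> real^'m \<Rightarrow> real^'m \<Rightarrow> real" where
  "sectional_curvature h u v w =
     (\<Sum>a\<in>UNIV. \<Sum>b\<in>UNIV. \<Sum>c\<in>UNIV. \<Sum>d\<in>UNIV. \<Sum>e\<in>UNIV.
        h u $ e $ d * riemann h u d c a b * v $ a * w $ b * w $ c * v $ e)
     / ((v \<bullet> (h u *v v)) * (w \<bullet> (h u *v w)) - (v \<bullet> (h u *v w))\<^sup>2)"


section \<open>The indicatrix\<close>

definition indicatrix :: "(real^'n \<Rightarrow> real^'n::finite \<Rightarrow> real) \<Rightarrow> real^'n \<Rightarrow> (real^'n) set" where
  "indicatrix F x = {y. y \<noteq> 0 \<and> F x y = 1}"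

text \<open>
  Local parametrizations of the indicatrix; they are only used when the dimension of the parameter
  space is one less than the dimension of the tangent space.
\<close>

definition indicatrix_parametrization ::
  "(real^'n \<Rightarrow> real^'n::finite \<Rightarrow> real) \<Rightarrow> real^'n \<Rightarrow> (real^'m::finite) set \<Rightarrow> (real^'m \<Rightarrow> real^'n) \<Rightarrow> bool" where
  "indicatrix_parametrization F x \<Omega> Y \<longleftrightarrow>
     open \<Omega> \<and> smooth_map_on \<Omega> Y \<and> inj_on Y \<Omega> \<and>
     (\<forall>u\<in>\<Omega>. inj (frechet_derivative Y (at u))) \<and> Y ` \<Omega> \<subseteq> indicatrix F x"

definition induced_metric ::
  "(real^'n \<Rightarrow> real^'n::finite \<Rightarrow> real) \<Rightarrow> real^'n \<Rightarrow> (real^'m::finite \<Rightarrow> real^'n) \<Rightarrow> real^'m \<Rightarrow> real^'m^'m" where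
  "induced_metric F x Y u =
     (\<chi> a b. \<Sum>i\<in>UNIV. \<Sum>j\<in>UNIV. finsler_metric F x (Y u) $ i $ j *
        partial a (\<lambda>w. Y w $ i) u * partial b (\<lambda>w. Y w $ j) u)"

text \<open>
  The type argument is the index type of the parameters, i.e. CARD('m) is the dimension of the
  indicatrix.
\<close>

definition indicatrix_constant_curvature ::
  "'m::finite itself \<Rightarrow> (real^'n \<Rightarrow> real^'n::finite \<Rightarrow> real) \<Rightarrow> real^'n \<Rightarrow> real \<Rightarrow> bool" where
  "indicatrix_constant_curvature _ F x C \<longleftrightarrow>
     (\<forall>(\<Omega> :: (real^'m) set) Y. indicatrix_parametrization F x \<Omega> Y \<longrightarrow>
        (\<forall>u\<in>\<Omega>. \<forall>v w. v \<noteq> w \<and> independent {v, w} \<longrightarrow>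
           sectional_curvature (induced_metric F x Y) u v w = C))"


section \<open>Conformal automorphisms\<close>

definition riemannian_metric :: "(real^'n) set \<Rightarrow> (real^'n \<Rightarrow> real^'n::finite^'n) \<Rightarrow> bool" where
  "riemannian_metric D a \<longleftrightarrow>
     smooth_map_on D a \<and>
     (\<forall>x\<in>D. transpose (a x) = a x \<and> (\<forall>v. v \<noteq> 0 \<longrightarrow> v \<bullet> (a x *v v) > 0))"

definition riemannian_function :: "(real^'n \<Rightarrow> real^'n^'n) \<Rightarrow> real^'n \<Rightarrow> real^'n::finite \<Rightarrow> real" where
  "riemannian_function a x y = sqrt (\<Sum>i\<in>UNIV. \<Sum>j\<in>UNIV. a x $ i $ j * y $ i * y $ j)"

text \<open>
  The transformation is defined on an open set W of nonzero tangent vectors (base point, vector)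
  that is closed under positive scaling in the vector, as the homogeneity condition requires. The
  whole slit tangent bundle is the special case of a global transformation. Invertible means
  invertible onto the image; together with the regular Jacobian this makes the inverse smooth.
\<close>

definition conformal_automorphism ::
  "((real^'n) \<times> (real^'n)) set \<Rightarrow> (real^'n \<Rightarrow> real^'n::finite \<Rightarrow> real) \<Rightarrow> (real^'n \<Rightarrow> real^'n^'n) \<Rightarrow>
   (real^'n \<Rightarrow> real) \<Rightarrow> (real^'n \<Rightarrow> real^'n \<Rightarrow> real^'n) \<Rightarrow> (real^'n \<Rightarrow> real^'n \<Rightarrow> real) \<Rightarrow> bool" where
  "conformal_automorphism W F a H t p \<longleftrightarrow>
     open W \<and>
     (\<forall>(x, y)\<in>W. y \<noteq> 0 \<and> (\<forall>k>0. (x, k *\<^sub>R y) \<in> W)) \<and>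
     riemannian_metric (fst ` W) a \<and>
     smooth_map_on W (\<lambda>(x, y). t x y) \<and>
     (\<forall>x. inj_on (t x) {y. (x, y) \<in> W}) \<and>
     (\<forall>(x, y)\<in>W.
        t x y \<noteq> 0 \<and> invertible (jacobian (t x) (at y)) \<and>
        H x > 0 \<and> (\<forall>k>0. t x (k *\<^sub>R y) = (k powr H x) *\<^sub>R t x y) \<and>
        (F x y = 1 \<longleftrightarrow> riemannian_function a x (t x y) = 1) \<and>
        p x y > 0 \<and>
        (\<forall>m n. finsler_metric F x y $ m $ n =
           (p x y)\<^sup>2 * (\<Sum>i\<in>UNIV. \<Sum>j\<in>UNIV.
              a x $ i $ j * jacobian (t x) (at y) $ i $ m * jacobian (t x) (at y) $ j $ n)))"

text \<open>
  Locality in the base means that the Riemannian metric a and the degree H live on a coordinate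
  neighbourhood V of q; locality in the tangent spaces means that near every nonzero tangent
  vector over V there is a transformation t.
\<close>

definition locally_conformally_automorphic ::
  "'a topology \<Rightarrow> ('a, 'n::finite) chart set \<Rightarrow> (('a, 'n) chart \<Rightarrow> real^'n \<Rightarrow> real^'n \<Rightarrow> real) \<Rightarrow> bool" where
  "locally_conformally_automorphic M A F \<longleftrightarrow>
     (\<forall>q \<in> topspace M. \<exists>c\<in>A. q \<in> fst c \<and>
       (\<exists>V a H. open V \<and> snd c q \<in> V \<and> V \<subseteq> snd c ` fst c \<and> riemannian_metric V a \<and>
         (\<forall>x\<in>V. \<forall>y. y \<noteq> 0 \<longrightarrow>
           (\<exists>W t p. (x, y) \<in> W \<and> W \<subseteq> V \<times> UNIV \<and> conformal_automorphism W (F c) a H t p))))"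

end

theory Submission
  imports Defs
begin

text \<open>
  Scaling a conformal automorphism to the indicatrix gives \<open>S(t) = F\<^sup>H\<close>, and contracting the
  conformality condition twice with y yields the factor p. On the indicatrix p equals \<open>1/H\<close>, so a
  parametrization Y of the indicatrix with induced metric h becomes a map \<open>Z = t \<circ> Y\<close> to the unit
  sphere pulling the round metric back to \<open>H\<^sup>2 h\<close>. Such maps satisfy
  \<open>\<partial>\<^sub>b \<partial>\<^sub>c Z = \<Gamma>\<^sup>d\<^sub>b\<^sub>c \<partial>\<^sub>d Z - H\<^sup>2 h\<^sub>b\<^sub>c Z\<close>, whose integrability condition says that h has constant
  curvature \<open>H\<^sup>2\<close>.

  Conversely, if h has constant curvature \<open>C = H\<^sup>2\<close>, this overdetermined linear system is integrable.
  Its solutions depend smoothly on the base point x, and for suitable initial values they form a map Z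
  to the unit sphere with the above property. In a central projection of the indicatrix with coordinates
  \<open>u(y)\<close>, the map \<open>t(x, y) = F\<^sup>H Z(x, u(y))\<close> is then a conformal automorphism to the Euclidean metric.
\<close>


section \<open>Calculus of smooth maps\<close>

text \<open>The factor p comes from polar coordinates. On a tangent space the Finsler metric is the
  cone \<open>dF^2 + F^2 h\<close> over the indicatrix metric h, and the Euclidean metric is the
  cone \<open>dr^2 + r^2 s\<close> over the round metric s. Substituting \<open>r = F^H\<close> and
  \<open>s = H^2 h\<close> turns the latter into \<open>H^2 F^(2H-2) (dF^2 + F^2 h)\<close>: both
  terms acquire the same factor \<open>1/p^2\<close>. The obstacle in the converse is that t must be
  smooth in x and y together, so the sphere map has to depend smoothly on the base point. The linear
  system is therefore rewritten as an integral equation along rays with x as a parameter, solved by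
  a Neumann series on a tube so small that the integral operator halves norms, and smoothness is
  gained one derivative at a time. The function C has to be smooth as well, although constancy of
  the curvature is given for each x separately. It is recovered as a quotient of a curvature
  component by a metric component, with two different parameter indices; these exist because the
  indicatrix has dimension at least 2.\<close>

abbreviation FD :: "('a::real_normed_vector \<Rightarrow> 'b::real_normed_vector) \<Rightarrow> 'a \<Rightarrow> 'a \<Rightarrow> 'b" where
  "FD f x \<equiv> frechet_derivative f (at x)"

lemma FD_eqI: "(f has_derivative f') (at x) \<Longrightarrow> FD f x = f'"
  by (metis frechet_derivative_at)

lemma FD_has_derivative: "f differentiable (at x) \<Longrightarrow> (f has_derivative FD f x) (at x)"
  by (simp add: frechet_derivative_works)

text \<open>\<open>frechet_derivative\<close> is a choice from the set of derivatives at x, and this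
  set depends only on the germ of the map. So the equality covers points of nondifferentiability
  too.\<close>

lemma FD_cong:
  assumes "open S" "x \<in> S" "\<And>y. y \<in> S \<Longrightarrow> f y = g y"
  shows "FD f x = FD g x"
proof -
  have "(f has_derivative f') (at x) \<longleftrightarrow> (g has_derivative f') (at x)" for f'
    using assms by (metis has_derivative_transform_within_open)
  then show ?thesis by (simp add: frechet_derivative_def)
qed

lemma differentiable_cong_open:
  assumes "open S" "x \<in> S" "\<And>y. y \<in> S \<Longrightarrow> f y = g y" "f differentiable (at x)"
  shows "g differentiable (at x)"
  using assms unfolding differentiable_def by (metis has_derivative_transform_within_open)

lemma Ck_on_cong:
  assumes "open S" "\<And>x. x \<in> S \<Longrightarrow> f x = g x" "Ck_on k f S"
  shows "Ck_on k g S"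
  using assms(2,3)
proof (induction k arbitrary: f g)
  case 0
  then show ?case using continuous_on_cong by force
next
  case (Suc k)
  have "FD f x v = FD g x v" if "x \<in> S" for x v
    using FD_cong[OF assms(1) that, of f g] Suc.prems(1) by auto
  moreover have "g differentiable (at x)" if "x \<in> S" for x
    using differentiable_cong_open[OF assms(1) that, of f g] Suc.prems that by auto
  moreover have "Ck_on k (\<lambda>x. FD g x v) S" for v
    using Suc.IH[of "\<lambda>x. FD f x v" "\<lambda>x. FD g x v"] Suc.prems(2) calculation(1) by auto
  ultimately show ?case by auto
qed

lemma Ck_on_subset: "Ck_on k f S \<Longrightarrow> T \<subseteq> S \<Longrightarrow> Ck_on k f T"
  by (induction k arbitrary: f) (auto intro: continuous_on_subset)

lemma Ck_on_Suc_has_derivative: "Ck_on (Suc k) f S \<Longrightarrow> x \<in> S \<Longrightarrow> (f has_derivative FD f x) (at x)"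
  using FD_has_derivative by auto

lemma Ck_on_imp_continuous: "Ck_on k f S \<Longrightarrow> continuous_on S f"
proof (cases k)
  case (Suc k')
  then show "Ck_on k f S \<Longrightarrow> continuous_on S f"
    by (metis Ck_on.simps(2) continuous_at_imp_continuous_on differentiable_imp_continuous_within)
qed simp

lemma Ck_on_SucD: "Ck_on (Suc k) f S \<Longrightarrow> Ck_on k f S"
proof (induction k arbitrary: f)
  case 0
  then show ?case by (metis Ck_on.simps(1) Ck_on_imp_continuous)
next
  case (Suc k)
  then show ?case by (meson Ck_on.simps(2))
qed

lemma Ck_on_local:
  assumes "\<And>x. x \<in> S \<Longrightarrow> \<exists>T. open T \<and> x \<in> T \<and> Ck_on k f T"
  shows "Ck_on k f S"
  using assms
proof (induction k arbitrary: f)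
  case 0
  then show ?case
    by (metis Ck_on.simps(1) continuous_at_imp_continuous_on continuous_on_eq_continuous_at)
next
  case (Suc k)
  then show ?case by (metis Ck_on.simps(2))
qed

lemma Ck_on_const [simp]: "Ck_on k (\<lambda>x. c) S"
  by (induction k arbitrary: c) auto

lemma Ck_on_bounded_linear_compose:
  assumes "bounded_linear L" "open S" "Ck_on k f S"
  shows "Ck_on k (\<lambda>x. L (f x)) S"
  using assms(3)
proof (induction k arbitrary: f)
  case 0
  then show ?case using assms(1) by (auto intro: bounded_linear.continuous_on)
next
  case (Suc k)
  have d: "((\<lambda>x. L (f x)) has_derivative (\<lambda>v. L (FD f x v))) (at x)" if "x \<in> S" for x
    by (rule bounded_linear.has_derivative[OF assms(1) Ck_on_Suc_has_derivative[OF Suc.prems that]])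
  have "Ck_on k (\<lambda>x. FD (\<lambda>x. L (f x)) x v) S" for v
    by (rule Ck_on_cong[OF assms(2) _ Suc.IH[of "\<lambda>x. FD f x v"]])
       (use FD_eqI[OF d] Suc.prems in auto)
  then show ?case using d by (auto simp: differentiable_def)
qed

lemma Ck_on_ident [simp]: "Ck_on k (\<lambda>x. x) S"
  by (cases k) auto

lemma Ck_on_bounded_linear: "bounded_linear L \<Longrightarrow> Ck_on k L S"
  using Ck_on_subset[OF Ck_on_bounded_linear_compose[of L UNIV k "\<lambda>x. x"]] by auto

lemma Ck_on_add:
  assumes "open S" "Ck_on k f S" "Ck_on k g S"
  shows "Ck_on k (\<lambda>x. f x + g x) S"
  using assms(2,3)
proof (induction k arbitrary: f g)
  case 0
  then show ?case by (auto intro: continuous_intros)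
next
  case (Suc k)
  have d: "((\<lambda>x. f x + g x) has_derivative (\<lambda>v. FD f x v + FD g x v)) (at x)" if "x \<in> S" for x
    by (rule has_derivative_add[OF Suc.prems[THEN Ck_on_Suc_has_derivative, OF that]])
  have "Ck_on k (\<lambda>x. FD (\<lambda>x. f x + g x) x v) S" for v
    by (rule Ck_on_cong[OF assms(1) _ Suc.IH[of "\<lambda>x. FD f x v" "\<lambda>x. FD g x v"]])
       (use FD_eqI[OF d] Suc.prems in auto)
  then show ?case using d by (auto simp: differentiable_def)
qed

lemma Ck_on_bilinear:
  assumes "bounded_bilinear pr" "open S" "Ck_on k f S" "Ck_on k g S"
  shows "Ck_on k (\<lambda>x. pr (f x) (g x)) S"
  using assms(3,4)
proof (induction k arbitrary: f g)
  case 0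
  then show ?case by (auto intro: bounded_bilinear.continuous_on[OF assms(1)])
next
  case (Suc k)
  have d: "((\<lambda>x. pr (f x) (g x)) has_derivative (\<lambda>v. pr (f x) (FD g x v) + pr (FD f x v) (g x))) (at x)"
    if "x \<in> S" for x
    by (rule bounded_bilinear.FDERIV[OF assms(1) Suc.prems[THEN Ck_on_Suc_has_derivative, OF that]])
  have "Ck_on k (\<lambda>x. FD (\<lambda>x. pr (f x) (g x)) x v) S" for v
    by (rule Ck_on_cong[OF assms(2) _ Ck_on_add[OF assms(2) Suc.IH[of f "\<lambda>x. FD g x v"] Suc.IH[of "\<lambda>x. FD f x v" g]]])
       (use FD_eqI[OF d] Suc.prems Ck_on_SucD[of k f] Ck_on_SucD[of k g] in auto)
  then show ?case using d by (auto simp: differentiable_def)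
qed

lemma Ck_on_sum:
  assumes "open S" "\<And>i. i \<in> I \<Longrightarrow> Ck_on k (f i) S"
  shows "Ck_on k (\<lambda>x. \<Sum>i\<in>I. f i x) S"
  using assms(2)
  by (induction I rule: infinite_finite_induct) (auto intro!: Ck_on_add assms(1))

lemma Ck_on_componentwise:
  fixes f :: "'a::real_normed_vector \<Rightarrow> 'b::euclidean_space"
  assumes "open S" "\<And>i. i \<in> Basis \<Longrightarrow> Ck_on k (\<lambda>x. f x \<bullet> i) S"
  shows "Ck_on k f S"
proof (rule Ck_on_cong[OF assms(1)])
  show "Ck_on k (\<lambda>x. \<Sum>i\<in>Basis. (f x \<bullet> i) *\<^sub>R i) S"
    using Ck_on_bounded_linear_compose[OF bounded_linear_scaleR_left assms(1) assms(2)]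
    by (intro Ck_on_sum assms(1)) auto
qed (simp add: euclidean_representation)

lemma Ck_on_Pair:
  assumes "open S" "Ck_on k f S" "Ck_on k g S"
  shows "Ck_on k (\<lambda>x. (f x, g x)) S"
proof (rule Ck_on_cong[OF assms(1)])
  show "Ck_on k (\<lambda>x. (f x, 0) + (0, g x)) S"
    by (intro Ck_on_add[OF assms(1)] Ck_on_bounded_linear_compose[of "\<lambda>y. (y,0)" S k f, OF _ assms(1,2)]
        Ck_on_bounded_linear_compose[of "\<lambda>y. (0,y)" S k g, OF _ assms(1,3)])
       (auto intro!: bounded_linear_intros)
qed simp

lemma Ck_on_compose:
  fixes f :: "'a::real_normed_vector \<Rightarrow> 'b::euclidean_space"
  assumes "open S" "open T" "f ` S \<subseteq> T" "Ck_on k f S" "Ck_on k g T"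
  shows "Ck_on k (\<lambda>x. g (f x)) S"
  using assms(4,5)
proof (induction k arbitrary: g)
  case 0
  then show ?case using assms(3) by (auto intro: continuous_on_compose2)
next
  case (Suc k)
  have d: "((\<lambda>x. g (f x)) has_derivative (\<lambda>v. FD g (f x) (FD f x v))) (at x)" if "x \<in> S" for x
    using has_derivative_compose[OF Ck_on_Suc_has_derivative[OF Suc.prems(1) that]
        Ck_on_Suc_has_derivative[OF Suc.prems(2)]] that assms(3) by blast
  \<comment> \<open>\<open>Ck_on\<close> controls derivatives of g only in fixed directions, whereas
    the chain rule produces the direction \<open>FD f x v\<close>, which moves with x. Expanding it
    in a finite basis brings every term into the form of the induction hypothesis.\<close>
  have e: "FD g (f x) (FD f x v) = (\<Sum>i\<in>Basis. (FD f x v \<bullet> i) *\<^sub>R FD g (f x) i)" if "x \<in> S" for x v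
  proof -
    have "linear (FD g (f x))"
      using Suc.prems(2) assms(3) that by (auto intro!: linear_frechet_derivative)
    then have "(\<Sum>i\<in>Basis. (FD f x v \<bullet> i) *\<^sub>R FD g (f x) i) = FD g (f x) (\<Sum>i\<in>Basis. (FD f x v \<bullet> i) *\<^sub>R i)"
      by (simp add: linear_sum linear_scale)
    then show ?thesis by (simp add: euclidean_representation)
  qed
  have "Ck_on k (\<lambda>x. FD (\<lambda>x. g (f x)) x v) S" for v
  proof (rule Ck_on_cong[OF assms(1)])
    have "Ck_on k f S" using Suc.prems(1) Ck_on_SucD by blast
    then show "Ck_on k (\<lambda>x. \<Sum>i\<in>Basis. (FD f x v \<bullet> i) *\<^sub>R FD g (f x) i) S"
      using Suc.prems
      by (intro Ck_on_sum assms(1) Ck_on_bilinear[OF bounded_bilinear_scaleR] Suc.IH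
          Ck_on_bounded_linear_compose[of "\<lambda>y. y \<bullet> _"]) (auto intro: bounded_linear_inner_left)
  qed (use FD_eqI[OF d] e in auto)
  then show ?case using d by (auto simp: differentiable_def)
qed

text \<open>The derivative is a polynomial in \<open>inverse\<close> itself, so each step of the
  induction uses the same function one level lower.\<close>

lemma Ck_on_inverse: "Ck_on k (inverse :: real \<Rightarrow> real) {x. x \<noteq> 0}"
proof (induction k)
  case 0
  then show ?case by (auto intro: continuous_intros)
next
  case (Suc k)
  have o: "open {x::real. x \<noteq> 0}" by (simp add: open_Collect_neq)
  have d: "(inverse has_derivative (\<lambda>v. - (inverse x * v * inverse x))) (at x)" if "x \<noteq> 0" for x :: real
    using that by (auto intro!: derivative_eq_intros)
  have "Ck_on k (\<lambda>x. FD inverse x v) {x::real. x \<noteq> 0}" for v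
  proof (rule Ck_on_cong[OF o])
    show "Ck_on k (\<lambda>x::real. (- v) * (inverse x * inverse x)) {x. x \<noteq> 0}"
      by (intro Ck_on_bilinear[OF bounded_bilinear_mult] o Suc Ck_on_const)
  qed (use FD_eqI[OF d] in auto)
  then show ?case using d unfolding Ck_on.simps differentiable_def by blast
qed

lemma Ck_on_exp: "Ck_on k (exp :: real \<Rightarrow> real) UNIV"
proof (induction k)
  case 0
  then show ?case by (auto intro: continuous_intros)
next
  case (Suc k)
  have d: "(exp has_derivative (\<lambda>v. exp x * v)) (at x)" for x :: real
    by (auto intro!: derivative_eq_intros)
  have "Ck_on k (\<lambda>x. FD exp x v) (UNIV::real set)" for v
    by (rule Ck_on_cong[OF _ _ Ck_on_bilinear[OF bounded_bilinear_mult _ Suc Ck_on_const[of _ v]]])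
       (use FD_eqI[OF d] in auto)
  then show ?case using d unfolding Ck_on.simps differentiable_def by blast
qed

lemma Ck_on_ln: "Ck_on k (ln :: real \<Rightarrow> real) {0<..}"
proof (cases k)
  case 0
  then show ?thesis by (auto intro!: continuous_intros)
next
  case (Suc k')
  have d: "(ln has_derivative (\<lambda>v. inverse x * v)) (at x)" if "x > 0" for x :: real
    using that by (auto intro!: derivative_eq_intros)
  have "Ck_on k' (\<lambda>x. FD ln x v) {0::real<..}" for v
    by (rule Ck_on_cong[OF _ _ Ck_on_bilinear[OF bounded_bilinear_mult _ Ck_on_subset[OF Ck_on_inverse] Ck_on_const[of _ v]]])
       (use FD_eqI[OF d] in auto)
  then show ?thesis using d unfolding Suc Ck_on.simps differentiable_def by blast
qed

section \<open>Closure properties of smooth maps\<close>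

lemma smooth_cong: "open S \<Longrightarrow> (\<And>x. x \<in> S \<Longrightarrow> f x = g x) \<Longrightarrow> smooth_map_on S f \<Longrightarrow> smooth_map_on S g"
  unfolding smooth_map_on_def using Ck_on_cong by metis

lemma smooth_subset: "smooth_map_on S f \<Longrightarrow> T \<subseteq> S \<Longrightarrow> smooth_map_on T f"
  unfolding smooth_map_on_def using Ck_on_subset by metis

lemma smooth_differentiable: "smooth_map_on S f \<Longrightarrow> x \<in> S \<Longrightarrow> f differentiable (at x)"
  unfolding smooth_map_on_def using Ck_on.simps(2) by metis

lemma smooth_has_derivative: "smooth_map_on S f \<Longrightarrow> x \<in> S \<Longrightarrow> (f has_derivative FD f x) (at x)"
  using smooth_differentiable FD_has_derivative by metis

lemma smooth_continuous: "smooth_map_on S f \<Longrightarrow> continuous_on S f"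
  unfolding smooth_map_on_def using Ck_on_imp_continuous by metis

lemma smooth_FD: "smooth_map_on S f \<Longrightarrow> smooth_map_on S (\<lambda>x. FD f x v)"
  unfolding smooth_map_on_def using Ck_on.simps(2) by metis

lemma smooth_const: "smooth_map_on S (\<lambda>x. c)"
  by (simp add: smooth_map_on_def)

lemma smooth_bounded_linear: "bounded_linear L \<Longrightarrow> smooth_map_on S L"
  by (simp add: smooth_map_on_def Ck_on_bounded_linear)

lemma smooth_ident: "smooth_map_on S (\<lambda>x. x)"
  by (simp add: smooth_map_on_def)

lemma smooth_bounded_linear_compose:
  "bounded_linear L \<Longrightarrow> open S \<Longrightarrow> smooth_map_on S f \<Longrightarrow> smooth_map_on S (\<lambda>x. L (f x))"
  by (simp add: smooth_map_on_def Ck_on_bounded_linear_compose)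

lemma smooth_bilinear:
  "bounded_bilinear pr \<Longrightarrow> open S \<Longrightarrow> smooth_map_on S f \<Longrightarrow> smooth_map_on S g \<Longrightarrow> smooth_map_on S (\<lambda>x. pr (f x) (g x))"
  by (simp add: smooth_map_on_def Ck_on_bilinear)

lemma smooth_add:
  "open S \<Longrightarrow> smooth_map_on S f \<Longrightarrow> smooth_map_on S g \<Longrightarrow> smooth_map_on S (\<lambda>x. f x + g x)"
  by (simp add: smooth_map_on_def Ck_on_add)

lemma smooth_minus: "open S \<Longrightarrow> smooth_map_on S f \<Longrightarrow> smooth_map_on S (\<lambda>x. - f x)"
  by (rule smooth_bounded_linear_compose[OF bounded_linear_minus[OF bounded_linear_ident]])

lemma smooth_diff:
  "open S \<Longrightarrow> smooth_map_on S f \<Longrightarrow> smooth_map_on S g \<Longrightarrow> smooth_map_on S (\<lambda>x. f x - g x)"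
  using smooth_add[OF _ _ smooth_minus] by fastforce

lemma smooth_scaleR:
  "open S \<Longrightarrow> smooth_map_on S f \<Longrightarrow> smooth_map_on S g \<Longrightarrow> smooth_map_on S (\<lambda>x. f x *\<^sub>R g x)"
  by (rule smooth_bilinear[OF bounded_bilinear_scaleR])

lemma smooth_mult:
  fixes f g :: "_ \<Rightarrow> real"
  shows "open S \<Longrightarrow> smooth_map_on S f \<Longrightarrow> smooth_map_on S g \<Longrightarrow> smooth_map_on S (\<lambda>x. f x * g x)"
  by (rule smooth_bilinear[OF bounded_bilinear_mult])

lemma smooth_sum:
  "open S \<Longrightarrow> (\<And>i. i \<in> I \<Longrightarrow> smooth_map_on S (f i)) \<Longrightarrow> smooth_map_on S (\<lambda>x. \<Sum>i\<in>I. f i x)"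
  by (simp add: smooth_map_on_def Ck_on_sum)

lemma smooth_prod:
  fixes f :: "_ \<Rightarrow> _ \<Rightarrow> real"
  assumes "open S" "\<And>i. i \<in> I \<Longrightarrow> smooth_map_on S (f i)"
  shows "smooth_map_on S (\<lambda>x. \<Prod>i\<in>I. f i x)"
  using assms(2)
  by (induction I rule: infinite_finite_induct) (auto intro!: smooth_mult smooth_const assms(1))

lemma smooth_power:
  fixes f :: "_ \<Rightarrow> real"
  shows "open S \<Longrightarrow> smooth_map_on S f \<Longrightarrow> smooth_map_on S (\<lambda>x. f x ^ n)"
  by (induction n) (auto intro!: smooth_mult smooth_const)

lemma smooth_Pair:
  "open S \<Longrightarrow> smooth_map_on S f \<Longrightarrow> smooth_map_on S g \<Longrightarrow> smooth_map_on S (\<lambda>x. (f x, g x))"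
  by (simp add: smooth_map_on_def Ck_on_Pair)

lemma smooth_compose:
  fixes f :: "'a::real_normed_vector \<Rightarrow> 'b::euclidean_space"
  assumes "open S" "open T" "f ` S \<subseteq> T" "smooth_map_on S f" "smooth_map_on T g"
  shows "smooth_map_on S (\<lambda>x. g (f x))"
  using assms unfolding smooth_map_on_def using Ck_on_compose by metis

lemma smooth_nth: "open S \<Longrightarrow> smooth_map_on S f \<Longrightarrow> smooth_map_on S (\<lambda>x. f x $ i)"
  by (rule smooth_bounded_linear_compose[OF bounded_linear_vec_nth])

lemma smooth_vec:
  fixes f :: "'a::real_normed_vector \<Rightarrow> ('b::euclidean_space)^'n"
  assumes "open S" "\<And>i. smooth_map_on S (\<lambda>x. f x $ i)"
  shows "smooth_map_on S f"
  unfolding smooth_map_on_def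
proof
  fix k
  show "Ck_on k f S"
  proof (rule Ck_on_componentwise[OF assms(1)])
    fix b :: "'b^'n" assume "b \<in> Basis"
    then obtain j e where b: "b = axis j e" by (auto simp: Basis_vec_def)
    have "smooth_map_on S (\<lambda>x. f x $ j \<bullet> e)"
      by (rule smooth_bounded_linear_compose[OF bounded_linear_inner_left assms(1) assms(2)])
    then show "Ck_on k (\<lambda>x. f x \<bullet> b) S"
      by (simp add: b smooth_map_on_def inner_axis)
  qed
qed

lemma smooth_inverse:
  fixes f :: "'a::real_normed_vector \<Rightarrow> real"
  assumes "open S" "smooth_map_on S f" "\<And>x. x \<in> S \<Longrightarrow> f x \<noteq> 0"
  shows "smooth_map_on S (\<lambda>x. inverse (f x))"
  by (rule smooth_compose[of S "{x. x \<noteq> 0}" f inverse])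
     (use assms in \<open>auto simp: smooth_map_on_def Ck_on_inverse open_Collect_neq\<close>)

lemma smooth_divide:
  fixes f g :: "'a::real_normed_vector \<Rightarrow> real"
  assumes "open S" "smooth_map_on S f" "smooth_map_on S g" "\<And>x. x \<in> S \<Longrightarrow> g x \<noteq> 0"
  shows "smooth_map_on S (\<lambda>x. f x / g x)"
  unfolding divide_inverse by (intro smooth_mult smooth_inverse assms)

lemma smooth_exp:
  fixes f :: "'a::real_normed_vector \<Rightarrow> real"
  assumes "open S" "smooth_map_on S f"
  shows "smooth_map_on S (\<lambda>x. exp (f x))"
  by (rule smooth_compose[of S UNIV f exp]) (use assms in \<open>auto simp: smooth_map_on_def Ck_on_exp\<close>)

lemma smooth_ln:
  fixes f :: "'a::real_normed_vector \<Rightarrow> real"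
  assumes "open S" "smooth_map_on S f" "\<And>x. x \<in> S \<Longrightarrow> f x > 0"
  shows "smooth_map_on S (\<lambda>x. ln (f x))"
  by (rule smooth_compose[of S "{0<..}" f ln]) (use assms in \<open>auto simp: smooth_map_on_def Ck_on_ln\<close>)

lemma smooth_powr:
  fixes f g :: "'a::real_normed_vector \<Rightarrow> real"
  assumes "open S" "smooth_map_on S f" "smooth_map_on S g" "\<And>x. x \<in> S \<Longrightarrow> f x > 0"
  shows "smooth_map_on S (\<lambda>x. f x powr g x)"
proof (rule smooth_cong[OF assms(1)])
  show "smooth_map_on S (\<lambda>x. exp (g x * ln (f x)))" by (intro smooth_exp smooth_mult smooth_ln assms)
qed (use assms(4) in \<open>force simp: powr_def\<close>)

lemma smooth_sqrt:
  fixes f :: "'a::real_normed_vector \<Rightarrow> real"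
  assumes "open S" "smooth_map_on S f" "\<And>x. x \<in> S \<Longrightarrow> f x > 0"
  shows "smooth_map_on S (\<lambda>x. sqrt (f x))"
proof (rule smooth_cong[OF assms(1)])
  show "smooth_map_on S (\<lambda>x. f x powr (1/2))" by (intro smooth_powr smooth_const assms)
qed (use assms(3) in \<open>force simp: powr_half_sqrt\<close>)

lemma smooth_fst: "smooth_map_on S fst" and smooth_snd: "smooth_map_on S snd"
  by (auto intro: smooth_bounded_linear bounded_linear_fst bounded_linear_snd)

section \<open>Linear integral equations along rays, with parameters\<close>

lemma continuous_integral_param:
  fixes g :: "real \<times> 't::euclidean_space \<Rightarrow> 'e::euclidean_space"
  assumes "continuous_on ({0..1} \<times> Q) g"
  shows "continuous_on Q (\<lambda>\<theta>. integral {0..1} (\<lambda>s. g (s, \<theta>)))"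
proof -
  have "continuous_on (Q \<times> cbox 0 1) (\<lambda>(x, t). g (t, x))"
    unfolding split_beta by (rule continuous_on_compose2[OF assms]) (auto intro!: continuous_intros)
  from integral_continuous_on_param[OF this] show ?thesis by simp
qed

lemma has_derivative_integral_param:
  fixes g :: "real \<times> 't::euclidean_space \<Rightarrow> 'e::euclidean_space"
  assumes "open Q" "\<theta> \<in> Q"
    and d: "\<And>w. w \<in> {0..1} \<times> Q \<Longrightarrow> (g has_derivative g' w) (at w)"
    and c: "\<And>v. continuous_on ({0..1} \<times> Q) (\<lambda>w. g' w (0, v))"
  shows "((\<lambda>\<theta>. integral {0..1} (\<lambda>s. g (s, \<theta>))) has_derivative
      (\<lambda>v. integral {0..1} (\<lambda>s. g' (s, \<theta>) (0, v)))) (at \<theta>)"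
proof -
  obtain r where r: "r > 0" "ball \<theta> r \<subseteq> Q" using assms(1,2) open_contains_ball by blast
  define G where "G x s = Blinfun (\<lambda>v. g' (s, x) (0, v))" for x s
  have bl: "bounded_linear (\<lambda>v. g' (s, x) (0, v))" if "x \<in> Q" "s \<in> {0..1}" for x s
    using bounded_linear_compose[OF has_derivative_bounded_linear[OF d] bounded_linear_Pair[OF bounded_linear_zero bounded_linear_ident]]
      that by auto
  have G: "blinfun_apply (G x s) v = g' (s, x) (0, v)" if "x \<in> Q" "s \<in> {0..1}" for x s v
    using bounded_linear_Blinfun_apply[OF bl[OF that]] by (simp add: G_def)
  \<comment> \<open>The Leibniz rule wants the derivative as a continuous family of operators, while
    assumption \<open>c\<close> gives continuity for one direction at a time. In finite dimension
    checking the basis directions suffices.\<close>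
  have cG: "continuous_on (ball \<theta> r \<times> cbox 0 1) (\<lambda>(x, s). G x s)"
  proof (rule continuous_on_blinfun_componentwise)
    fix i :: 't
    have "continuous_on (ball \<theta> r \<times> cbox 0 1) (\<lambda>w. g' (snd w, fst w) (0, i))"
      by (rule continuous_on_compose2[OF c]) (use r in \<open>auto intro!: continuous_intros\<close>)
    then show "continuous_on (ball \<theta> r \<times> cbox 0 1) (\<lambda>w. blinfun_apply (case w of (x, s) \<Rightarrow> G x s) i)"
      by (rule continuous_on_eq) (use r in \<open>auto simp: G split_beta\<close>)
  qed
  have dx: "((\<lambda>x. g (s, x)) has_derivative (\<lambda>v. g' (s, x) (0, v))) (at x)" if "x \<in> Q" "s \<in> {0..1}" for x s
  proof -
    have "((\<lambda>x. (s, x)) has_derivative (\<lambda>v. (0, v))) (at x)"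
      by (auto intro!: derivative_eq_intros)
    from has_derivative_compose[OF this d] that show ?thesis by simp
  qed
  have cg: "continuous_on ({0..1} \<times> Q) g"
    using d by (meson continuous_at_imp_continuous_on has_derivative_continuous)
  have cgx: "continuous_on {0..1} (\<lambda>s. g (s, x))" if "x \<in> Q" for x
    by (rule continuous_on_compose2[OF cg]) (use that in \<open>auto intro!: continuous_intros\<close>)
  have "((\<lambda>x. integral (cbox 0 1) (\<lambda>s. g (s, x))) has_derivative blinfun_apply (integral (cbox 0 1) (G \<theta>)))
      (at \<theta> within ball \<theta> r)"
  proof (rule leibniz_rule[OF _ _ cG])
    fix x s assume "x \<in> ball \<theta> r" "s \<in> cbox (0::real) 1"
    then have x: "x \<in> Q" "s \<in> {0..1}" using r by auto
    have "blinfun_apply (G x s) = (\<lambda>v. g' (s, x) (0, v))" using G[OF x] by auto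
    then show "((\<lambda>x. g (s, x)) has_derivative blinfun_apply (G x s)) (at x within ball \<theta> r)"
      using dx[OF x] has_derivative_at_withinI by metis
  next
    fix x assume "x \<in> ball \<theta> r"
    then show "(\<lambda>s. g (s, x)) integrable_on cbox 0 1" using cgx[of x] r integrable_continuous_real[of 0 1 "\<lambda>s. g (s, x)"] by auto
  qed (use r in auto)
  moreover have "blinfun_apply (integral (cbox 0 1) (G \<theta>)) = (\<lambda>v. integral {0..1} (\<lambda>s. g' (s, \<theta>) (0, v)))"
  proof
    fix v
    have "continuous_on (cbox 0 1) (\<lambda>s. (\<lambda>(x, s). G x s) (\<theta>, s))"
      by (rule continuous_on_compose2[OF cG]) (use r in \<open>auto intro!: continuous_intros\<close>)
    then have "G \<theta> integrable_on cbox 0 1" by (intro integrable_continuous) auto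
    then have "blinfun_apply (integral (cbox 0 1) (G \<theta>)) v = integral (cbox 0 1) (\<lambda>s. blinfun_apply (G \<theta> s) v)"
      by (rule blinfun_apply_integral)
    also have "\<dots> = integral {0..1} (\<lambda>s. g' (s, \<theta>) (0, v))"
      using G[OF assms(2)] by (auto intro: integral_cong)
    finally show "blinfun_apply (integral (cbox 0 1) (G \<theta>)) v = integral {0..1} (\<lambda>s. g' (s, \<theta>) (0, v))" .
  qed
  ultimately show ?thesis using r(1) by (simp add: at_within_open[of \<theta> "ball \<theta> r"])
qed

text \<open>Because \<open>{0..1} \<times> Q\<close> is not open, g lives on a larger set D on which
  its derivatives in all variables are controlled. Differentiating under the integral replaces g by
  its derivative in direction \<open>(0, v)\<close>, so the claim reproduces itself one level
  lower.\<close>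

lemma Ck_on_integral:
  fixes g :: "real \<times> 't::euclidean_space \<Rightarrow> 'e::euclidean_space"
  assumes "open Q" "{0..1} \<times> Q \<subseteq> D" "Ck_on k g D"
  shows "Ck_on k (\<lambda>\<theta>. integral {0..1} (\<lambda>s. g (s, \<theta>))) Q"
  using assms(3)
proof (induction k arbitrary: g)
  case 0
  then show ?case using continuous_integral_param continuous_on_subset[OF _ assms(2)] by auto
next
  case (Suc k)
  have d: "((\<lambda>\<theta>. integral {0..1} (\<lambda>s. g (s, \<theta>))) has_derivative
      (\<lambda>v. integral {0..1} (\<lambda>s. FD g (s, \<theta>) (0, v)))) (at \<theta>)" if "\<theta> \<in> Q" for \<theta>
  proof (rule has_derivative_integral_param[OF assms(1) that])
    fix v
    have "Ck_on k (\<lambda>w. FD g w (0, v)) D" using Suc.prems by auto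
    then show "continuous_on ({0..1} \<times> Q) (\<lambda>w. FD g w (0, v))"
      using Ck_on_imp_continuous continuous_on_subset[OF _ assms(2)] by blast
  qed (use Ck_on_Suc_has_derivative[OF Suc.prems] assms(2) in blast)
  have "Ck_on k (\<lambda>\<theta>. FD (\<lambda>\<theta>. integral {0..1} (\<lambda>s. g (s, \<theta>))) \<theta> v) Q" for v
    by (rule Ck_on_cong[OF assms(1) _ Suc.IH[of "\<lambda>w. FD g w (0, v)"]])
       (use FD_eqI[OF d] Suc.prems in auto)
  then show ?case using d by (auto simp: differentiable_def)
qed

text \<open>Each directional derivative is continuous, hence bounded on the compact set; the bounds
  for the finitely many basis directions add up to one operator bound.\<close>

lemma Ck_on_Suc_bounded_on_compact:
  fixes g :: "'a::euclidean_space \<Rightarrow> 'b::real_normed_vector"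
  assumes "Ck_on (Suc k) g D" "compact Q" "Q \<subseteq> D"
  obtains c where "c \<ge> 0" "\<And>w v. w \<in> Q \<Longrightarrow> norm (FD g w v) \<le> c * norm v"
proof -
  have "\<exists>B. \<forall>w\<in>Q. norm (FD g w b) \<le> B" for b
  proof -
    have "continuous_on Q (\<lambda>w. FD g w b)"
      using assms(1,3) Ck_on_imp_continuous continuous_on_subset by (metis Ck_on.simps(2))
    then have "bounded ((\<lambda>w. FD g w b) ` Q)" using assms(2) compact_continuous_image compact_imp_bounded by blast
    then show ?thesis by (auto simp: bounded_iff)
  qed
  then obtain B where B: "\<And>b w. w \<in> Q \<Longrightarrow> norm (FD g w b) \<le> B b" by metis
  define c where "c = (\<Sum>b\<in>(Basis::'a set). \<bar>B b\<bar>)"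
  have "norm (FD g w v) \<le> c * norm v" if "w \<in> Q" for w v
  proof -
    have "linear (FD g w)" using assms that by (auto intro: linear_frechet_derivative)
    then have "FD g w (\<Sum>b\<in>Basis. (v \<bullet> b) *\<^sub>R b) = (\<Sum>b\<in>Basis. (v \<bullet> b) *\<^sub>R FD g w b)"
      by (simp add: linear_sum linear_scale)
    then have "norm (FD g w v) = norm (\<Sum>b\<in>Basis. (v \<bullet> b) *\<^sub>R FD g w b)"
      by (simp add: euclidean_representation)
    also have "\<dots> \<le> (\<Sum>b\<in>Basis. norm v * \<bar>B b\<bar>)"
    proof (rule sum_norm_le)
      fix b :: 'a assume "b \<in> Basis"
      then have "\<bar>v \<bullet> b\<bar> \<le> norm v" by (rule Basis_le_norm)
      moreover have "norm (FD g w b) \<le> \<bar>B b\<bar>" using B[OF that, of b] by linarith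
      ultimately show "norm ((v \<bullet> b) *\<^sub>R FD g w b) \<le> norm v * \<bar>B b\<bar>" by (simp add: mult_mono)
    qed
    finally show ?thesis by (simp add: c_def sum_distrib_left mult.commute)
  qed
  then show ?thesis using that[of c] by (simp add: c_def sum_nonneg)
qed

text \<open>The assumption \<open>0 \<le> m\<close> takes care of non-integrable g, whose integral
  is 0 by convention.\<close>

lemma norm_integral_unit_le:
  fixes g :: "real \<Rightarrow> 'b::banach"
  assumes "\<And>s. s \<in> {0..1} \<Longrightarrow> norm (g s) \<le> m" "0 \<le> m"
  shows "norm (integral {0..1} g) \<le> m"
proof (cases "g integrable_on {0..1}")
  case True
  then show ?thesis using integrable_bound[of m g 0 1] assms by simp
qed (use assms in \<open>simp add: not_integrable_integral\<close>)

lemma Ck_on_FD: "Ck_on (Suc k) f S \<Longrightarrow> Ck_on k (\<lambda>x. FD f x v) S"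
  unfolding Ck_on.simps by blast

lemma Ck_on_SucI:
  assumes "\<And>x. x \<in> S \<Longrightarrow> (f has_derivative f' x) (at x)" "\<And>v. Ck_on k (\<lambda>x. FD f x v) S"
  shows "Ck_on (Suc k) f S"
  unfolding Ck_on.simps differentiable_def using assms by blast

lemma C1_FD_continuous: "Ck_on 1 f S \<Longrightarrow> continuous_on S (\<lambda>x. FD f x v)"
  unfolding One_nat_def Ck_on.simps by blast

section \<open>Rays, tubes and the integral operator along rays\<close>

definition ray :: "real \<times> ('p \<times> 'z::real_vector) \<Rightarrow> 'p \<times> 'z" where
  "ray w = (fst (snd w), fst w *\<^sub>R snd (snd w))"

definition tube :: "'p set \<Rightarrow> real \<Rightarrow> ('p \<times> 'z::real_normed_vector) set" where
  "tube X \<rho> = X \<times> ball 0 \<rho>"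

text \<open>For open X this is an open neighbourhood of
  \<open>{0..1} \<times> tube X \<rho>\<close>, so that kernels can be differentiated in the ray
  parameter as well, also at its end points.\<close>

definition ray_dom :: "'p set \<Rightarrow> real \<Rightarrow> (real \<times> ('p \<times> 'z::real_normed_vector)) set" where
  "ray_dom X \<rho> = {w. snd w \<in> tube X \<rho> \<and> ray w \<in> tube X \<rho>}"

lemma ray_has_derivative:
  "(ray has_derivative (\<lambda>v. (fst (snd v), fst w *\<^sub>R snd (snd v) + fst v *\<^sub>R snd (snd w)))) (at w)"
  for w :: "real \<times> ('p::real_normed_vector \<times> 'z::real_normed_vector)"
  unfolding ray_def by (auto intro!: derivative_eq_intros)

lemma continuous_on_ray: "continuous_on S (ray :: real \<times> ('p::real_normed_vector \<times> 'z::real_normed_vector) \<Rightarrow> _)"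
  unfolding ray_def by (auto intro!: continuous_intros)

lemma smooth_ray: "open S \<Longrightarrow> smooth_map_on S (ray :: real \<times> ('p::real_normed_vector \<times> 'z::real_normed_vector) \<Rightarrow> _)"
  unfolding ray_def
  by (intro smooth_Pair smooth_scaleR smooth_bounded_linear)
     (auto intro: bounded_linear_compose bounded_linear_fst bounded_linear_snd)

lemma open_tube: "open X \<Longrightarrow> open (tube X \<rho> :: ('p::real_normed_vector \<times> 'z::real_normed_vector) set)"
  unfolding tube_def by (intro open_Times) auto

lemma open_ray_dom:
  assumes "open X"
  shows "open (ray_dom X \<rho> :: (real \<times> ('p::real_normed_vector \<times> 'z::real_normed_vector)) set)"
proof -
  have "ray_dom X \<rho> = snd -` (tube X \<rho> :: ('p \<times> 'z) set) \<inter> ray -` tube X \<rho>" by (auto simp: ray_dom_def)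
  moreover have "continuous_on UNIV (ray :: real \<times> ('p \<times> 'z) \<Rightarrow> _)" by (rule continuous_on_ray)
  ultimately show ?thesis using open_tube[OF assms] by (auto intro!: open_Int open_vimage continuous_intros)
qed

lemma ray_tube: "s \<in> {0..1} \<Longrightarrow> \<theta> \<in> tube X \<rho> \<Longrightarrow> ray (s, \<theta>) \<in> tube X \<rho>"
proof -
  assume a: "s \<in> {0..1}" "\<theta> \<in> tube X \<rho>"
  have "norm (s *\<^sub>R snd \<theta>) \<le> norm (snd \<theta>)" using a(1) by (simp add: mult_left_le_one_le)
  then show ?thesis using a by (auto simp: tube_def ray_def)
qed

lemma ray_dom_sub: "{0..1} \<times> tube X \<rho> \<subseteq> ray_dom X \<rho>"
  by (auto simp: ray_dom_def intro!: ray_tube)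

text \<open>When \<open>L (s, \<theta>)\<close> is the radial coefficient of a linear system at the
  point \<open>ray (s, \<theta>)\<close>, the equation \<open>U = f + ray_op pr L U\<close> is the
  integrated form of the system along all rays at once, each ray being rescaled to the unit
  interval.\<close>

definition ray_op ::
  "('l \<Rightarrow> 'e \<Rightarrow> 'e::euclidean_space) \<Rightarrow> (real \<times> ('p \<times> 'z::euclidean_space) \<Rightarrow> 'l) \<Rightarrow> ('p \<times> 'z \<Rightarrow> 'e) \<Rightarrow> 'p \<times> 'z \<Rightarrow> 'e" where
  "ray_op pr L U \<theta> = integral {0..1} (\<lambda>s. pr (L (s, \<theta>)) (U (ray (s, \<theta>))))"

text \<open>Makes \<open>ray_op\<close> halve sup norms, so that Neumann series are dominated by
  geometric series of ratio 1/2. Tubes are later chosen thin enough to ensure it.\<close>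

definition half_bounded :: "('l \<Rightarrow> 'e \<Rightarrow> 'e::real_normed_vector) \<Rightarrow> (real \<times> 't \<Rightarrow> 'l) \<Rightarrow> 't set \<Rightarrow> bool" where
  "half_bounded pr L Q \<longleftrightarrow> (\<forall>s\<in>{0..1}. \<forall>\<theta>\<in>Q. \<forall>e. norm (pr (L (s, \<theta>)) e) \<le> norm e / 2)"

text \<open>The product is abstract because two instances occur: multiplication of matrices for the
  frame of the sphere map, and \<open>l ** e + e ** transpose l\<close> for its Gram matrix.\<close>

locale ray_equation = bounded_bilinear pr
  for pr :: "'l::real_normed_vector \<Rightarrow> 'e::euclidean_space \<Rightarrow> 'e"
begin

lemma integrand_continuous:
  fixes X :: "'p::euclidean_space set"
  assumes "continuous_on (ray_dom X \<rho>) L" "continuous_on (tube X \<rho>) U"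
  shows "continuous_on (ray_dom X \<rho>) (\<lambda>w. pr (L w) (U (ray w)))"
  by (intro continuous_on assms continuous_on_compose2[OF assms(2) continuous_on_ray])
     (auto simp: ray_dom_def)

lemma integrand_s_continuous:
  fixes X :: "'p::euclidean_space set"
  assumes "continuous_on (ray_dom X \<rho>) L" "continuous_on (tube X \<rho>) U" "\<theta> \<in> tube X \<rho>"
  shows "continuous_on {0..1} (\<lambda>s. pr (L (s, \<theta>)) (U (ray (s, \<theta>))))"
proof (rule continuous_on_compose2[OF integrand_continuous[OF assms(1,2)]])
  show "(\<lambda>s. (s, \<theta>)) ` {0..1} \<subseteq> ray_dom X \<rho>" using ray_dom_sub assms(3) by blast
qed (auto intro!: continuous_intros)

lemma ray_op_continuous:
  fixes X :: "'p::euclidean_space set"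
  assumes "continuous_on (ray_dom X \<rho>) L" "continuous_on (tube X \<rho>) U"
  shows "continuous_on (tube X \<rho>) (ray_op pr L U)"
  unfolding ray_op_def
  by (rule continuous_integral_param[of "tube X \<rho>" "\<lambda>w. pr (L w) (U (ray w))"])
     (rule continuous_on_subset[OF integrand_continuous[OF assms] ray_dom_sub])

lemma ray_op_bound:
  fixes X :: "'p::euclidean_space set"
  assumes "continuous_on (ray_dom X \<rho>) L" "continuous_on (tube X \<rho>) U" "half_bounded pr L (tube X \<rho>)"
    and "\<And>\<theta>. \<theta> \<in> tube X \<rho> \<Longrightarrow> norm (U \<theta>) \<le> M" "\<theta> \<in> tube X \<rho>"
  shows "norm (ray_op pr L U \<theta>) \<le> M / 2"
proof -
  have "norm (pr (L (s, \<theta>)) (U (ray (s, \<theta>)))) \<le> M / 2" if "s \<in> {0..1}" for s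
    using assms(3)[unfolded half_bounded_def, rule_format, OF that assms(5), of "U (ray (s, \<theta>))"]
      assms(4)[OF ray_tube[OF that assms(5)]] by linarith
  then have "norm (integral {0..1} (\<lambda>s. pr (L (s, \<theta>)) (U (ray (s, \<theta>))))) \<le> M / 2 * (1 - 0)"
    by (intro integral_bound integrand_s_continuous[OF assms(1,2,5)]) auto
  then show ?thesis by (simp add: ray_op_def)
qed

lemma ray_op_diff:
  fixes X :: "'p::euclidean_space set"
  assumes "continuous_on (ray_dom X \<rho>) L" "continuous_on (tube X \<rho>) U" "continuous_on (tube X \<rho>) V" "\<theta> \<in> tube X \<rho>"
  shows "ray_op pr L (\<lambda>\<theta>. U \<theta> - V \<theta>) \<theta> = ray_op pr L U \<theta> - ray_op pr L V \<theta>"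
  unfolding ray_op_def diff_right
  by (rule integral_diff) (intro integrable_continuous_real integrand_s_continuous[OF assms(1) _ assms(4)] assms)+

lemma ray_op_add:
  fixes X :: "'p::euclidean_space set"
  assumes "continuous_on (ray_dom X \<rho>) L" "continuous_on (tube X \<rho>) U" "continuous_on (tube X \<rho>) V" "\<theta> \<in> tube X \<rho>"
  shows "ray_op pr L (\<lambda>\<theta>. U \<theta> + V \<theta>) \<theta> = ray_op pr L U \<theta> + ray_op pr L V \<theta>"
  unfolding ray_op_def add_right
  by (rule integral_add) (intro integrable_continuous_real integrand_s_continuous[OF assms(1) _ assms(4)] assms)+

lemma Ck_on_ray_op:
  fixes X :: "'p::euclidean_space set"
  assumes "open X" "Ck_on k L (ray_dom X \<rho>)" "Ck_on k U (tube X \<rho>)"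
  shows "Ck_on k (ray_op pr L U) (tube X \<rho>)"
  unfolding ray_op_def
proof (rule Ck_on_integral[of "tube X \<rho>" "ray_dom X \<rho>" k "\<lambda>w. pr (L w) (U (ray w))"])
  show "Ck_on k (\<lambda>w. pr (L w) (U (ray w))) (ray_dom X \<rho>)"
    by (intro Ck_on_bilinear[OF bounded_bilinear_axioms] open_ray_dom assms
        Ck_on_compose[OF _ open_tube[OF assms(1)] _ _ assms(3)])
       (use smooth_ray[OF open_ray_dom[OF assms(1)]] in \<open>auto simp: smooth_map_on_def ray_dom_def\<close>)
qed (use open_tube[OF assms(1)] in \<open>auto intro!: ray_dom_sub\<close>)

text \<open>The difference of two solutions is a fixed point of \<open>ray_op\<close>, so its bound
  \<open>2 * M\<close> may be halved arbitrarily often.\<close>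

lemma ray_equation_unique:
  fixes X :: "'p::euclidean_space set"
  assumes L: "continuous_on (ray_dom X \<rho>) L" "half_bounded pr L (tube X \<rho>)"
    and U: "continuous_on (tube X \<rho>) U" "\<And>\<theta>. \<theta> \<in> tube X \<rho> \<Longrightarrow> norm (U \<theta>) \<le> M" "\<And>\<theta>. \<theta> \<in> tube X \<rho> \<Longrightarrow> U \<theta> = f \<theta> + ray_op pr L U \<theta>"
    and V: "continuous_on (tube X \<rho>) V" "\<And>\<theta>. \<theta> \<in> tube X \<rho> \<Longrightarrow> norm (V \<theta>) \<le> M" "\<And>\<theta>. \<theta> \<in> tube X \<rho> \<Longrightarrow> V \<theta> = f \<theta> + ray_op pr L V \<theta>"
    and \<theta>: "\<theta> \<in> tube X \<rho>"
  shows "U \<theta> = V \<theta>"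
proof -
  define W where "W \<theta> = U \<theta> - V \<theta>" for \<theta>
  have W: "continuous_on (tube X \<rho>) W" unfolding W_def by (intro continuous_intros U V)
  have "norm (W \<theta>) \<le> 2 * M / 2 ^ n" if "\<theta> \<in> tube X \<rho>" for n \<theta>
    using that
  proof (induction n arbitrary: \<theta>)
    case 0
    then show ?case using U(2)[OF 0] V(2)[OF 0] norm_triangle_ineq4[of "U \<theta>" "V \<theta>"] by (simp add: W_def)
  next
    case (Suc n)
    have "norm (ray_op pr L W \<theta>) \<le> 2 * M / 2 ^ n / 2"
      by (rule ray_op_bound[OF L(1) W L(2) Suc.IH Suc.prems])
    moreover have "W \<theta> = ray_op pr L W \<theta>"
      using U(3) V(3) Suc.prems ray_op_diff[OF L(1) U(1) V(1) Suc.prems] by (simp add: W_def[abs_def])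
    ultimately show ?case by (simp add: mult.commute)
  qed
  then have b: "norm (W \<theta>) \<le> 2 * M / 2 ^ n" for n using \<theta> by blast
  have "(\<lambda>n. 2 * M * (1/2) ^ n) \<longlonglongrightarrow> 2 * M * 0" by (intro tendsto_intros LIMSEQ_power_zero) auto
  then have "norm (W \<theta>) \<le> 0"
    using b by (intro LIMSEQ_le_const[of "\<lambda>n. 2 * M * (1/2) ^ n"]) (auto simp: power_one_over divide_simps)
  then show ?thesis by (simp add: W_def)
qed

primrec neumann :: "(real \<times> ('p::euclidean_space \<times> 'z::euclidean_space) \<Rightarrow> 'l) \<Rightarrow> ('p \<times> 'z \<Rightarrow> 'e) \<Rightarrow> nat \<Rightarrow> 'p \<times> 'z \<Rightarrow> 'e" where
  "neumann L f 0 = f"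
| "neumann L f (Suc n) = ray_op pr L (neumann L f n)"

lemma neumann_continuous:
  assumes "continuous_on (ray_dom X \<rho>) L" "continuous_on (tube X \<rho>) f"
  shows "continuous_on (tube X \<rho>) (neumann L f n)"
  by (induction n) (auto intro!: ray_op_continuous assms)

lemma neumann_bound:
  assumes "continuous_on (ray_dom X \<rho>) L" "half_bounded pr L (tube X \<rho>)"
    and "continuous_on (tube X \<rho>) f" "\<And>\<theta>. \<theta> \<in> tube X \<rho> \<Longrightarrow> norm (f \<theta>) \<le> M" "\<theta> \<in> tube X \<rho>"
  shows "norm (neumann L f n \<theta>) \<le> M / 2 ^ n"
  using assms(5)
proof (induction n arbitrary: \<theta>)
  case (Suc n)
  have "norm (ray_op pr L (neumann L f n) \<theta>) \<le> M / 2 ^ n / 2"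
    by (rule ray_op_bound[OF assms(1) neumann_continuous[OF assms(1,3)] assms(2) Suc.IH Suc.prems])
  then show ?case by (simp add: mult.commute)
qed (use assms(4) in auto)

text \<open>Since \<open>neumann L f n\<close> is the n-th term of the series, its partial sums
  satisfy \<open>S (Suc n) = f + ray_op pr L (S n)\<close>. They converge uniformly, and the norm
  bound on \<open>ray_op\<close> lets it pass to the limit.\<close>

lemma neumann_solution:
  fixes X :: "'p::euclidean_space set" and f :: "'p \<times> 'z::euclidean_space \<Rightarrow> 'e"
  assumes L: "continuous_on (ray_dom X \<rho>) L" "half_bounded pr L (tube X \<rho>)"
    and f: "continuous_on (tube X \<rho>) f" "\<And>\<theta>. \<theta> \<in> tube X \<rho> \<Longrightarrow> norm (f \<theta>) \<le> M"
  obtains U where "continuous_on (tube X \<rho>) U" "\<And>\<theta>. \<theta> \<in> tube X \<rho> \<Longrightarrow> norm (U \<theta>) \<le> 2 * M"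
    "\<And>\<theta>. \<theta> \<in> tube X \<rho> \<Longrightarrow> U \<theta> = f \<theta> + ray_op pr L U \<theta>"
    "\<And>\<theta>. \<theta> \<in> tube X \<rho> \<Longrightarrow> (\<lambda>n. neumann L f n \<theta>) sums U \<theta>"
proof -
  define U where "U \<theta> = (\<Sum>n. neumann L f n \<theta>)" for \<theta>
  define S where "S n \<theta> = (\<Sum>i<n. neumann L f i \<theta>)" for n \<theta>
  have g: "(\<lambda>n. M / 2 ^ n) sums (2 * M)"
    using sums_mult[OF geometric_sums[of "1/2::real"], of M] by (simp add: power_one_over field_simps)
  have nb: "norm (neumann L f n \<theta>) \<le> M / 2 ^ n" if "\<theta> \<in> tube X \<rho>" for n \<theta>
    by (rule neumann_bound[OF L f that])
  have ul: "uniform_limit (tube X \<rho>) S U sequentially"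
    unfolding S_def[abs_def] U_def[abs_def]
    by (rule Weierstrass_m_test[OF nb sums_summable[OF g]])
  have cS: "continuous_on (tube X \<rho>) (S n)" for n
    unfolding S_def by (intro continuous_intros neumann_continuous[OF L(1) f(1)])
  have cU: "continuous_on (tube X \<rho>) U"
    by (rule uniform_limit_theorem[OF _ ul]) (use cS in auto)
  have s: "(\<lambda>n. neumann L f n \<theta>) sums U \<theta>" if "\<theta> \<in> tube X \<rho>" for \<theta>
    unfolding U_def using summable_comparison_test'[OF sums_summable[OF g] nb[OF that]] by (rule summable_sums)
  have bU: "norm (U \<theta>) \<le> 2 * M" if "\<theta> \<in> tube X \<rho>" for \<theta>
    unfolding U_def sums_unique[OF g]
    by (rule norm_suminf_le[OF nb[OF that] sums_summable[OF g]])
  have Ssuc: "S (Suc n) \<theta> = f \<theta> + ray_op pr L (S n) \<theta>" if "\<theta> \<in> tube X \<rho>" for n \<theta>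
  proof (induction n)
    case 0
    then show ?case by (simp add: S_def ray_op_def zero_right)
  next
    case (Suc n)
    have e: "S (Suc n) = (\<lambda>\<theta>. S n \<theta> + neumann L f n \<theta>)" for n by (auto simp: S_def)
    have "ray_op pr L (S (Suc n)) \<theta> = ray_op pr L (S n) \<theta> + neumann L f (Suc n) \<theta>"
      unfolding e using ray_op_add[OF L(1) cS neumann_continuous[OF L(1) f(1)] that] by simp
    then show ?case using Suc e[of "Suc n"] by simp
  qed
  have eq: "U \<theta> = f \<theta> + ray_op pr L U \<theta>" if "\<theta> \<in> tube X \<rho>" for \<theta>
  proof (rule LIMSEQ_unique)
    show "(\<lambda>n. S (Suc n) \<theta>) \<longlonglongrightarrow> U \<theta>"
      using s[OF that] unfolding sums_def S_def by (rule LIMSEQ_Suc)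
    have "(\<lambda>n. ray_op pr L (S n) \<theta>) \<longlonglongrightarrow> ray_op pr L U \<theta>"
    proof (rule LIMSEQ_I)
      fix r :: real assume "r > 0"
      then have "\<forall>\<^sub>F n in sequentially. \<forall>x\<in>tube X \<rho>. dist (S n x) (U x) < r"
        using ul unfolding uniform_limit_iff by blast
      then obtain N where N: "\<And>n x. n \<ge> N \<Longrightarrow> x \<in> tube X \<rho> \<Longrightarrow> norm (S n x - U x) < r"
        by (auto simp: eventually_sequentially dist_norm)
      have "norm (ray_op pr L (S n) \<theta> - ray_op pr L U \<theta>) < r" if "n \<ge> N" for n
      proof -
        have "norm (ray_op pr L (\<lambda>\<theta>. S n \<theta> - U \<theta>) \<theta>) \<le> r / 2"
          by (rule ray_op_bound[OF L(1) _ L(2) _ \<open>\<theta> \<in> tube X \<rho>\<close>])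
             (use N[OF that] in \<open>auto intro!: continuous_intros cS cU less_imp_le\<close>)
        then show ?thesis using \<open>r > 0\<close> ray_op_diff[OF L(1) cS cU \<open>\<theta> \<in> tube X \<rho>\<close>] by simp
      qed
      then show "\<exists>N. \<forall>n\<ge>N. norm (ray_op pr L (S n) \<theta> - ray_op pr L U \<theta>) < r" by blast
    qed
    then show "(\<lambda>n. S (Suc n) \<theta>) \<longlonglongrightarrow> f \<theta> + ray_op pr L U \<theta>"
      using Ssuc[OF that] by (auto intro: tendsto_intros)
  qed
  show ?thesis by (rule that[OF cU bU eq s])
qed

section \<open>Differentiability of solutions of the ray equation\<close>

lemma ray_op_has_derivative:
  fixes X :: "'p::euclidean_space set"
  assumes "open X" "Ck_on 1 L (ray_dom X \<rho>)" "Ck_on 1 U (tube X \<rho>)" "\<theta> \<in> tube X \<rho>"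
  shows "(ray_op pr L U has_derivative (\<lambda>v. integral {0..1} (\<lambda>s.
      pr (L (s, \<theta>)) (FD U (ray (s, \<theta>)) (fst v, s *\<^sub>R snd v)) + pr (FD L (s, \<theta>) (0, v)) (U (ray (s, \<theta>)))))) (at \<theta>)"
proof -
  define g' where "g' w v = pr (L w) (FD U (ray w) (fst (snd v), fst w *\<^sub>R snd (snd v) + fst v *\<^sub>R snd (snd w)))
      + pr (FD L w v) (U (ray w))" for w v
  note L1 = assms(2)[unfolded One_nat_def] and U1 = assms(3)[unfolded One_nat_def]
  have d: "((\<lambda>w. pr (L w) (U (ray w))) has_derivative g' w) (at w)" if "w \<in> ray_dom X \<rho>" for w
    unfolding g'_def
    by (rule FDERIV[OF Ck_on_Suc_has_derivative[OF L1 that]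
        has_derivative_compose[OF ray_has_derivative Ck_on_Suc_has_derivative[OF U1]]])
       (use that in \<open>simp add: ray_dom_def\<close>)
  have "((\<lambda>\<theta>. integral {0..1} (\<lambda>s. pr (L (s, \<theta>)) (U (ray (s, \<theta>))))) has_derivative
      (\<lambda>v. integral {0..1} (\<lambda>s. g' (s, \<theta>) (0, v)))) (at \<theta>)"
  proof (rule has_derivative_integral_param[of "tube X \<rho>" \<theta> "\<lambda>w. pr (L w) (U (ray w))", OF open_tube[OF assms(1)] assms(4)])
    fix w :: "real \<times> 'p \<times> 'a"
    assume "w \<in> {0..1} \<times> tube X \<rho>"
    then show "((\<lambda>w. pr (L w) (U (ray w))) has_derivative g' w) (at w)" using d ray_dom_sub by blast
  next
    fix v :: "'p \<times> 'a"
    \<comment> \<open>The direction in which U is differentiated depends on the ray parameter;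
      splitting it leaves two fixed directions, for which continuity of the derivative is
      available.\<close>
    have e: "FD U (ray w) (fst v, fst w *\<^sub>R snd v) = FD U (ray w) (fst v, 0) + fst w *\<^sub>R FD U (ray w) (0, snd v)"
      if "w \<in> ray_dom X \<rho>" for w
    proof -
      have "linear (FD U (ray w))" using U1 that by (auto simp: ray_dom_def intro: linear_frechet_derivative)
      then have "FD U (ray w) ((fst v, 0) + fst w *\<^sub>R (0, snd v)) = FD U (ray w) (fst v, 0) + fst w *\<^sub>R FD U (ray w) (0, snd v)"
        by (simp only: linear_add linear_scale)
      then show ?thesis by simp
    qed
    have cU': "continuous_on (tube X \<rho>) (\<lambda>\<theta>. FD U \<theta> u)" for u
      using U1 unfolding Ck_on.simps by blast
    have cU: "continuous_on (ray_dom X \<rho>) (\<lambda>w. FD U (ray w) u)" for u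
      by (rule continuous_on_compose2[OF cU' continuous_on_ray]) (auto simp: ray_dom_def)
    have cU0: "continuous_on (ray_dom X \<rho>) (\<lambda>w. U (ray w))"
      using Ck_on_imp_continuous[OF U1] by (intro continuous_on_compose2[OF _ continuous_on_ray, of "tube X \<rho>"]) (auto simp: ray_dom_def)
    have cL: "continuous_on (ray_dom X \<rho>) (\<lambda>w. FD L w (0, v))" using L1 unfolding Ck_on.simps by blast
    have "continuous_on (ray_dom X \<rho>) (\<lambda>w. pr (L w) (FD U (ray w) (fst v, 0) + fst w *\<^sub>R FD U (ray w) (0, snd v))
        + pr (FD L w (0, v)) (U (ray w)))"
      by (intro continuous_intros continuous_on cU cU0 cL Ck_on_imp_continuous[OF L1])
    then have "continuous_on (ray_dom X \<rho>) (\<lambda>w. g' w (0, v))"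
      by (rule continuous_on_eq) (simp add: g'_def e)
    then show "continuous_on ({0..1} \<times> tube X \<rho>) (\<lambda>w. g' w (0, v))"
      using continuous_on_subset ray_dom_sub by blast
  qed
  then show ?thesis by (simp add: ray_op_def[abs_def] g'_def)
qed

lemma neumann_C1:
  assumes "open X" "Ck_on 1 L (ray_dom X \<rho>)" "Ck_on 1 f (tube X \<rho>)"
  shows "Ck_on 1 (neumann L f n) (tube X \<rho>)"
proof (induction n)
  case (Suc n)
  then show ?case unfolding neumann.simps by (rule Ck_on_ray_op[OF assms(1,2)])
qed (use assms in simp)

text \<open>If \<open>d n\<close> bounds the derivative of the n-th term, differentiating
  \<open>ray_op\<close> gives \<open>d (n+1) = d n / 2 + c * M / 2^n\<close>: the first part is
  halved by L, the second comes from the derivative of L. Such a recursion grows like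
  \<open>(n+1) / 2^n\<close>, and writing \<open>c * M / 2^n\<close> as
  \<open>2 * c * M / 2^(n+1)\<close> explains the constant \<open>b + 2 * c * M\<close>.\<close>

lemma neumann_derivative_bound:
  assumes X: "open X" and L: "Ck_on 1 L (ray_dom X \<rho>)" "half_bounded pr L (tube X \<rho>)"
    and f: "Ck_on 1 f (tube X \<rho>)" "\<And>\<theta>. \<theta> \<in> tube X \<rho> \<Longrightarrow> norm (f \<theta>) \<le> M" "M \<ge> 0"
    and b: "\<And>\<theta> v. \<theta> \<in> tube X \<rho> \<Longrightarrow> norm (FD f \<theta> v) \<le> b * norm v" "b \<ge> 0"
    and c: "\<And>w v e. w \<in> {0..1} \<times> tube X \<rho> \<Longrightarrow> norm (pr (FD L w v) e) \<le> c * norm v * norm e" "c \<ge> 0"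
    and \<theta>: "\<theta> \<in> tube X \<rho>"
  shows "norm (FD (neumann L f n) \<theta> v) \<le> (b + 2 * c * M) * (real (Suc n) * (1/2) ^ n) * norm v"
  using \<theta>
proof (induction n arbitrary: \<theta> v)
  case 0
  have "b * norm v \<le> (b + 2 * c * M) * norm v" using b(2) c(2) f(3) by (intro mult_right_mono) auto
  then show ?case using b(1)[OF 0, of v] by simp
next
  case (Suc n)
  let ?B = "b + 2 * c * M" and ?W = "neumann L f n"
  let ?g = "\<lambda>s. pr (L (s, \<theta>)) (FD ?W (ray (s, \<theta>)) (fst v, s *\<^sub>R snd v)) + pr (FD L (s, \<theta>) (0, v)) (?W (ray (s, \<theta>)))"
  let ?m = "?B * (real (Suc (Suc n)) * (1/2) ^ Suc n) * norm v"
  note W = neumann_C1[OF X L(1) f(1), of n]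
  have fd: "FD (neumann L f (Suc n)) \<theta> v = integral {0..1} ?g"
    using FD_eqI[OF ray_op_has_derivative[OF X L(1) W Suc.prems]] by simp
  have "norm (?g s) \<le> ?m" if s: "s \<in> {0..1}" for s
  proof -
    have r: "ray (s, \<theta>) \<in> tube X \<rho>" using ray_tube[OF s Suc.prems] .
    have nv: "norm (fst v, s *\<^sub>R snd v) \<le> norm v"
    proof -
      have "(norm (s *\<^sub>R snd v))\<^sup>2 \<le> (norm (snd v))\<^sup>2" using s by (intro power_mono) (auto simp: mult_left_le_one_le)
      then show ?thesis by (cases v) (simp add: norm_Pair)
    qed
    have B: "0 \<le> ?B * (real (Suc n) * (1/2) ^ n)" using b(2) c(2) f(3) by simp
    have "norm (pr (L (s, \<theta>)) (FD ?W (ray (s, \<theta>)) (fst v, s *\<^sub>R snd v))) \<le> norm (FD ?W (ray (s, \<theta>)) (fst v, s *\<^sub>R snd v)) / 2"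
      using L(2) s Suc.prems by (auto simp: half_bounded_def)
    also have "\<dots> \<le> ?B * (real (Suc n) * (1/2) ^ n) * norm (fst v, s *\<^sub>R snd v) / 2"
      using Suc.IH[OF r] by (simp add: divide_right_mono)
    also have "\<dots> \<le> ?B * (real (Suc n) * (1/2) ^ n) * norm v / 2"
      using mult_left_mono[OF nv B] by (simp add: divide_right_mono)
    finally have 1: "norm (pr (L (s, \<theta>)) (FD ?W (ray (s, \<theta>)) (fst v, s *\<^sub>R snd v))) \<le> ?B * (real (Suc n) * (1/2) ^ n) * norm v / 2" .
    have "norm (?W (ray (s, \<theta>))) \<le> M / 2 ^ n"
      by (rule neumann_bound[OF Ck_on_imp_continuous[OF L(1)] L(2) Ck_on_imp_continuous[OF f(1)] f(2) r])
    then have "c * norm v * norm (?W (ray (s, \<theta>))) \<le> c * norm v * (M / 2 ^ n)"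
      using c(2) by (intro mult_left_mono) auto
    moreover have "norm (pr (FD L (s, \<theta>) (0, v)) (?W (ray (s, \<theta>)))) \<le> c * norm (0::real, v) * norm (?W (ray (s, \<theta>)))"
      using c(1)[of "(s, \<theta>)" "(0, v)"] s Suc.prems by auto
    ultimately have 2: "norm (pr (FD L (s, \<theta>) (0, v)) (?W (ray (s, \<theta>)))) \<le> c * norm v * (M / 2 ^ n)"
      by (simp add: norm_Pair)
    have "2 * c * M * (norm v / 2 ^ Suc n) \<le> ?B * (norm v / 2 ^ Suc n)"
      using b(2) by (intro mult_right_mono) auto
    moreover have "?m = ?B * (real (Suc n) * (1/2) ^ n) * norm v / 2 + ?B * (norm v / 2 ^ Suc n)"
      by (simp add: power_one_over field_simps)
    moreover have "2 * c * M * (norm v / 2 ^ Suc n) = c * norm v * (M / 2 ^ n)" by simp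
    ultimately show ?thesis using 1 2 norm_triangle_ineq[of "pr (L (s, \<theta>)) (FD ?W (ray (s, \<theta>)) (fst v, s *\<^sub>R snd v))" "pr (FD L (s, \<theta>) (0, v)) (?W (ray (s, \<theta>)))"]
      by linarith
  qed
  moreover have "0 \<le> ?m" using b(2) c(2) f(3) by simp
  ultimately show ?case unfolding fd by (rule norm_integral_unit_le)
qed

text \<open>Termwise differentiation of the Neumann series. The bounds \<open>\<beta> n\<close> are
  summable as terms of the differentiated geometric series, and convexity of X makes the tube
  convex, as the theorem on differentiating series demands.\<close>

lemma ray_equation_C1_bounded:
  fixes X :: "'p::euclidean_space set" and U f :: "'p \<times> 'z::euclidean_space \<Rightarrow> 'e"
  assumes X: "open X" "convex X" and L: "Ck_on 1 L (ray_dom X \<rho>)" "half_bounded pr L (tube X \<rho>)"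
    and f: "Ck_on 1 f (tube X \<rho>)" "\<And>\<theta>. \<theta> \<in> tube X \<rho> \<Longrightarrow> norm (f \<theta>) \<le> M" "M \<ge> 0"
    and b: "\<And>\<theta> v. \<theta> \<in> tube X \<rho> \<Longrightarrow> norm (FD f \<theta> v) \<le> b * norm v" "b \<ge> 0"
    and c: "\<And>w v e. w \<in> {0..1} \<times> tube X \<rho> \<Longrightarrow> norm (pr (FD L w v) e) \<le> c * norm v * norm e" "c \<ge> 0"
    and U: "\<And>\<theta>. \<theta> \<in> tube X \<rho> \<Longrightarrow> (\<lambda>n. neumann L f n \<theta>) sums U \<theta>"
  shows "Ck_on 1 U (tube X \<rho>)"
proof -
  let ?T = "tube X \<rho> :: ('p \<times> 'z) set"
  define B where "B = b + 2 * c * M"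
  define \<beta> where "\<beta> n = B * (real (Suc n) * (1/2) ^ n)" for n
  have B: "B \<ge> 0" using b c f by (simp add: B_def)
  have s\<beta>: "summable \<beta>"
    unfolding \<beta>_def using geometric_deriv_sums[of "1/2::real"] by (intro summable_mult) (auto simp: sums_iff)
  have \<beta>0: "\<beta> n \<ge> 0" for n using B by (simp add: \<beta>_def)
  have nd: "norm (FD (neumann L f n) \<theta> v) \<le> \<beta> n * norm v" if "\<theta> \<in> ?T" for n \<theta> v
    unfolding \<beta>_def B_def by (rule neumann_derivative_bound[OF X(1) L f b c that])
  define V where "V \<theta> v = (\<Sum>n. FD (neumann L f n) \<theta> v)" for \<theta> v
  have sV: "summable (\<lambda>n. FD (neumann L f n) \<theta> v)" if "\<theta> \<in> ?T" for \<theta> v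
    by (rule summable_comparison_test'[OF summable_mult2[OF s\<beta>] nd[OF that]])
  have cT: "convex ?T" unfolding tube_def by (intro convex_Times X) auto
  have oT: "open ?T" by (rule open_tube[OF X(1)])
  have hd: "(neumann L f n has_derivative FD (neumann L f n) \<theta>) (at \<theta>)" if "\<theta> \<in> ?T" for n \<theta>
    using Ck_on_Suc_has_derivative[OF neumann_C1[OF X(1) L(1) f(1), unfolded One_nat_def] that] .
  have d: "(U has_derivative V \<theta>) (at \<theta>)" if \<theta>: "\<theta> \<in> ?T" for \<theta>
  proof -
    have "\<exists>g. \<forall>x\<in>?T. (\<lambda>n. neumann L f n x) sums g x \<and> (g has_derivative V x) (at x within ?T)"
    proof (rule has_derivative_series[where f = "neumann L f" and f' = "\<lambda>n. FD (neumann L f n)" and x = \<theta> and l = "U \<theta>", OF cT _ _ \<theta> U[OF \<theta>]])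
      fix e :: real assume e: "e > 0"
      have "(\<lambda>n. \<Sum>k. \<beta> (k + n)) \<longlonglongrightarrow> 0" by (rule suminf_exist_split2[OF s\<beta>])
      then have "\<forall>\<^sub>F n in sequentially. (\<Sum>k. \<beta> (k + n)) < e" using e by (rule order_tendstoD)
      then show "\<forall>\<^sub>F n in sequentially. \<forall>x\<in>?T. \<forall>h. norm ((\<Sum>i<n. FD (neumann L f i) x h) - V x h) \<le> e * norm h"
      proof eventually_elim
        case (elim n)
        show ?case
        proof (intro ballI allI)
          fix x h assume x: "x \<in> ?T"
          have "norm (V x h - (\<Sum>i<n. FD (neumann L f i) x h)) = norm (\<Sum>k. FD (neumann L f (k + n)) x h)"
            unfolding V_def by (simp add: suminf_minus_initial_segment[OF sV[OF x]])
          also have "\<dots> \<le> (\<Sum>k. \<beta> (k + n) * norm h)"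
            by (rule norm_suminf_le[OF nd[OF x]]) (use s\<beta> in \<open>auto intro!: summable_mult2 simp: summable_iff_shift\<close>)
          also have "\<dots> = (\<Sum>k. \<beta> (k + n)) * norm h"
            by (rule suminf_mult2[symmetric]) (use s\<beta> in \<open>simp add: summable_iff_shift\<close>)
          also have "\<dots> \<le> e * norm h" using elim by (intro mult_right_mono) auto
          finally show "norm ((\<Sum>i<n. FD (neumann L f i) x h) - V x h) \<le> e * norm h"
            by (simp add: norm_minus_commute)
        qed
      qed
    qed (use hd has_derivative_at_withinI in blast)
    then obtain g where g: "\<And>x. x \<in> ?T \<Longrightarrow> (\<lambda>n. neumann L f n x) sums g x" "(g has_derivative V \<theta>) (at \<theta> within ?T)"
      using \<theta> by blast
    have "g x = U x" if "x \<in> ?T" for x using g(1)[OF that] U[OF that] sums_unique2 by blast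
    then show ?thesis
      using g(2) has_derivative_transform_within_open[OF _ oT \<theta>] \<theta> oT by (metis at_within_open)
  qed
  have "continuous_on ?T (\<lambda>\<theta>. FD U \<theta> v)" for v
  proof -
    have "uniform_limit ?T (\<lambda>n \<theta>. \<Sum>i<n. FD (neumann L f i) \<theta> v) (\<lambda>\<theta>. V \<theta> v) sequentially"
      unfolding V_def by (rule Weierstrass_m_test[OF nd summable_mult2[OF s\<beta>]])
    moreover have "continuous_on ?T (\<lambda>\<theta>. \<Sum>i<n. FD (neumann L f i) \<theta> v)" for n
      by (intro continuous_intros C1_FD_continuous neumann_C1 X L f)
    ultimately have "continuous_on ?T (\<lambda>\<theta>. V \<theta> v)" by (intro uniform_limit_theorem) auto
    then show ?thesis by (rule continuous_on_eq) (simp add: FD_eqI[OF d])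
  qed
  then show ?thesis unfolding One_nat_def by (intro Ck_on_SucI[OF d]) simp_all
qed

text \<open>The bounds needed for termwise differentiation are available on compact sets only. The
  equation at \<open>\<theta>\<close> involves the whole ray down to \<open>z = 0\<close>, so a
  small ball around \<open>\<theta>\<close> would not do: the localisation shrinks the tube, to a
  ball in the parameter and a radius strictly between \<open>norm (snd \<theta>)\<close> and
  \<open>\<rho>\<close>. Uniqueness identifies U with the Neumann sum there.\<close>

lemma ray_equation_C1:
  fixes X :: "'p::euclidean_space set" and U f :: "'p \<times> 'z::euclidean_space \<Rightarrow> 'e"
  assumes X: "open X" and L: "Ck_on 1 L (ray_dom X \<rho>)" "half_bounded pr L (tube X \<rho>)"
    and f: "Ck_on 1 f (tube X \<rho>)"
    and U: "continuous_on (tube X \<rho>) U" "\<And>\<theta>. \<theta> \<in> tube X \<rho> \<Longrightarrow> U \<theta> = f \<theta> + ray_op pr L U \<theta>"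
  shows "Ck_on 1 U (tube X \<rho>)"
proof (rule Ck_on_local)
  fix \<theta> :: "'p \<times> 'z" assume \<theta>: "\<theta> \<in> tube X \<rho>"
  then obtain r where r: "r > 0" "cball (fst \<theta>) r \<subseteq> X"
    using X unfolding tube_def by (metis mem_Times_iff open_contains_cball)
  obtain \<rho>' where \<rho>': "norm (snd \<theta>) < \<rho>'" "\<rho>' < \<rho>" using \<theta> dense[of "norm (snd \<theta>)" \<rho>] by (auto simp: tube_def)
  let ?X = "ball (fst \<theta>) r"
  let ?T = "tube ?X \<rho>' :: ('p \<times> 'z) set"
  let ?Q = "cball (fst \<theta>) r \<times> cball 0 \<rho>' :: ('p \<times> 'z) set"
  have TQ: "?T \<subseteq> ?Q" and QT: "?Q \<subseteq> tube X \<rho>" using r \<rho>' by (auto simp: tube_def)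
  have Qc: "compact ?Q" by (intro compact_Times) auto
  have sub: "?T \<subseteq> tube X \<rho>" "ray_dom ?X \<rho>' \<subseteq> (ray_dom X \<rho> :: (real \<times> 'p \<times> 'z) set)"
    using TQ QT unfolding ray_dom_def by blast+
  have oX: "open ?X" "convex ?X" by auto
  note L' = Ck_on_subset[OF L(1) sub(2)] and f' = Ck_on_subset[OF f sub(1)]
  have hb: "half_bounded pr L ?T" using L(2) sub(1) unfolding half_bounded_def by blast
  have bd: "\<exists>M\<ge>0. \<forall>\<theta>\<in>?T. norm (g \<theta>) \<le> M" if "continuous_on (tube X \<rho>) g" for g :: "_ \<Rightarrow> 'e"
  proof -
    have "bounded (g ` ?Q)"
      by (rule compact_imp_bounded[OF compact_continuous_image[OF continuous_on_subset[OF that QT] Qc]])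
    then obtain M where "\<And>\<theta>. \<theta> \<in> ?Q \<Longrightarrow> norm (g \<theta>) \<le> M" by (auto simp: bounded_iff)
    then show ?thesis using TQ by (intro exI[of _ "\<bar>M\<bar>"]) force
  qed
  obtain M where M: "M \<ge> 0" "\<And>\<theta>. \<theta> \<in> ?T \<Longrightarrow> norm (f \<theta>) \<le> M"
    using bd[OF Ck_on_imp_continuous[OF f]] by blast
  obtain M' where M': "\<And>\<theta>. \<theta> \<in> ?T \<Longrightarrow> norm (U \<theta>) \<le> M'" using bd[OF U(1)] by blast
  obtain b where b: "b \<ge> 0" "\<And>w v. w \<in> ?Q \<Longrightarrow> norm (FD f w v) \<le> b * norm v"
    using Ck_on_Suc_bounded_on_compact[OF f[unfolded One_nat_def] Qc QT] by blast
  have "{0..1} \<times> ?Q \<subseteq> ray_dom X \<rho>" using QT ray_dom_sub by blast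
  then obtain c where c: "c \<ge> 0" "\<And>w v. w \<in> {0..1} \<times> ?Q \<Longrightarrow> norm (FD L w v) \<le> c * norm v"
    using Ck_on_Suc_bounded_on_compact[OF L(1)[unfolded One_nat_def] compact_Times[OF compact_Icc Qc]] by blast
  obtain K where K: "K > 0" "\<And>a e. norm (pr a e) \<le> norm a * norm e * K" using pos_bounded by blast
  have cK: "norm (pr (FD L w v) e) \<le> (c * K) * norm v * norm e" if "w \<in> {0..1} \<times> ?T" for w v e
  proof -
    have "norm (pr (FD L w v) e) \<le> norm (FD L w v) * norm e * K" by (rule K)
    also have "\<dots> \<le> c * norm v * norm e * K"
      using c(2)[of w v] that TQ K(1) by (intro mult_right_mono) auto
    finally show ?thesis by (simp add: ac_simps)
  qed
  obtain U' where U': "continuous_on ?T U'" "\<And>\<theta>. \<theta> \<in> ?T \<Longrightarrow> norm (U' \<theta>) \<le> 2 * M"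
    "\<And>\<theta>. \<theta> \<in> ?T \<Longrightarrow> U' \<theta> = f \<theta> + ray_op pr L U' \<theta>" "\<And>\<theta>. \<theta> \<in> ?T \<Longrightarrow> (\<lambda>n. neumann L f n \<theta>) sums U' \<theta>"
    using neumann_solution[OF Ck_on_imp_continuous[OF L'] hb Ck_on_imp_continuous[OF f'] M(2)] by blast
  have C1: "Ck_on 1 U' ?T"
    by (rule ray_equation_C1_bounded[OF oX L' hb f' M(2,1) _ b(1) cK _ U'(4)])
       (use b(2) TQ c K in auto)
  have "U' \<theta> = U \<theta>" if "\<theta> \<in> ?T" for \<theta>
  proof (rule ray_equation_unique[OF Ck_on_imp_continuous[OF L'] hb U'(1) _ U'(3) _ _ _ that])
    show "continuous_on ?T U" using U(1) sub(1) continuous_on_subset by blast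
    show "norm (U' \<theta>) \<le> max (2 * M) M'" if "\<theta> \<in> ?T" for \<theta> using U'(2)[OF that] by auto
    show "norm (U \<theta>) \<le> max (2 * M) M'" if "\<theta> \<in> ?T" for \<theta> using M'[OF that] by auto
    show "U \<theta> = f \<theta> + ray_op pr L U \<theta>" if "\<theta> \<in> ?T" for \<theta> using U(2) that sub(1) by blast
  qed
  then have "Ck_on 1 U ?T" using Ck_on_cong[OF open_tube[OF oX(1)] _ C1] by blast
  moreover have "\<theta> \<in> ?T" using r(1) \<rho>' by (auto simp: tube_def mem_Times_iff)
  ultimately show "\<exists>T. open T \<and> \<theta> \<in> T \<and> Ck_on 1 U T" using open_tube[OF oX(1)] by blast
qed

text \<open>
  The derivatives of a solution in a parameter direction and in a ray direction solve equations of the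
  same kind, with kernels \<open>L\<close> and \<open>s L\<close>.
\<close>

theorem ray_equation_Ck:
  fixes X :: "'p::euclidean_space set" and U f :: "'p \<times> 'z::euclidean_space \<Rightarrow> 'e"
  assumes X: "open X" and L: "Ck_on k L (ray_dom X \<rho>)" "half_bounded pr L (tube X \<rho>)"
    and f: "Ck_on k f (tube X \<rho>)"
    and U: "continuous_on (tube X \<rho>) U" "\<And>\<theta>. \<theta> \<in> tube X \<rho> \<Longrightarrow> U \<theta> = f \<theta> + ray_op pr L U \<theta>"
  shows "Ck_on k U (tube X \<rho>)"
  using L f U
proof (induction k arbitrary: L f U)
  case 0
  then show ?case by simp
next
  case (Suc k)
  let ?T = "tube X \<rho> :: ('p \<times> 'z) set"
  have C1: "Ck_on 1 h S" if "Ck_on (Suc k) h S" for h :: "'a::real_normed_vector \<Rightarrow> 'b::real_normed_vector" and S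
    using that Ck_on_imp_continuous[of k] unfolding One_nat_def Ck_on.simps by blast
  note L1 = C1[OF Suc.prems(1)] and f1 = C1[OF Suc.prems(3)]
  have U1: "Ck_on 1 U ?T"
    by (rule ray_equation_C1[OF X L1 Suc.prems(2) f1 Suc.prems(4,5)])
  have Uk: "Ck_on k U ?T"
    by (rule Suc.IH[OF Ck_on_SucD[OF Suc.prems(1)] Suc.prems(2) Ck_on_SucD[OF Suc.prems(3)] Suc.prems(4,5)])
  have lin: "linear (FD U \<theta>)" if "\<theta> \<in> ?T" for \<theta> using U1 that by (auto intro: linear_frechet_derivative)
  have cU: "continuous_on ?T (\<lambda>\<theta>. FD U \<theta> v)" for v by (rule C1_FD_continuous[OF U1])
  \<comment> \<open>R collects the terms without derivatives of U; they are \<open>Ck_on k\<close>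
    by the induction hypothesis for U. What is left is a ray equation for the derivative of U, and
    the induction hypothesis asks of that unknown only continuity, which the \<open>Ck_on 1\<close>
    property of U provides.\<close>
  define R where "R v \<theta> = FD f \<theta> v + integral {0..1} (\<lambda>s. pr (FD L (s, \<theta>) (0, v)) (U (ray (s, \<theta>))))" for v \<theta>
  have Rk: "Ck_on k (R v) ?T" for v
    unfolding R_def
  proof (rule Ck_on_add[OF open_tube[OF X]])
    show "Ck_on k (\<lambda>\<theta>. FD f \<theta> v) ?T" by (rule Ck_on_FD[OF Suc.prems(3)])
    have "Ck_on k (ray_op pr (\<lambda>w. FD L w (0, v)) U) ?T"
      by (rule Ck_on_ray_op[OF X Ck_on_FD[OF Suc.prems(1)] Uk])
    then show "Ck_on k (\<lambda>\<theta>. integral {0..1} (\<lambda>s. pr (FD L (s, \<theta>) (0, v)) (U (ray (s, \<theta>))))) ?T"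
      by (simp add: ray_op_def[abs_def])
  qed
  have eq: "FD U \<theta> v = R v \<theta> + integral {0..1} (\<lambda>s. pr (L (s, \<theta>)) (FD U (ray (s, \<theta>)) (fst v, s *\<^sub>R snd v)))"
    if \<theta>: "\<theta> \<in> ?T" and c: "continuous_on {0..1} (\<lambda>s. pr (L (s, \<theta>)) (FD U (ray (s, \<theta>)) (fst v, s *\<^sub>R snd v)))" for \<theta> v
  proof -
    have "((\<lambda>\<theta>. f \<theta> + ray_op pr L U \<theta>) has_derivative (\<lambda>v. FD f \<theta> v + integral {0..1} (\<lambda>s.
      pr (L (s, \<theta>)) (FD U (ray (s, \<theta>)) (fst v, s *\<^sub>R snd v)) + pr (FD L (s, \<theta>) (0, v)) (U (ray (s, \<theta>)))))) (at \<theta>)"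
      by (intro has_derivative_add Ck_on_Suc_has_derivative[OF Suc.prems(3) \<theta>] ray_op_has_derivative[OF X L1 U1 \<theta>])
    from FD_eqI[OF this] have "FD U \<theta> v = FD f \<theta> v + integral {0..1} (\<lambda>s.
      pr (L (s, \<theta>)) (FD U (ray (s, \<theta>)) (fst v, s *\<^sub>R snd v)) + pr (FD L (s, \<theta>) (0, v)) (U (ray (s, \<theta>))))"
      using FD_cong[OF open_tube[OF X] \<theta> Suc.prems(5)] by simp
    moreover have "continuous_on {0..1} (\<lambda>s. pr (FD L (s, \<theta>) (0, v)) (U (ray (s, \<theta>))))"
      by (rule integrand_s_continuous[OF C1_FD_continuous[OF L1] Suc.prems(4) \<theta>])
    ultimately show ?thesis
      using c unfolding R_def by (subst (asm) integral_add) (auto intro: integrable_continuous_real)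
  qed
  have x: "Ck_on k (\<lambda>\<theta>. FD U \<theta> (\<xi>, 0)) ?T" for \<xi>
  proof (rule Suc.IH[OF Ck_on_SucD[OF Suc.prems(1)] Suc.prems(2) Rk[of "(\<xi>, 0)"] cU])
    fix \<theta> :: "'p \<times> 'z" assume \<theta>: "\<theta> \<in> ?T"
    show "FD U \<theta> (\<xi>, 0) = R (\<xi>, 0) \<theta> + ray_op pr L (\<lambda>\<theta>. FD U \<theta> (\<xi>, 0)) \<theta>"
      using eq[OF \<theta>, of "(\<xi>, 0)"] integrand_s_continuous[OF Ck_on_imp_continuous[OF L1] cU \<theta>, of "(\<xi>, 0)"]
      by (simp add: ray_op_def)
  qed
  have z: "Ck_on k (\<lambda>\<theta>. FD U \<theta> (0, \<zeta>)) ?T" for \<zeta>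
  proof (rule Suc.IH[of "\<lambda>w. fst w *\<^sub>R L w" "R (0, \<zeta>)", OF _ _ Rk cU])
    show Lk: "Ck_on k (\<lambda>w. fst w *\<^sub>R L w) (ray_dom X \<rho>)"
      by (intro Ck_on_bilinear[OF bounded_bilinear_scaleR] open_ray_dom X Ck_on_SucD[OF Suc.prems(1)]
          Ck_on_bounded_linear bounded_linear_fst)
    show "half_bounded pr (\<lambda>w. fst w *\<^sub>R L w) ?T"
      unfolding half_bounded_def
    proof (intro ballI allI)
      fix s :: real and \<theta> :: "'p \<times> 'z" and e assume s: "s \<in> {0..1}" "\<theta> \<in> ?T"
      have "norm (pr (fst (s, \<theta>) *\<^sub>R L (s, \<theta>)) e) = s * norm (pr (L (s, \<theta>)) e)"
        using s(1) by (simp add: scaleR_left)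
      also have "\<dots> \<le> norm (pr (L (s, \<theta>)) e)" using s(1) by (simp add: mult_left_le_one_le)
      also have "\<dots> \<le> norm e / 2" using Suc.prems(2) s by (simp add: half_bounded_def)
      finally show "norm (pr (fst (s, \<theta>) *\<^sub>R L (s, \<theta>)) e) \<le> norm e / 2" .
    qed
    fix \<theta> :: "'p \<times> 'z" assume \<theta>: "\<theta> \<in> ?T"
    have e: "pr (L (s, \<theta>)) (FD U (ray (s, \<theta>)) (0, s *\<^sub>R \<zeta>)) = pr (fst (s, \<theta>) *\<^sub>R L (s, \<theta>)) (FD U (ray (s, \<theta>)) (0, \<zeta>))"
      if "s \<in> {0..1}" for s
    proof -
      have "FD U (ray (s, \<theta>)) (s *\<^sub>R (0, \<zeta>)) = s *\<^sub>R FD U (ray (s, \<theta>)) (0, \<zeta>)"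
        using linear_scale[OF lin[OF ray_tube[OF that \<theta>]]] .
      then show ?thesis by (simp add: scaleR_left scaleR_right)
    qed
    have "continuous_on {0..1} (\<lambda>s. pr (L (s, \<theta>)) (FD U (ray (s, \<theta>)) (0, s *\<^sub>R \<zeta>)))"
      by (rule continuous_on_eq[OF integrand_s_continuous[OF Ck_on_imp_continuous[OF Lk] cU \<theta>, of "(0, \<zeta>)"]]) (use e in auto)
    then have "FD U \<theta> (0, \<zeta>) = R (0, \<zeta>) \<theta> + integral {0..1} (\<lambda>s. pr (L (s, \<theta>)) (FD U (ray (s, \<theta>)) (0, s *\<^sub>R \<zeta>)))"
      using eq[OF \<theta>, of "(0, \<zeta>)"] by simp
    also have "integral {0..1} (\<lambda>s. pr (L (s, \<theta>)) (FD U (ray (s, \<theta>)) (0, s *\<^sub>R \<zeta>))) =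
        integral {0..1} (\<lambda>s. pr (fst (s, \<theta>) *\<^sub>R L (s, \<theta>)) (FD U (ray (s, \<theta>)) (0, \<zeta>)))"
      by (rule integral_cong) (rule e)
    finally show "FD U \<theta> (0, \<zeta>) = R (0, \<zeta>) \<theta> + ray_op pr (\<lambda>w. fst w *\<^sub>R L w) (\<lambda>\<theta>. FD U \<theta> (0, \<zeta>)) \<theta>"
      by (simp add: ray_op_def)
  qed
  have "Ck_on k (\<lambda>\<theta>. FD U \<theta> v) ?T" for v
  proof (rule Ck_on_cong[OF open_tube[OF X] _ Ck_on_add[OF open_tube[OF X] x[of "fst v"] z[of "snd v"]]])
    fix \<theta> :: "'p \<times> 'z" assume "\<theta> \<in> ?T"
    then show "FD U \<theta> (fst v, 0) + FD U \<theta> (0, snd v) = FD U \<theta> v"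
      using linear_add[OF lin, of \<theta> "(fst v, 0)" "(0, snd v)"] by simp
  qed
  then show ?case by (intro Ck_on_SucI[OF Ck_on_Suc_has_derivative[OF U1[unfolded One_nat_def]]])
qed

end

section \<open>Integrable linear systems\<close>

text \<open>Both mixed derivatives are limits of the same second difference quotient, which is
  symmetric in v and w.\<close>

lemma FD_FD_symmetric_real:
  fixes f :: "'a::euclidean_space \<Rightarrow> real"
  assumes "open S" "Ck_on 2 f S" "x \<in> S"
  shows "FD (\<lambda>y. FD f y v) x w = FD (\<lambda>y. FD f y w) x v"
proof -
  have approx: "\<exists>d>0. \<forall>h. 0 < h \<and> h < d \<longrightarrow>
      \<bar>f (x + h *\<^sub>R v + h *\<^sub>R w) - f (x + h *\<^sub>R v) - f (x + h *\<^sub>R w) + f x - h\<^sup>2 * FD (\<lambda>y. FD f y v) x w\<bar> \<le> e * h\<^sup>2"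
    if e: "e > 0" for e v w
  proof -
    \<comment> \<open>The error of the first-order expansion of \<open>FD f y v\<close> is used at
      the two points with \<open>t = h\<close> and \<open>t = 0\<close>; together they cost
      \<open>2 * \<xi> * norm v + h * norm w\<close>, which is below \<open>h * C\<close>. The
      summand 1 keeps C positive.\<close>
    define C where "C = 2 * norm v + norm w + 1"
    have C: "C > 0" unfolding C_def using norm_ge_zero[of v] norm_ge_zero[of w] by linarith
    have C1: "Ck_on 1 (\<lambda>y. FD f y v) S" using assms(2) by (simp add: numeral_2_eq_2)
    have d2: "((\<lambda>y. FD f y v) has_derivative FD (\<lambda>y. FD f y v) x) (at x)"
      using Ck_on_Suc_has_derivative[OF C1[unfolded One_nat_def] assms(3)] .
    let ?D = "FD (\<lambda>y. FD f y v) x"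
    have lin: "linear ?D" using d2 has_derivative_linear by blast
    obtain d where d: "d > 0" "\<And>y. norm (y - x) < d \<Longrightarrow> norm (FD f y v - FD f x v - ?D (y - x)) \<le> (e / C) * norm (y - x)"
      using d2[unfolded has_derivative_at_alt] e C by (metis divide_pos_pos)
    obtain r where r: "r > 0" "ball x r \<subseteq> S" using assms(1,3) open_contains_ball by blast
    define d0 where "d0 = min d r / C"
    have "d0 > 0" using d(1) r(1) C by (simp add: d0_def)
    moreover have "\<bar>f (x + h *\<^sub>R v + h *\<^sub>R w) - f (x + h *\<^sub>R v) - f (x + h *\<^sub>R w) + f x - h\<^sup>2 * ?D w\<bar> \<le> e * h\<^sup>2"
      if h: "0 < h" "h < d0" for h
    proof -
      have hC: "h * C < d" "h * C < r" using h(2) C by (auto simp: d0_def pos_less_divide_eq)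
      have small: "norm (s *\<^sub>R v + t *\<^sub>R w) \<le> h * (norm v + norm w)" if "0 \<le> s" "s \<le> h" "0 \<le> t" "t \<le> h" for s t
      proof -
        have "norm (s *\<^sub>R v + t *\<^sub>R w) \<le> s * norm v + t * norm w"
          using norm_triangle_ineq[of "s *\<^sub>R v" "t *\<^sub>R w"] that by simp
        also have "\<dots> \<le> h * norm v + h * norm w" using that by (intro add_mono mult_right_mono) auto
        finally show ?thesis by (simp add: algebra_simps)
      qed
      have hle: "h * (norm v + norm w) < h * C" using h(1) by (simp add: C_def add_nonneg_pos)
      have inS: "x + s *\<^sub>R v + t *\<^sub>R w \<in> S" if "0 \<le> s" "s \<le> h" "0 \<le> t" "t \<le> h" for s t
      proof -
        have "dist x (x + s *\<^sub>R v + t *\<^sub>R w) = norm (s *\<^sub>R v + t *\<^sub>R w)"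
          by (metis add.assoc add_diff_cancel_left' dist_commute dist_norm)
        then show ?thesis using small[OF that] hle hC(2) r(2) by (auto simp: subset_iff)
      qed
      have df: "((\<lambda>s. f (x + s *\<^sub>R v + t *\<^sub>R w)) has_real_derivative FD f (x + s *\<^sub>R v + t *\<^sub>R w) v) (at s)"
        if "0 \<le> s" "s \<le> h" "0 \<le> t" "t \<le> h" for s t
      proof -
        have 1: "(f has_derivative FD f (x + s *\<^sub>R v + t *\<^sub>R w)) (at (x + s *\<^sub>R v + t *\<^sub>R w))"
          using Ck_on_Suc_has_derivative[of 1 f S] assms(2) inS[OF that] by (simp add: numeral_2_eq_2)
        have "((\<lambda>s. x + s *\<^sub>R v + t *\<^sub>R w) has_derivative (\<lambda>s. s *\<^sub>R v)) (at s)"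
          by (auto intro!: derivative_eq_intros)
        from has_derivative_compose[OF this 1]
        have "((\<lambda>s. f (x + s *\<^sub>R v + t *\<^sub>R w)) has_derivative (\<lambda>s'. FD f (x + s *\<^sub>R v + t *\<^sub>R w) (s' *\<^sub>R v))) (at s)" .
        moreover have "FD f (x + s *\<^sub>R v + t *\<^sub>R w) (s' *\<^sub>R v) = FD f (x + s *\<^sub>R v + t *\<^sub>R w) v * s'" for s'
          using linear_scale[OF has_derivative_linear[OF 1], of s' v] by simp
        ultimately show ?thesis by (simp add: has_field_derivative_def)
      qed
      \<comment> \<open>The second difference is an increment of this function, so the mean value
        theorem reduces it to a difference of first derivatives in direction v.\<close>
      define \<phi> where "\<phi> s = f (x + s *\<^sub>R v + h *\<^sub>R w) - f (x + s *\<^sub>R v + 0 *\<^sub>R w)" for s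
      have d\<phi>: "(\<phi> has_real_derivative FD f (x + s *\<^sub>R v + h *\<^sub>R w) v - FD f (x + s *\<^sub>R v + 0 *\<^sub>R w) v) (at s)"
        if "0 \<le> s" "s \<le> h" for s
        unfolding \<phi>_def by (intro DERIV_diff df) (use that h in auto)
      obtain \<xi> where \<xi>: "0 < \<xi>" "\<xi> < h" "\<phi> h - \<phi> 0 = (h - 0) * (FD f (x + \<xi> *\<^sub>R v + h *\<^sub>R w) v - FD f (x + \<xi> *\<^sub>R v + 0 *\<^sub>R w) v)"
        using MVT2[OF h(1) d\<phi>] by auto
      have est: "norm (FD f (x + \<xi> *\<^sub>R v + t *\<^sub>R w) v - FD f x v - ?D (\<xi> *\<^sub>R v + t *\<^sub>R w)) \<le> (e / C) * (\<xi> * norm v + t * norm w)"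
        if "0 \<le> t" "t \<le> h" for t
      proof -
        have e1: "x + \<xi> *\<^sub>R v + t *\<^sub>R w - x = \<xi> *\<^sub>R v + t *\<^sub>R w" by simp
        have "norm (FD f (x + \<xi> *\<^sub>R v + t *\<^sub>R w) v - FD f x v - ?D (\<xi> *\<^sub>R v + t *\<^sub>R w)) \<le> (e / C) * norm (\<xi> *\<^sub>R v + t *\<^sub>R w)"
          using d(2)[of "x + \<xi> *\<^sub>R v + t *\<^sub>R w"] small[of \<xi> t] \<xi> that hle hC(1) unfolding e1 by linarith
        also have "\<dots> \<le> (e / C) * (\<xi> * norm v + t * norm w)"
          using norm_triangle_ineq[of "\<xi> *\<^sub>R v" "t *\<^sub>R w"] \<xi> that e C by (intro mult_left_mono) auto
        finally show ?thesis .
      qed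
      have "?D (\<xi> *\<^sub>R v + h *\<^sub>R w) - ?D (\<xi> *\<^sub>R v + 0 *\<^sub>R w) = h * ?D w"
        using lin by (simp add: linear_add linear_scale)
      then have "\<bar>(FD f (x + \<xi> *\<^sub>R v + h *\<^sub>R w) v - FD f (x + \<xi> *\<^sub>R v + 0 *\<^sub>R w) v) - h * ?D w\<bar>
          \<le> (e / C) * (\<xi> * norm v + h * norm w) + (e / C) * (\<xi> * norm v + 0 * norm w)"
        using est[of h] est[of 0] h(1) unfolding real_norm_def by linarith
      also have "\<dots> \<le> (e / C) * (h * C)"
      proof -
        have "(\<xi> * norm v + h * norm w) + (\<xi> * norm v + 0 * norm w) \<le> h * C"
          using mult_right_mono[OF less_imp_le[OF \<xi>(2)] norm_ge_zero[of v]] h(1) by (simp add: C_def algebra_simps)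
        then have "(e / C) * ((\<xi> * norm v + h * norm w) + (\<xi> * norm v + 0 * norm w)) \<le> (e / C) * (h * C)"
          using e C by (intro mult_left_mono) auto
        then show ?thesis by (simp only: distrib_left)
      qed
      also have "\<dots> = e * h" using C by simp
      finally have "h * \<bar>(FD f (x + \<xi> *\<^sub>R v + h *\<^sub>R w) v - FD f (x + \<xi> *\<^sub>R v + 0 *\<^sub>R w) v) - h * ?D w\<bar> \<le> h * (e * h)"
        using h(1) by (intro mult_left_mono) auto
      then have "\<bar>h * ((FD f (x + \<xi> *\<^sub>R v + h *\<^sub>R w) v - FD f (x + \<xi> *\<^sub>R v + 0 *\<^sub>R w) v) - h * ?D w)\<bar> \<le> e * h\<^sup>2"
        using h(1) by (simp add: abs_mult power2_eq_square ac_simps)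
      then have "\<bar>(\<phi> h - \<phi> 0) - h\<^sup>2 * ?D w\<bar> \<le> e * h\<^sup>2"
        unfolding \<xi>(3) by (simp add: power2_eq_square algebra_simps)
      then show ?thesis by (simp add: \<phi>_def algebra_simps)
    qed
    ultimately show ?thesis by blast
  qed
  let ?a = "FD (\<lambda>y. FD f y v) x w" and ?b = "FD (\<lambda>y. FD f y w) x v"
  have "\<bar>?a - ?b\<bar> \<le> e" if e: "e > 0" for e
  proof -
    obtain d1 where d1: "d1 > 0" "\<And>h. 0 < h \<Longrightarrow> h < d1 \<Longrightarrow>
      \<bar>f (x + h *\<^sub>R v + h *\<^sub>R w) - f (x + h *\<^sub>R v) - f (x + h *\<^sub>R w) + f x - h\<^sup>2 * ?a\<bar> \<le> e / 2 * h\<^sup>2"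
      using approx[of "e / 2" v w] e by auto
    obtain d2 where d2: "d2 > 0" "\<And>h. 0 < h \<Longrightarrow> h < d2 \<Longrightarrow>
      \<bar>f (x + h *\<^sub>R w + h *\<^sub>R v) - f (x + h *\<^sub>R w) - f (x + h *\<^sub>R v) + f x - h\<^sup>2 * ?b\<bar> \<le> e / 2 * h\<^sup>2"
      using approx[of "e / 2" w v] e by auto
    define h where "h = min d1 d2 / 2"
    have h: "0 < h" "h < d1" "h < d2" using d1(1) d2(1) by (auto simp: h_def)
    have c: "f (x + h *\<^sub>R w + h *\<^sub>R v) = f (x + h *\<^sub>R v + h *\<^sub>R w)" by (rule arg_cong[of _ _ f]) simp
    have "\<bar>h\<^sup>2 * ?a - h\<^sup>2 * ?b\<bar> \<le> e / 2 * h\<^sup>2 + e / 2 * h\<^sup>2"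
      using d1(2)[OF h(1,2)] d2(2)[OF h(1,3)] c by linarith
    then have "h\<^sup>2 * \<bar>?a - ?b\<bar> \<le> h\<^sup>2 * e"
      using abs_mult[of "h\<^sup>2" "?a - ?b"] by (simp add: right_diff_distrib mult.commute)
    then show ?thesis using h(1) by simp
  qed
  then have "\<bar>?a - ?b\<bar> \<le> 0" by (rule field_le_epsilon) simp
  then show ?thesis by simp
qed

lemma FD_FD_symmetric:
  fixes f :: "'a::euclidean_space \<Rightarrow> 'b::euclidean_space"
  assumes "open S" "smooth_map_on S f" "x \<in> S"
  shows "FD (\<lambda>y. FD f y v) x w = FD (\<lambda>y. FD f y w) x v"
proof (rule euclidean_eqI)
  fix i :: 'b assume "i \<in> Basis"
  have 1: "FD (\<lambda>y. g y \<bullet> i) x u = FD g x u \<bullet> i" if "smooth_map_on S g" "x \<in> S" for g :: "'a \<Rightarrow> 'b" and x u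
    using FD_eqI[OF bounded_linear.has_derivative[OF bounded_linear_inner_left smooth_has_derivative[OF that]]] by simp
  have 2: "FD (\<lambda>y. FD f y u) x u' \<bullet> i = FD (\<lambda>y. FD (\<lambda>z. f z \<bullet> i) y u) x u'" for u u'
    unfolding 1[OF smooth_FD[OF assms(2)] assms(3), symmetric]
    by (rule arg_cong[where f = "\<lambda>g. g u'"], rule FD_cong[OF assms(1,3)]) (simp add: 1[OF assms(2)])
  have "Ck_on 2 (\<lambda>z. f z \<bullet> i) S"
    using smooth_bounded_linear_compose[OF bounded_linear_inner_left assms(1,2)] by (simp add: smooth_map_on_def)
  from FD_FD_symmetric_real[OF assms(1) this assms(3)]
  show "FD (\<lambda>y. FD f y v) x w \<bullet> i = FD (\<lambda>y. FD f y w) x v \<bullet> i" unfolding 2 .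
qed

lemma linear_snd_expansion:
  fixes f :: "'p::real_vector \<times> 'z::euclidean_space \<Rightarrow> 'b::real_vector"
  assumes "linear f"
  shows "f (0, z) = (\<Sum>a\<in>Basis. (z \<bullet> a) *\<^sub>R f (0, a))"
proof -
  have "linear (\<lambda>z. f (0, z))"
    using linear_add[OF assms, of "(0, _)" "(0, _)"] linear_scale[OF assms, of _ "(0, _)"] by (intro linearI) auto
  then have "f (0, \<Sum>a\<in>Basis. (z \<bullet> a) *\<^sub>R a) = (\<Sum>a\<in>Basis. f (0, (z \<bullet> a) *\<^sub>R a))"
    by (rule linear_sum)
  also have "\<dots> = (\<Sum>a\<in>Basis. (z \<bullet> a) *\<^sub>R f (0, a))"
    using linear_scale[OF assms, of _ "(0, _)"] by simp
  finally have "f (0, \<Sum>a\<in>Basis. (z \<bullet> a) *\<^sub>R a) = (\<Sum>a\<in>Basis. (z \<bullet> a) *\<^sub>R f (0, a))" .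
  then show ?thesis by (simp add: euclidean_representation)
qed

text \<open>Gronwall argument: \<open>exp (-2 K s)\<close> times the squared norm of W is
  nonnegative, nonincreasing and zero at the start.\<close>

lemma linear_ode_zero:
  fixes W :: "real \<Rightarrow> 'e::real_inner"
  assumes d: "\<And>s. s \<in> {0..1} \<Longrightarrow> (W has_vector_derivative W' s) (at s)"
    and b: "\<And>s. s \<in> {0..1} \<Longrightarrow> norm (W' s) \<le> K * norm (W s)" and "W 0 = 0" "t \<in> {0..1}"
  shows "W t = 0"
proof -
  define \<phi> where "\<phi> s = exp (- 2 * K * s) * (W s \<bullet> W s)" for s
  have d\<phi>: "(\<phi> has_real_derivative exp (- 2 * K * s) * (2 * (W s \<bullet> W' s)) - 2 * K * exp (- 2 * K * s) * (W s \<bullet> W s)) (at s)"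
    if "s \<in> {0..1}" for s
  proof -
    have "((\<lambda>s. W s \<bullet> W s) has_derivative (\<lambda>h. W s \<bullet> (h *\<^sub>R W' s) + (h *\<^sub>R W' s) \<bullet> W s)) (at s)"
      using d[OF that] by (intro has_derivative_inner) (auto simp: has_vector_derivative_def)
    then have "((\<lambda>s. W s \<bullet> W s) has_real_derivative 2 * (W s \<bullet> W' s)) (at s)"
      unfolding has_field_derivative_def by (rule has_derivative_eq_rhs) (auto simp: inner_commute)
    then show ?thesis unfolding \<phi>_def by (auto intro!: derivative_eq_intros)
  qed
  have "\<phi> t \<le> \<phi> 0"
  proof (rule DERIV_nonpos_imp_nonincreasing[of 0 t \<phi>])
    fix s assume "s \<ge> 0" "s \<le> t"
    then have s: "s \<in> {0..1}" using assms(4) by auto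
    have "W s \<bullet> W' s \<le> norm (W s) * norm (W' s)" by (rule norm_cauchy_schwarz)
    also have "\<dots> \<le> norm (W s) * (K * norm (W s))" using b[OF s] by (intro mult_left_mono) auto
    also have "\<dots> = K * (W s \<bullet> W s)" by (simp add: power2_norm_eq_inner[symmetric] power2_eq_square)
    finally have "exp (- 2 * K * s) * (2 * (W s \<bullet> W' s)) \<le> exp (- 2 * K * s) * (2 * (K * (W s \<bullet> W s)))"
      by (intro mult_left_mono) auto
    then have "exp (- 2 * K * s) * (2 * (W s \<bullet> W' s)) - 2 * K * exp (- 2 * K * s) * (W s \<bullet> W s) \<le> 0"
      by (simp add: ac_simps)
    then show "\<exists>y. DERIV \<phi> s :> y \<and> y \<le> 0" using d\<phi>[OF s] by blast
  qed (use assms(4) in auto)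
  then have "exp (- 2 * K * t) * (W t \<bullet> W t) \<le> 0" using assms(3) by (simp add: \<phi>_def)
  then have "W t \<bullet> W t \<le> 0" by (simp add: mult_le_0_iff)
  then show ?thesis using inner_gt_zero_iff[of "W t"] by fastforce
qed

text \<open>
  The system \<open>\<partial>\<^sub>b U = A\<^sub>b U\<close> is first solved along the rays issuing from 0; by integrability the defect
  \<open>\<partial>\<^sub>b U - A\<^sub>b U\<close>, multiplied by the ray parameter, solves a homogeneous linear equation along each ray.
\<close>

context ray_equation
begin

definition radial :: "('z \<Rightarrow> 'p \<times> 'z::euclidean_space \<Rightarrow> 'l) \<Rightarrow> 'p \<times> 'z \<Rightarrow> 'z \<Rightarrow> 'l" where
  "radial A \<theta> z = (\<Sum>b\<in>Basis. (z \<bullet> b) *\<^sub>R A b \<theta>)"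

lemma radial_scale: "radial A \<theta> (s *\<^sub>R z) = s *\<^sub>R radial A \<theta> z"
  by (simp add: radial_def scaleR_sum_right)

lemma pr_radial: "pr (radial A \<theta> z) e = (\<Sum>b\<in>Basis. (z \<bullet> b) *\<^sub>R pr (A b \<theta>) e)"
  by (simp add: radial_def sum_left scaleR_left)

text \<open>Only the component of the system along z is solved here. It determines U from its values
  at \<open>z = 0\<close> without any integrability condition.\<close>

lemma radial_solution:
  fixes A :: "'z \<Rightarrow> 'p::euclidean_space \<times> 'z::euclidean_space \<Rightarrow> 'l" and e :: "'p \<Rightarrow> 'e"
  assumes "open \<Theta>" "(x0, 0) \<in> \<Theta>" "open X0" "x0 \<in> X0"
    and A: "\<And>b. b \<in> Basis \<Longrightarrow> smooth_map_on \<Theta> (A b)" and e: "smooth_map_on X0 e"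
  obtains r U where "r > 0" "tube (ball x0 r) r \<subseteq> \<Theta>" "ball x0 r \<subseteq> X0" "smooth_map_on (tube (ball x0 r) r) U"
    "\<And>x. x \<in> ball x0 r \<Longrightarrow> U (x, 0) = e x"
    "\<And>\<theta>. \<theta> \<in> tube (ball x0 r) r \<Longrightarrow> FD U \<theta> (0, snd \<theta>) = pr (radial A \<theta> (snd \<theta>)) (U \<theta>)"
proof -
  obtain K where K: "K > 0" "\<And>a e. norm (pr a e) \<le> norm a * norm e * K" using pos_bounded by blast
  obtain \<Theta>1 \<Theta>2 where \<Theta>12: "open \<Theta>1" "open \<Theta>2" "x0 \<in> \<Theta>1" "0 \<in> \<Theta>2" "\<Theta>1 \<times> \<Theta>2 \<subseteq> \<Theta>"
    using assms(1,2) by (metis open_prod_elim mem_Sigma_iff)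
  obtain r1 where r1: "r1 > 0" "cball x0 r1 \<subseteq> \<Theta>1" using \<Theta>12 open_contains_cball by blast
  obtain r2 where r2: "r2 > 0" "cball 0 r2 \<subseteq> \<Theta>2" using \<Theta>12 open_contains_cball by blast
  obtain r3 where r3: "r3 > 0" "cball x0 r3 \<subseteq> X0" using assms(3,4) open_contains_cball by blast
  let ?Q = "cball x0 r1 \<times> cball 0 r2 :: ('p \<times> 'z) set"
  have Q: "compact ?Q" "?Q \<subseteq> \<Theta>" using r1 r2 \<Theta>12 by (auto intro!: compact_Times)
  have "\<exists>C. \<forall>\<theta>\<in>?Q. norm (A b \<theta>) \<le> C" if "b \<in> Basis" for b
  proof -
    have "bounded (A b ` ?Q)"
      by (rule compact_imp_bounded[OF compact_continuous_image[OF continuous_on_subset[OF smooth_continuous[OF A[OF that]] Q(2)] Q(1)]])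
    then show ?thesis by (auto simp: bounded_iff)
  qed
  then obtain C where C: "\<And>b \<theta>. b \<in> Basis \<Longrightarrow> \<theta> \<in> ?Q \<Longrightarrow> norm (A b \<theta>) \<le> C b" by metis
  define CC where "CC = (\<Sum>b\<in>(Basis::'z set). \<bar>C b\<bar>)"
  have CC: "CC \<ge> 0" by (simp add: CC_def sum_nonneg)
  have rad: "norm (radial A \<theta> z) \<le> norm z * CC" if "\<theta> \<in> ?Q" for \<theta> z
    unfolding radial_def CC_def sum_distrib_left
  proof (rule sum_norm_le)
    fix b :: 'z assume b: "b \<in> Basis"
    have "norm (A b \<theta>) \<le> \<bar>C b\<bar>" using C[OF b that] by linarith
    then show "norm ((z \<bullet> b) *\<^sub>R A b \<theta>) \<le> norm z * \<bar>C b\<bar>" using Basis_le_norm[OF b, of z] by (simp add: mult_mono)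
  qed
  \<comment> \<open>The last entry yields \<open>r * CC * K \<le> 1/2\<close>, the contraction
    condition; adding 1 to CC keeps the denominator positive when all coefficients vanish.\<close>
  define r where "r = min (min r1 r2) (min r3 (1 / (2 * K * (CC + 1))))"
  have r: "r > 0" using r1 r2 r3 K CC by (simp add: r_def)
  have rK: "r * CC * K \<le> 1 / 2"
  proof -
    have "r \<le> 1 / (2 * K * (CC + 1))" by (simp add: r_def)
    then have "r * (2 * K * (CC + 1)) \<le> 1" using K CC by (simp add: pos_le_divide_eq)
    moreover have "r * CC * K \<le> r * (CC + 1) * K" using r K by (intro mult_right_mono mult_left_mono) auto
    ultimately show ?thesis by (simp add: algebra_simps)
  qed
  let ?X = "ball x0 r" let ?T = "tube ?X r :: ('p \<times> 'z) set"
  have TQ: "?T \<subseteq> ?Q" by (auto simp: tube_def r_def)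
  have XX: "?X \<subseteq> X0" "?X \<subseteq> cball x0 r3" using r3 by (auto simp: r_def subset_iff)
  have oX: "open ?X" and oT: "open ?T" by (auto intro: open_tube)
  define L where "L w = radial A (ray w) (snd (snd w))" for w
  define f where "f \<theta> = e (fst \<theta>)" for \<theta> :: "'p \<times> 'z"
  have Ls: "smooth_map_on (ray_dom ?X r) L"
    unfolding L_def radial_def
  proof (intro smooth_sum smooth_scaleR open_ray_dom oX)
    fix b :: 'z assume b: "b \<in> Basis"
    show "smooth_map_on (ray_dom ?X r) (\<lambda>w. snd (snd w) \<bullet> b :: real)"
      by (rule smooth_bounded_linear) (intro bounded_linear_compose[OF bounded_linear_inner_left]
          bounded_linear_compose[OF bounded_linear_snd bounded_linear_snd])
    show "smooth_map_on (ray_dom ?X r) (\<lambda>w. A b (ray w))"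
      by (rule smooth_compose[OF open_ray_dom[OF oX] assms(1) _ smooth_ray[OF open_ray_dom[OF oX]] A[OF b]])
         (use TQ Q(2) in \<open>unfold ray_dom_def, blast\<close>)
  qed
  have fs: "smooth_map_on ?T f"
    unfolding f_def
    by (rule smooth_compose[OF oT assms(3) _ smooth_fst e]) (use XX in \<open>auto simp: tube_def\<close>)
  have hb: "half_bounded pr L ?T"
    unfolding half_bounded_def
  proof (intro ballI allI)
    fix s :: real and \<theta> :: "'p \<times> 'z" and v assume s: "s \<in> {0..1}" "\<theta> \<in> ?T"
    have "norm (pr (L (s, \<theta>)) v) \<le> norm (L (s, \<theta>)) * norm v * K" by (rule K)
    also have "\<dots> \<le> (norm (snd \<theta>) * CC) * norm v * K"
      using rad[of "ray (s, \<theta>)" "snd \<theta>"] ray_tube[OF s] TQ K(1) by (intro mult_right_mono) (auto simp: L_def)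
    also have "\<dots> \<le> (r * CC) * norm v * K"
      using s(2) CC K(1) by (intro mult_right_mono) (auto simp: tube_def)
    also have "\<dots> = (r * CC * K) * norm v" by simp
    also have "\<dots> \<le> norm v / 2" using mult_right_mono[OF rK, of "norm v"] by simp
    finally show "norm (pr (L (s, \<theta>)) v) \<le> norm v / 2" .
  qed
  have "bounded (e ` cball x0 r3)"
    by (rule compact_imp_bounded[OF compact_continuous_image[OF continuous_on_subset[OF smooth_continuous[OF e] r3(2)] compact_cball]])
  then obtain M where "\<And>x. x \<in> cball x0 r3 \<Longrightarrow> norm (e x) \<le> M" unfolding bounded_iff by blast
  then have M: "norm (f \<theta>) \<le> M" if "\<theta> \<in> ?T" for \<theta> using that XX(2) by (auto simp: f_def tube_def)
  obtain U where U: "continuous_on ?T U" "\<And>\<theta>. \<theta> \<in> ?T \<Longrightarrow> U \<theta> = f \<theta> + ray_op pr L U \<theta>"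
    by (rule neumann_solution[OF smooth_continuous[OF Ls] hb smooth_continuous[OF fs] M]) (assumption, rule that)
  have Us: "smooth_map_on ?T U"
    unfolding smooth_map_on_def
    by (intro allI ray_equation_Ck[OF oX _ hb _ U]) (use Ls fs in \<open>simp_all add: smooth_map_on_def\<close>)
  show ?thesis
  proof (rule that[OF r _ XX(1) Us])
    show "?T \<subseteq> \<Theta>" using TQ Q(2) by blast
    fix x assume x: "x \<in> ?X"
    have "ray_op pr L U (x, 0) = 0" by (simp add: ray_op_def L_def radial_def zero_left)
    then show "U (x, 0) = e x" using U(2)[of "(x, 0)"] x r by (simp add: tube_def f_def)
  next
    fix \<theta> assume \<theta>: "\<theta> \<in> ?T"
    obtain x z where xz: "\<theta> = (x, z)" by (cases \<theta>)
    define \<psi> where "\<psi> s = pr (radial A (x, s *\<^sub>R z) z) (U (x, s *\<^sub>R z))" for s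
    have \<psi>c: "continuous_on {0..1} \<psi>"
      using integrand_s_continuous[OF smooth_continuous[OF Ls] U(1) \<theta>] by (simp add: \<psi>_def[abs_def] L_def ray_def xz)
    define \<Psi> where "\<Psi> t = integral {0..t} \<psi>" for t
    have d\<Psi>: "(\<Psi> has_vector_derivative \<psi> t) (at t within {0..1})" if "t \<in> {0..1}" for t
      unfolding \<Psi>_def[abs_def] using integral_has_vector_derivative[OF \<psi>c that] .
    \<comment> \<open>Since \<open>radial\<close> is homogeneous in z, the integral over the unit
      interval at the point \<open>t z\<close> becomes \<open>\<integral> t \<psi> (s t) ds\<close>,
      and substitution turns it into the integral of \<open>\<psi>\<close> from 0 to t.\<close>
    have U\<Psi>: "U (x, t *\<^sub>R z) = e x + \<Psi> t" if t: "t \<in> {0..1}" for t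
    proof -
      have T: "(x, t *\<^sub>R z) \<in> ?T" using ray_tube[OF t \<theta>] by (simp add: ray_def xz)
      have "((\<lambda>s. t *\<^sub>R \<psi> (s * t)) has_integral (\<Psi> (1 * t) - \<Psi> (0 * t))) {0..1}"
      proof (rule fundamental_theorem_of_calculus)
        fix s :: real assume s: "s \<in> {0..1}"
        have st: "s * t \<in> {0..1}" using s t by (auto simp: mult_le_one)
        have "((\<Psi> \<circ> (\<lambda>s. s * t)) has_vector_derivative (t *\<^sub>R \<psi> (s * t))) (at s within {0..1})"
        proof (rule vector_diff_chain_within)
          show "((\<lambda>s. s * t) has_vector_derivative t) (at s within {0..1})"
            by (auto intro!: derivative_eq_intros)
          show "(\<Psi> has_vector_derivative \<psi> (s * t)) (at (s * t) within (\<lambda>s. s * t) ` {0..1})"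
            by (rule has_vector_derivative_within_subset[OF d\<Psi>[OF st]]) (use t in \<open>auto simp: mult_le_one\<close>)
        qed
        then show "((\<lambda>s. \<Psi> (s * t)) has_vector_derivative t *\<^sub>R \<psi> (s * t)) (at s within {0..1})"
          by (simp add: o_def)
      qed simp
      from integral_unique[OF this] have "integral {0..1} (\<lambda>s. t *\<^sub>R \<psi> (s * t)) = \<Psi> t"
        by (simp only: mult_1_left mult_zero_left) (simp add: \<Psi>_def)
      moreover have "ray_op pr L U (x, t *\<^sub>R z) = integral {0..1} (\<lambda>s. t *\<^sub>R \<psi> (s * t))"
        by (simp add: ray_op_def L_def ray_def \<psi>_def radial_scale scaleR_left)
      ultimately show ?thesis using U(2)[OF T] by (simp add: f_def)
    qed
    \<comment> \<open>The formula for U holds for t in the unit interval only, so the derivative at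
      the end point \<open>t = 1\<close> is taken one-sidedly; the ordinary derivative of U is
      compared with it by uniqueness of derivatives within the interval.\<close>
    have "((\<lambda>t. e x + \<Psi> t) has_vector_derivative \<psi> 1) (at 1 within {0..1})"
      using d\<Psi>[of 1] by (auto intro!: derivative_eq_intros)
    then have 1: "((\<lambda>t. U (x, t *\<^sub>R z)) has_vector_derivative \<psi> 1) (at 1 within {0..1})"
      by (rule has_vector_derivative_transform[rotated 2]) (use U\<Psi> in auto)
    have hU: "(U has_derivative FD U \<theta>) (at (x, 1 *\<^sub>R z))" using smooth_has_derivative[OF Us \<theta>] by (simp add: xz)
    have "((\<lambda>t. (x, t *\<^sub>R z)) has_derivative (\<lambda>t. (0, t *\<^sub>R z))) (at 1 within {0..1})"
      by (auto intro!: derivative_eq_intros)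
    from has_derivative_compose[OF this hU]
    have "((\<lambda>t. U (x, t *\<^sub>R z)) has_derivative (\<lambda>t. FD U \<theta> (0, t *\<^sub>R z))) (at 1 within {0..1})" .
    moreover have "FD U \<theta> (0, t *\<^sub>R z) = t *\<^sub>R FD U \<theta> (0, z)" for t
      using linear_scale[OF has_derivative_linear[OF hU], of t "(0, z)"] by simp
    ultimately have 2: "((\<lambda>t. U (x, t *\<^sub>R z)) has_vector_derivative FD U \<theta> (0, z)) (at 1 within {0..1})"
      by (simp add: has_vector_derivative_def)
    have "FD U \<theta> (0, z) = \<psi> 1"
      by (rule vector_derivative_unique_within[OF _ 2 1]) (simp add: trivial_limit_within islimpt_Icc)
    then show "FD U \<theta> (0, snd \<theta>) = pr (radial A \<theta> (snd \<theta>)) (U \<theta>)" by (simp add: \<psi>_def xz)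
  qed
qed

lemma ray_ode_zero:
  fixes A :: "'z \<Rightarrow> 'p::euclidean_space \<times> 'z::euclidean_space \<Rightarrow> 'l"
  assumes A: "\<And>b. b \<in> Basis \<Longrightarrow> continuous_on (tube X \<rho>) (A b)" and \<theta>: "(x, z) \<in> tube X \<rho>"
    and W: "\<And>s. s \<in> {0..1} \<Longrightarrow> (W has_vector_derivative pr (radial A (x, s *\<^sub>R z) z) (W s)) (at s)" "W 0 = 0"
  shows "W 1 = 0"
proof -
  obtain K where K: "K > 0" "\<And>a e. norm (pr a e) \<le> norm a * norm e * K" using pos_bounded by blast
  have T: "(x, s *\<^sub>R z) \<in> tube X \<rho>" if "s \<in> {0..1}" for s using ray_tube[OF that \<theta>] by (simp add: ray_def)
  have "continuous_on {0..1} (\<lambda>s. radial A (x, s *\<^sub>R z) z)"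
    unfolding radial_def
  proof (intro continuous_intros)
    fix a :: 'z assume "a \<in> Basis"
    show "continuous_on {0..1} (\<lambda>s. A a (x, s *\<^sub>R z))"
      by (rule continuous_on_compose2[OF A[OF \<open>a \<in> Basis\<close>]])
         (use T in \<open>auto intro!: continuous_intros\<close>)
  qed
  then have "bounded ((\<lambda>s. radial A (x, s *\<^sub>R z) z) ` {0..1})"
    by (rule compact_imp_bounded[OF compact_continuous_image[OF _ compact_Icc]])
  then obtain c where c: "\<And>s. s \<in> {0..1} \<Longrightarrow> norm (radial A (x, s *\<^sub>R z) z) \<le> c"
    unfolding bounded_iff by blast
  show ?thesis
  proof (rule linear_ode_zero[where W = W and K = "c * K", OF W(1)])
    fix s :: real assume s: "s \<in> {0..1}"
    have "norm (pr (radial A (x, s *\<^sub>R z) z) (W s)) \<le> norm (radial A (x, s *\<^sub>R z) z) * norm (W s) * K" by (rule K)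
    also have "\<dots> \<le> c * norm (W s) * K" using c[OF s] K(1) by (intro mult_right_mono) auto
    finally show "norm (pr (radial A (x, s *\<^sub>R z) z) (W s)) \<le> c * K * norm (W s)" by (simp add: ac_simps)
  qed (use W(2) in auto)
qed

text \<open>The hypothesis \<open>flat\<close> is what commuting mixed derivatives of a solution
  force: \<open>d_b (A_a U) = d_a (A_b U)\<close>, with the derivatives of U eliminated by the
  system itself. The parameter x is never differentiated in it.\<close>

theorem total_linear_system:
  fixes A :: "'z \<Rightarrow> 'p::euclidean_space \<times> 'z::euclidean_space \<Rightarrow> 'l" and e :: "'p \<Rightarrow> 'e"
  assumes "open \<Theta>" "(x0, 0) \<in> \<Theta>" "open X0" "x0 \<in> X0"
    and A: "\<And>b. b \<in> Basis \<Longrightarrow> smooth_map_on \<Theta> (A b)" and e: "smooth_map_on X0 e"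
    and flat: "\<And>\<theta> a b v. \<theta> \<in> \<Theta> \<Longrightarrow> a \<in> Basis \<Longrightarrow> b \<in> Basis \<Longrightarrow>
      pr (FD (A a) \<theta> (0, b)) v + pr (A a \<theta>) (pr (A b \<theta>) v) = pr (FD (A b) \<theta> (0, a)) v + pr (A b \<theta>) (pr (A a \<theta>) v)"
  obtains r U where "r > 0" "tube (ball x0 r) r \<subseteq> \<Theta>" "ball x0 r \<subseteq> X0" "smooth_map_on (tube (ball x0 r) r) U"
    "\<And>x. x \<in> ball x0 r \<Longrightarrow> U (x, 0) = e x"
    "\<And>\<theta> b. \<theta> \<in> tube (ball x0 r) r \<Longrightarrow> b \<in> Basis \<Longrightarrow> FD U \<theta> (0, b) = pr (A b \<theta>) (U \<theta>)"
proof -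
  obtain r U where r: "r > 0" "tube (ball x0 r) r \<subseteq> \<Theta>" "ball x0 r \<subseteq> X0" and Us: "smooth_map_on (tube (ball x0 r) r) U"
    and U0: "\<And>x. x \<in> ball x0 r \<Longrightarrow> U (x, 0) = e x"
    and Ur: "\<And>\<theta>. \<theta> \<in> tube (ball x0 r) r \<Longrightarrow> FD U \<theta> (0, snd \<theta>) = pr (radial A \<theta> (snd \<theta>)) (U \<theta>)"
    using radial_solution[where A = A and e = e, OF assms(1-4) A e] by blast
  let ?T = "tube (ball x0 r) r :: ('p \<times> 'z) set"
  have oT: "open ?T" by (auto intro: open_tube)
  note hU = smooth_has_derivative[OF Us] and hU2 = smooth_has_derivative[OF smooth_FD[OF Us]]
  have hA: "(A b has_derivative FD (A b) \<theta>) (at \<theta>)" if "\<theta> \<in> ?T" "b \<in> Basis" for b \<theta>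
    using smooth_has_derivative[OF A] that r(2) by blast
  have lin: "FD U \<theta> (0, z) = (\<Sum>a\<in>Basis. (z \<bullet> a) *\<^sub>R FD U \<theta> (0, a))"
    and lin2: "FD (\<lambda>\<theta>. FD U \<theta> v) \<theta> (0, z) = (\<Sum>a\<in>Basis. (z \<bullet> a) *\<^sub>R FD (\<lambda>\<theta>. FD U \<theta> v) \<theta> (0, a))"
    if "\<theta> \<in> ?T" for \<theta> z v
    by (rule linear_snd_expansion[OF has_derivative_linear[OF hU[OF that]]], rule linear_snd_expansion[OF has_derivative_linear[OF hU2[OF that]]])
  have linA: "FD (A b) \<theta> (0, z) = (\<Sum>a\<in>Basis. (z \<bullet> a) *\<^sub>R FD (A b) \<theta> (0, a))" if "\<theta> \<in> ?T" "b \<in> Basis" for \<theta> z b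
    by (rule linear_snd_expansion[OF has_derivative_linear[OF hA[OF that]]])
  define D where "D b \<theta> = FD U \<theta> (0, b) - pr (A b \<theta>) (U \<theta>)" for b \<theta>
  define D' where "D' b \<theta> v = FD (\<lambda>\<theta>. FD U \<theta> (0, b)) \<theta> v - (pr (A b \<theta>) (FD U \<theta> v) + pr (FD (A b) \<theta> v) (U \<theta>))" for b \<theta> v
  have hD: "(D b has_derivative D' b \<theta>) (at \<theta>)" if "\<theta> \<in> ?T" "b \<in> Basis" for b \<theta>
    unfolding D_def[abs_def] D'_def[abs_def] by (intro has_derivative_diff hU2 FDERIV hA hU that)
  \<comment> \<open>The radial equation says that the sum of \<open>z_a D_a\<close> vanishes. Its
    derivative in direction b turns the sum of \<open>z_a d_b D_a\<close> into \<open>- D_b\<close>,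
    and \<open>flat\<close> exchanges \<open>d_b D_a\<close> for \<open>d_a D_b\<close> at the price
    of terms linear in D, one of which vanishes by the radial equation again.\<close>
  have key: "D' b \<theta> (0, snd \<theta>) = pr (radial A \<theta> (snd \<theta>)) (D b \<theta>) - D b \<theta>" if \<theta>: "\<theta> \<in> ?T" and b: "b \<in> Basis" for \<theta> b
  proof -
    let ?z = "snd \<theta>" and ?S = "\<lambda>F. (\<Sum>a\<in>Basis. (snd \<theta> \<bullet> a) *\<^sub>R F a) :: 'e"
    have "((\<lambda>\<theta>. \<Sum>a\<in>Basis. (snd \<theta> \<bullet> a) *\<^sub>R D a \<theta>) has_derivative
       (\<lambda>v. \<Sum>a\<in>Basis. (snd \<theta> \<bullet> a) *\<^sub>R D' a \<theta> v + (snd v \<bullet> a) *\<^sub>R D a \<theta>)) (at \<theta>)"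
      by (intro has_derivative_sum has_derivative_scaleR hD[OF \<theta>] has_derivative_inner_left
          has_derivative_snd has_derivative_ident)
    moreover have "(\<Sum>a\<in>Basis. (snd \<theta> \<bullet> a) *\<^sub>R D a \<theta>) = 0" if "\<theta> \<in> ?T" for \<theta>
      using Ur[OF that] lin[OF that, of "snd \<theta>"] by (simp add: D_def pr_radial scaleR_diff_right sum_subtractf)
    ultimately have "(\<lambda>v. \<Sum>a\<in>Basis. (snd \<theta> \<bullet> a) *\<^sub>R D' a \<theta> v + (snd v \<bullet> a) *\<^sub>R D a \<theta>) = FD (\<lambda>\<theta>. 0) \<theta>"
      using FD_eqI FD_cong[OF oT \<theta>] by (metis (no_types, lifting))
    then have "(\<Sum>a\<in>Basis. (snd \<theta> \<bullet> a) *\<^sub>R D' a \<theta> (0, b) + (b \<bullet> a) *\<^sub>R D a \<theta>) = 0"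
      by (auto dest!: fun_cong[of _ _ "(0, b)"])
    then have 1: "?S (\<lambda>a. D' a \<theta> (0, b)) + D b \<theta> = 0"
      using b by (simp add: sum.distrib inner_Basis if_distrib[of "\<lambda>c. c *\<^sub>R _"] sum.delta' cong: if_cong)
    have sym: "FD (\<lambda>\<theta>. FD U \<theta> (0, a)) \<theta> (0, b) = FD (\<lambda>\<theta>. FD U \<theta> (0, b)) \<theta> (0, a)" for a
      by (rule FD_FD_symmetric[OF oT Us \<theta>])
    have "D' b \<theta> (0, ?z) = ?S (\<lambda>a. D' b \<theta> (0, a))"
      unfolding D'_def lin2[OF \<theta>, of _ ?z] lin[OF \<theta>, of ?z] linA[OF \<theta> b, of ?z]
      by (simp add: sum_left sum_right scaleR_left scaleR_right sum_subtractf sum.distrib scaleR_diff_right scaleR_add_right)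
    also have "\<dots> = ?S (\<lambda>a. D' a \<theta> (0, b)) + ?S (\<lambda>a. D' b \<theta> (0, a) - D' a \<theta> (0, b))"
      by (simp add: scaleR_diff_right sum_subtractf)
    also have "?S (\<lambda>a. D' b \<theta> (0, a) - D' a \<theta> (0, b)) = ?S (\<lambda>a. pr (A a \<theta>) (D b \<theta>) - pr (A b \<theta>) (D a \<theta>))"
    proof (rule sum.cong[OF refl])
      fix a :: 'z assume a: "a \<in> Basis"
      have "pr (FD (A a) \<theta> (0, b)) (U \<theta>) + pr (A a \<theta>) (pr (A b \<theta>) (U \<theta>)) = pr (FD (A b) \<theta> (0, a)) (U \<theta>) + pr (A b \<theta>) (pr (A a \<theta>) (U \<theta>))"
        using flat \<theta> r(2) a b by blast
      then have "D' b \<theta> (0, a) - D' a \<theta> (0, b) = pr (A a \<theta>) (D b \<theta>) - pr (A b \<theta>) (D a \<theta>)"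
        unfolding D'_def D_def sym[of a] diff_right by (simp add: algebra_simps)
      then show "(?z \<bullet> a) *\<^sub>R (D' b \<theta> (0, a) - D' a \<theta> (0, b)) = (?z \<bullet> a) *\<^sub>R (pr (A a \<theta>) (D b \<theta>) - pr (A b \<theta>) (D a \<theta>))"
        by simp
    qed
    also have "\<dots> = pr (radial A \<theta> ?z) (D b \<theta>) - pr (A b \<theta>) (?S (\<lambda>a. D a \<theta>))"
      by (simp add: pr_radial sum_right scaleR_right scaleR_diff_right sum_subtractf)
    also have "?S (\<lambda>a. D a \<theta>) = 0"
      using Ur[OF \<theta>] lin[OF \<theta>, of ?z] by (simp add: D_def pr_radial scaleR_diff_right sum_subtractf)
    finally show ?thesis using 1 by (simp add: zero_right eq_neg_iff_add_eq_0[symmetric])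
  qed
  have "D b \<theta> = 0" if \<theta>: "\<theta> \<in> ?T" and b: "b \<in> Basis" for \<theta> b
  proof -
    obtain x z where xz: "\<theta> = (x, z)" by (cases \<theta>)
    have T: "(x, s *\<^sub>R z) \<in> ?T" if "s \<in> {0..1}" for s using ray_tube[OF that \<theta>] by (simp add: ray_def xz)
    \<comment> \<open>The factor s absorbs the summand \<open>- D b \<theta>\<close> of
      \<open>key\<close>, so that W obeys a homogeneous equation; it also gives
      \<open>W 0 = 0\<close> without knowledge of the defect at the origin.\<close>
    define W where "W s = s *\<^sub>R D b (x, s *\<^sub>R z)" for s
    have "W 1 = 0"
    proof (rule ray_ode_zero[where W = W and A = A, OF _ \<theta>[unfolded xz]])
      show "continuous_on ?T (A a)" if "a \<in> Basis" for a
        by (rule continuous_on_subset[OF smooth_continuous[OF A[OF that]] r(2)])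
      fix s :: real assume s: "s \<in> {0..1}"
      let ?\<theta> = "(x, s *\<^sub>R z)"
      have "((\<lambda>s. (x, s *\<^sub>R z)) has_derivative (\<lambda>t. (0, t *\<^sub>R z))) (at s)"
        by (auto intro!: derivative_eq_intros)
      from has_derivative_compose[OF this hD[OF T[OF s] b]]
      have "((\<lambda>s. D b (x, s *\<^sub>R z)) has_derivative (\<lambda>t. D' b ?\<theta> (0, t *\<^sub>R z))) (at s)" .
      moreover have sc: "D' b ?\<theta> (0, t *\<^sub>R z) = t *\<^sub>R D' b ?\<theta> (0, z)" for t
        using linear_scale[OF has_derivative_linear[OF hD[OF T[OF s] b]], of t "(0, z)"] by simp
      ultimately have "((\<lambda>s. D b (x, s *\<^sub>R z)) has_vector_derivative D' b ?\<theta> (0, z)) (at s)"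
        by (simp add: has_vector_derivative_def)
      then have "(W has_vector_derivative s *\<^sub>R D' b ?\<theta> (0, z) + 1 *\<^sub>R D b ?\<theta>) (at s)"
        unfolding W_def[abs_def] by (intro has_vector_derivative_scaleR) auto
      moreover have "s *\<^sub>R D' b ?\<theta> (0, z) + 1 *\<^sub>R D b ?\<theta> = pr (radial A ?\<theta> z) (W s)"
        using key[OF T[OF s] b] by (simp add: sc radial_scale W_def scaleR_left scaleR_right)
      ultimately show "(W has_vector_derivative pr (radial A ?\<theta> z) (W s)) (at s)" by simp
    qed (auto simp: W_def)
    then show ?thesis by (simp add: W_def xz)
  qed
  then have "FD U \<theta> (0, b) = pr (A b \<theta>) (U \<theta>)" if "\<theta> \<in> ?T" "b \<in> Basis" for \<theta> b
    using that by (simp add: D_def)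
  then show ?thesis using that[OF r Us U0] by blast
qed

end

section \<open>Curvature of metrics in coordinates\<close>

lemma partial_eq: "partial i f x = FD f x (axis i 1)"
  by (simp add: partial_def)

lemma partial_eqI: "(f has_derivative f') (at x) \<Longrightarrow> partial i f x = f' (axis i 1)"
  by (simp add: partial_eq FD_eqI)

lemma partial_cong:
  "open S \<Longrightarrow> x \<in> S \<Longrightarrow> (\<And>y. y \<in> S \<Longrightarrow> f y = g y) \<Longrightarrow> partial i f x = partial i g x"
  unfolding partial_eq using FD_cong by metis

lemma partial_const: "partial i (\<lambda>x. c) x = 0"
  by (simp add: partial_eq)

lemma partial_add:
  "f differentiable (at x) \<Longrightarrow> g differentiable (at x) \<Longrightarrow>
   partial i (\<lambda>x. f x + g x) x = partial i f x + partial i g x"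
  using partial_eqI[OF has_derivative_add[OF FD_has_derivative FD_has_derivative]] by (simp add: partial_eq)

lemma partial_mult:
  "f differentiable (at x) \<Longrightarrow> g differentiable (at x) \<Longrightarrow>
   partial i (\<lambda>x. f x * g x) x = f x * partial i g x + partial i f x * g x"
  using partial_eqI[OF has_derivative_mult[OF FD_has_derivative FD_has_derivative]] by (simp add: partial_eq)

lemma partial_sum:
  "(\<And>j. j \<in> I \<Longrightarrow> f j differentiable (at x)) \<Longrightarrow>
   partial i (\<lambda>x. \<Sum>j\<in>I. f j x) x = (\<Sum>j\<in>I. partial i (f j) x)"
  unfolding partial_eq by (subst FD_eqI[OF has_derivative_sum[OF FD_has_derivative]]) auto

lemma smooth_partial: "smooth_map_on S f \<Longrightarrow> smooth_map_on S (partial i f)"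
  unfolding partial_eq[abs_def] by (rule smooth_FD)

lemma partial_commute:
  "open S \<Longrightarrow> smooth_map_on S f \<Longrightarrow> x \<in> S \<Longrightarrow> partial i (partial j f) x = partial j (partial i f) x"
  unfolding partial_eq[abs_def] by (rule FD_FD_symmetric)

lemma partial_slice:
  assumes "(f has_derivative f') (at (x, u))"
  shows "partial i (\<lambda>w. f (x, w)) u = FD f (x, u) (0, axis i 1)"
proof -
  have "((\<lambda>w. (x, w)) has_derivative (\<lambda>v. (0, v))) (at u)" by (auto intro!: derivative_eq_intros)
  from partial_eqI[OF has_derivative_compose[OF this assms]] show ?thesis by (simp add: FD_eqI[OF assms])
qed

section \<open>Positive definite matrices and smooth dependence of Christoffel symbols\<close>

definition pos_def :: "real^'n^'n \<Rightarrow> bool" where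
  "pos_def A \<longleftrightarrow> transpose A = A \<and> (\<forall>v. v \<noteq> 0 \<longrightarrow> v \<bullet> (A *v v) > 0)"

lemma riemannian_metric_iff: "riemannian_metric S h \<longleftrightarrow> smooth_map_on S h \<and> (\<forall>u\<in>S. pos_def (h u))"
  by (auto simp: riemannian_metric_def pos_def_def)

lemma transpose_sym: "transpose A = A \<Longrightarrow> A $ i $ j = A $ j $ i"
  by (simp add: vec_eq_iff transpose_def)

lemma pos_def_sym: "pos_def A \<Longrightarrow> A $ i $ j = A $ j $ i"
  by (simp add: pos_def_def transpose_sym)

lemma inner_mv: "v \<bullet> (A *v w) = (\<Sum>i\<in>UNIV. \<Sum>j\<in>UNIV. A $ i $ j * v $ i * w $ j)" for A :: "real^'n^'m"
  by (simp add: inner_vec_def matrix_vector_mult_def sum_distrib_left ac_simps)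

lemma inner_mv_commute: "transpose A = A \<Longrightarrow> v \<bullet> (A *v w) = w \<bullet> (A *v v)" for A :: "real^'n^'n"
  by (metis dot_lmul_matrix inner_commute transpose_matrix_vector)

lemma pos_def_zero: "pos_def A \<Longrightarrow> v \<bullet> (A *v v) = 0 \<Longrightarrow> v = 0"
  by (metis less_irrefl pos_def_def)

lemma pos_def_invertible: "pos_def A \<Longrightarrow> invertible A"
  unfolding invertible_left_inverse matrix_left_invertible_ker using pos_def_zero by (metis inner_zero_right)

lemma matrix_inv_mult:
  assumes "invertible A"
  shows "A ** matrix_inv A = mat 1" "matrix_inv A ** A = mat 1"
  using someI_ex[OF assms[unfolded invertible_def]] by (auto simp: matrix_inv_def)

text \<open>Cramer's rule: entries of the inverse are quotients of polynomials in the entries of the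
  matrix. This is how smoothness passes to the inverse metric.\<close>

lemma matrix_inv_nth:
  fixes A :: "real^'n^'n"
  assumes "invertible A"
  shows "matrix_inv A $ k $ j = det (\<chi> i l. if l = k then axis j 1 $ i else A $ i $ l) / det A"
proof -
  let ?x = "\<chi> k. matrix_inv A $ k $ j"
  have "A *v ?x = (\<chi> i. (A ** matrix_inv A) $ i $ j)"
    by (simp add: matrix_vector_mult_def matrix_matrix_mult_def)
  also have "\<dots> = axis j 1" by (auto simp: matrix_inv_mult[OF assms] mat_def axis_def vec_eq_iff)
  finally have "?x = (\<chi> k. det (\<chi> i l. if l = k then axis j 1 $ i else A $ i $ l) / det A)"
    using cramer[of A ?x "axis j 1"] assms invertible_det_nz by auto
  then show ?thesis by (simp add: vec_eq_iff)
qed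

lemma smooth_det:
  fixes A :: "'a::real_normed_vector \<Rightarrow> real^'n^'n"
  assumes "open S" "\<And>i j. smooth_map_on S (\<lambda>x. A x $ i $ j)"
  shows "smooth_map_on S (\<lambda>x. det (A x))"
  unfolding det_def by (intro smooth_sum smooth_mult smooth_prod smooth_const assms)

lemma smooth_matrix_inv_nth:
  fixes A :: "'a::real_normed_vector \<Rightarrow> real^'n^'n"
  assumes "open S" "\<And>i j. smooth_map_on S (\<lambda>x. A x $ i $ j)" "\<And>x. x \<in> S \<Longrightarrow> invertible (A x)"
  shows "smooth_map_on S (\<lambda>x. matrix_inv (A x) $ k $ j)"
proof (rule smooth_cong[OF assms(1)])
  show "smooth_map_on S (\<lambda>x. det (\<chi> i l. if l = k then axis j 1 $ i else A x $ i $ l) / det (A x))"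
  proof (intro smooth_divide smooth_det assms)
    fix i l
    show "smooth_map_on S (\<lambda>x. (\<chi> i l. if l = k then axis j 1 $ i else A x $ i $ l) $ i $ l)"
      by (cases "l = k") (simp_all add: smooth_const assms(2))
  qed (use assms(3) invertible_det_nz in blast)
qed (simp add: matrix_inv_nth[OF assms(3)])

lemma smooth_entries: "open S \<Longrightarrow> smooth_map_on S h \<Longrightarrow> smooth_map_on S (\<lambda>x. h x $ i $ j)"
  by (intro smooth_nth)

lemma smooth_christoffel_param:
  fixes h :: "'p::euclidean_space \<Rightarrow> real^'m \<Rightarrow> real^'m^'m"
  assumes "open S" "smooth_map_on S (\<lambda>(x, u). h x u)" "\<And>x u. (x, u) \<in> S \<Longrightarrow> pos_def (h x u)"
  shows "smooth_map_on S (\<lambda>(x, u). christoffel (h x) u d a b)"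
proof -
  have e: "smooth_map_on S (\<lambda>\<theta>. h (fst \<theta>) (snd \<theta>) $ i $ j)" for i j
    using smooth_entries[OF assms(1,2), of i j] by (simp add: case_prod_unfold)
  have p: "smooth_map_on S (\<lambda>\<theta>. partial k (\<lambda>w. h (fst \<theta>) w $ i $ j) (snd \<theta>))" for i j k
  proof (rule smooth_cong[OF assms(1) _ smooth_FD[OF e[of i j], of "(0, axis k 1)"]])
    fix \<theta> assume "\<theta> \<in> S"
    then show "FD (\<lambda>\<theta>. h (fst \<theta>) (snd \<theta>) $ i $ j) \<theta> (0, axis k 1) = partial k (\<lambda>w. h (fst \<theta>) w $ i $ j) (snd \<theta>)"
      using partial_slice[of "\<lambda>\<theta>. h (fst \<theta>) (snd \<theta>) $ i $ j" _ "fst \<theta>" "snd \<theta>" k, unfolded prod.collapse,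
          OF smooth_has_derivative[OF e]] by simp
  qed
  have "smooth_map_on S (\<lambda>\<theta>. christoffel (h (fst \<theta>)) (snd \<theta>) d a b)"
    unfolding christoffel_def
    by (intro smooth_mult smooth_const smooth_sum smooth_add smooth_diff p assms(1) smooth_matrix_inv_nth e pos_def_invertible assms(3)) auto
  then show ?thesis by (simp add: case_prod_unfold)
qed

text \<open>Obtained from the version with parameters by means of a dummy real parameter.\<close>

lemma smooth_christoffel:
  fixes S :: "(real^'m) set"
  assumes "open S" "riemannian_metric S h"
  shows "smooth_map_on S (\<lambda>u. christoffel h u d a b)"
proof -
  have oS: "open (UNIV \<times> S :: (real \<times> (real^'m)) set)" using assms(1) by (intro open_Times) auto
  have "smooth_map_on (UNIV \<times> S :: (real \<times> (real^'m)) set) (\<lambda>(x, u). h u)"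
    unfolding case_prod_unfold
    by (rule smooth_compose[OF oS assms(1) _ smooth_snd]) (use assms(2) in \<open>auto simp: riemannian_metric_iff\<close>)
  then have "smooth_map_on (UNIV \<times> S :: (real \<times> (real^'m)) set) (\<lambda>(x, u). christoffel h u d a b)"
    using assms by (intro smooth_christoffel_param[OF oS, of "\<lambda>x. h"]) (auto simp: riemannian_metric_iff)
  then have "smooth_map_on S (\<lambda>u. (\<lambda>(x, u). christoffel h u d a b) (0::real, u))"
    by (rule smooth_compose[OF assms(1) oS, rotated 2]) (auto intro!: smooth_Pair assms(1) smooth_const smooth_ident)
  then show ?thesis by simp
qed

text \<open>A tensor with the symmetries of a curvature tensor is determined by its sectional
  values. Four Bianchi identities give the pair symmetry; polarising \<open>T v w v w = 0\<close> in
  both arguments then gives antisymmetry in the second and fourth slot. With this all three terms of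
  the Bianchi sum coincide, so three times T vanishes.\<close>

lemma curvature_like_zero:
  fixes T :: "'v::real_vector \<Rightarrow> 'v \<Rightarrow> 'v \<Rightarrow> 'v \<Rightarrow> real"
  assumes add: "\<And>x x' y z w. T (x + x') y z w = T x y z w + T x' y z w"
    "\<And>x y y' z w. T x (y + y') z w = T x y z w + T x y' z w"
    "\<And>x y z z' w. T x y (z + z') w = T x y z w + T x y z' w"
    "\<And>x y z w w'. T x y z (w + w') = T x y z w + T x y z w'"
    and a1: "\<And>x y z w. T x y z w = - T x y w z" and a2: "\<And>x y z w. T x y z w = - T y x z w"
    and bianchi: "\<And>x y z w. T x y z w + T x z w y + T x w y z = 0"
    and sec: "\<And>v w. T v w v w = 0"
  shows "T x y z w = 0"
proof -
  have pair: "T x y z w = T z w x y" for x y z w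
    using bianchi[of x y z w] bianchi[of y z w x] bianchi[of z w x y] bianchi[of w x y z]
      a1[of x y z w] a1[of x z w y] a1[of x w y z] a1[of y z w x] a1[of y w x z] a1[of y x z w]
      a1[of z w x y] a1[of z x y w] a1[of z y w x] a1[of w x y z] a1[of w y z x] a1[of w z x y]
      a2[of x y z w] a2[of x z w y] a2[of x w y z] a2[of y z w x] a2[of y w x z] a2[of y x z w]
      a2[of z w x y] a2[of z x y w] a2[of z y w x] a2[of w x y z] a2[of w y z x] a2[of w z x y]
    by linarith
  have s1: "T v w v' w = 0" for v v' w
    using sec[of "v + v'" w] sec[of v w] sec[of v' w] pair[of v w v' w] by (simp add: add)
  have s2: "T x y z w = - T x w z y" for x y z w
    using s1[of x "y + w" z] s1[of x y z] s1[of x w z] by (simp add: add)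
  show ?thesis
    using bianchi[of x y z w] s2[of x y z w] a1[of x w z y] s2[of x z w y] a1[of x y w z] s2[of x w y z] a1[of x z y w]
    by linarith
qed

lemma sum_rotate: "(\<Sum>c\<in>A. \<Sum>a\<in>A. \<Sum>b\<in>A. f c a b) = (\<Sum>c\<in>A. \<Sum>a\<in>A. \<Sum>b\<in>A. f a b c)"
proof -
  have "(\<Sum>c\<in>A. \<Sum>a\<in>A. \<Sum>b\<in>A. f a b c) = (\<Sum>a\<in>A. \<Sum>c\<in>A. \<Sum>b\<in>A. f a b c)" by (rule sum.swap)
  also have "\<dots> = (\<Sum>a\<in>A. \<Sum>b\<in>A. \<Sum>c\<in>A. f a b c)" by (intro sum.cong refl sum.swap)
  finally show ?thesis by simp
qed

text \<open>Strict Cauchy-Schwarz inequality: the determinant is \<open>v \<bullet> (A *v v)\<close>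
  times the squared A-length of \<open>w - k *\<^sub>R v\<close>, the part of w that is A-orthogonal
  to v.\<close>

lemma gram_pos:
  fixes A :: "real^'m^'m"
  assumes "pos_def A" "v \<noteq> w" "independent {v, w}"
  shows "(v \<bullet> (A *v v)) * (w \<bullet> (A *v w)) - (v \<bullet> (A *v w))\<^sup>2 > 0"
proof -
  have i: "v \<noteq> 0" "w \<notin> span {v}"
    using assms(2,3) independent_insert[of w "{v}"] by (auto simp: insert_commute dependent_zero)
  define k where "k = (v \<bullet> (A *v w)) / (v \<bullet> (A *v v))"
  have vv: "v \<bullet> (A *v v) > 0" using assms(1) i(1) by (simp add: pos_def_def)
  have "w - k *\<^sub>R v \<noteq> 0" using i(2) span_mul[OF span_base, of v "{v}" k] by auto
  then have "(w - k *\<^sub>R v) \<bullet> (A *v (w - k *\<^sub>R v)) > 0" using assms(1) by (simp add: pos_def_def)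
  moreover have "(w - k *\<^sub>R v) \<bullet> (A *v (w - k *\<^sub>R v)) = w \<bullet> (A *v w) - 2 * k * (v \<bullet> (A *v w)) + k\<^sup>2 * (v \<bullet> (A *v v))"
    using inner_mv_commute[of A w v] assms(1)
    by (simp add: pos_def_def matrix_vector_mult_diff_distrib matrix_vector_mult_scaleR inner_diff_left inner_diff_right power2_eq_square algebra_simps)
  ultimately have "0 < (v \<bullet> (A *v v)) * (w \<bullet> (A *v w) - 2 * k * (v \<bullet> (A *v w)) + k\<^sup>2 * (v \<bullet> (A *v v)))"
    using vv by simp
  also have "\<dots> = (v \<bullet> (A *v v)) * (w \<bullet> (A *v w)) - (v \<bullet> (A *v w))\<^sup>2"
    using vv by (simp add: k_def field_simps power2_eq_square)
  finally show ?thesis .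
qed

section \<open>Symmetries of the curvature tensor and constant sectional curvature\<close>

locale coordinate_metric =
  fixes S :: "(real^'m::finite) set" and h :: "real^'m \<Rightarrow> real^'m^'m"
  assumes open_S: "open S" and metric: "riemannian_metric S h"
begin

abbreviation "\<Gamma> u d a b \<equiv> christoffel h u d a b"

lemma pos: "u \<in> S \<Longrightarrow> pos_def (h u)" using metric by (simp add: riemannian_metric_iff)
lemma h_sym: "u \<in> S \<Longrightarrow> h u $ i $ j = h u $ j $ i" using pos pos_def_sym by blast
lemma smooth_h: "smooth_map_on S (\<lambda>u. h u $ i $ j)"
  by (rule smooth_entries[OF open_S]) (use metric in \<open>simp add: riemannian_metric_iff\<close>)
lemmas smooth_\<Gamma> = smooth_christoffel[OF open_S metric]
lemmas diff_h = smooth_differentiable[OF smooth_h] and diff_\<Gamma> = smooth_differentiable[OF smooth_\<Gamma>]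

lemma partial_h_sym: "u \<in> S \<Longrightarrow> partial k (\<lambda>w. h w $ i $ j) u = partial k (\<lambda>w. h w $ j $ i) u"
  by (rule partial_cong[OF open_S]) (auto simp: h_sym)

lemma \<Gamma>_sym: "u \<in> S \<Longrightarrow> \<Gamma> u d a b = \<Gamma> u d b a"
  unfolding christoffel_def by (intro arg_cong2[where f = "(*)"] sum.cong refl) (simp add: partial_h_sym[of u _ a b])

lemma partial_\<Gamma>_sym: "u \<in> S \<Longrightarrow> partial k (\<lambda>w. \<Gamma> w d a b) u = partial k (\<lambda>w. \<Gamma> w d b a) u"
  by (rule partial_cong[OF open_S]) (auto simp: \<Gamma>_sym)

lemma lower_\<Gamma>:
  assumes "u \<in> S"
  shows "(\<Sum>d\<in>UNIV. h u $ c $ d * \<Gamma> u d a b) =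
    1/2 * (partial a (\<lambda>w. h w $ c $ b) u + partial b (\<lambda>w. h w $ c $ a) u - partial c (\<lambda>w. h w $ a $ b) u)"
proof -
  let ?k = "\<lambda>e. partial a (\<lambda>w. h w $ e $ b) u + partial b (\<lambda>w. h w $ e $ a) u - partial e (\<lambda>w. h w $ a $ b) u"
  have "(\<Sum>d\<in>UNIV. h u $ c $ d * \<Gamma> u d a b) = 1/2 * (\<Sum>d\<in>UNIV. \<Sum>e\<in>UNIV. h u $ c $ d * matrix_inv (h u) $ d $ e * ?k e)"
    by (simp add: christoffel_def sum_distrib_left sum_divide_distrib mult.assoc)
  also have "(\<Sum>d\<in>UNIV. \<Sum>e\<in>UNIV. h u $ c $ d * matrix_inv (h u) $ d $ e * ?k e)
      = (\<Sum>e\<in>UNIV. (\<Sum>d\<in>UNIV. h u $ c $ d * matrix_inv (h u) $ d $ e) * ?k e)"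
    unfolding sum_distrib_right by (rule sum.swap)
  also have "\<dots> = (\<Sum>e\<in>UNIV. (h u ** matrix_inv (h u)) $ c $ e * ?k e)"
    by (simp add: matrix_matrix_mult_def)
  also have "\<dots> = ?k c"
    unfolding matrix_inv_mult[OF pos_def_invertible[OF pos[OF assms]]] by (simp add: mat_def if_distrib[of "\<lambda>x. x * _"] cong: if_cong)
  finally show ?thesis .
qed

lemma metric_compatible:
  assumes "u \<in> S"
  shows "partial a (\<lambda>w. h w $ b $ c) u = (\<Sum>d\<in>UNIV. h u $ b $ d * \<Gamma> u d a c) + (\<Sum>d\<in>UNIV. h u $ c $ d * \<Gamma> u d a b)"
  unfolding lower_\<Gamma>[OF assms] using partial_h_sym[OF assms] by (simp add: field_simps)

definition lowered :: "real^'m \<Rightarrow> 'm \<Rightarrow> 'm \<Rightarrow> 'm \<Rightarrow> 'm \<Rightarrow> real" where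
  "lowered u e c a b = (\<Sum>d\<in>UNIV. h u $ e $ d * riemann h u d c a b)"

lemma riemann_antisym: "riemann h u d c a b = - riemann h u d c b a"
  unfolding riemann_def by (simp add: sum_subtractf)

lemma riemann_bianchi:
  assumes "u \<in> S"
  shows "riemann h u d c a b + riemann h u d a b c + riemann h u d b c a = 0"
proof -
  note s = \<Gamma>_sym[OF assms] and ps = partial_\<Gamma>_sym[OF assms]
  have "riemann h u d c a b + riemann h u d a b c + riemann h u d b c a =
    (\<Sum>e\<in>UNIV. (\<Gamma> u d a e * \<Gamma> u e b c - \<Gamma> u d b e * \<Gamma> u e a c) + (\<Gamma> u d b e * \<Gamma> u e c a - \<Gamma> u d c e * \<Gamma> u e b a)
      + (\<Gamma> u d c e * \<Gamma> u e a b - \<Gamma> u d a e * \<Gamma> u e c b))"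
    unfolding riemann_def sum.distrib
    using ps[of a d b c] ps[of b d a c] ps[of c d a b] by simp
  also have "\<dots> = 0" using s[of _ b c] s[of _ a c] s[of _ a b] by simp
  finally show ?thesis .
qed

lemma lowered_antisym1: "lowered u e c a b = - lowered u e c b a"
  unfolding lowered_def riemann_antisym[of u _ c a b] by (simp add: sum_negf)

lemma lowered_bianchi: "u \<in> S \<Longrightarrow> lowered u e c a b + lowered u e a b c + lowered u e b c a = 0"
  using riemann_bianchi[of u] by (simp add: lowered_def sum.distrib[symmetric] distrib_left[symmetric])

text \<open>Expanding \<open>d_a d_b h_ce = d_b d_a h_ce\<close> by metric compatibility leaves the
  sum of the two lowered curvatures. The remaining products of two Christoffel symbols are the terms
  Q, which cancel by the symmetry \<open>Qs\<close>.\<close>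

lemma lowered_antisym2:
  assumes u: "u \<in> S"
  shows "lowered u e c a b = - lowered u c e a b"
proof -
  have pp: "partial a (partial b (\<lambda>w. h w $ c $ e)) u =
    (\<Sum>d\<in>UNIV. h u $ c $ d * partial a (\<lambda>w. \<Gamma> w d b e) u + partial a (\<lambda>w. h w $ c $ d) u * \<Gamma> u d b e) +
    (\<Sum>d\<in>UNIV. h u $ e $ d * partial a (\<lambda>w. \<Gamma> w d b c) u + partial a (\<lambda>w. h w $ e $ d) u * \<Gamma> u d b c)" for a b
  proof -
    have "partial a (partial b (\<lambda>w. h w $ c $ e)) u =
      partial a (\<lambda>w. (\<Sum>d\<in>UNIV. h w $ c $ d * \<Gamma> w d b e) + (\<Sum>d\<in>UNIV. h w $ e $ d * \<Gamma> w d b c)) u"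
      by (rule partial_cong[OF open_S u metric_compatible])
    also have "\<dots> = (\<Sum>d\<in>UNIV. partial a (\<lambda>w. h w $ c $ d * \<Gamma> w d b e) u) + (\<Sum>d\<in>UNIV. partial a (\<lambda>w. h w $ e $ d * \<Gamma> w d b c) u)"
      by (subst partial_add) (auto intro!: partial_sum arg_cong2[where f = "(+)"] differentiable_sum differentiable_mult diff_h[OF u] diff_\<Gamma>[OF u])
    finally show ?thesis by (simp add: partial_mult diff_h[OF u] diff_\<Gamma>[OF u])
  qed
  define Q where "Q a b e c = (\<Sum>d\<in>UNIV. \<Sum>f\<in>UNIV. h u $ d $ f * \<Gamma> u f a e * \<Gamma> u d b c)" for a b e c
  have Qs: "Q a b e c = Q b a c e" for a b e c
    unfolding Q_def by (subst sum.swap) (simp add: h_sym[OF u] ac_simps)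
  have exp: "(\<Sum>d\<in>UNIV. partial a (\<lambda>w. h w $ e $ d) u * \<Gamma> u d b c) =
     (\<Sum>d\<in>UNIV. h u $ e $ d * (\<Sum>f\<in>UNIV. \<Gamma> u d a f * \<Gamma> u f b c)) + Q a b e c" for a b e c
  proof -
    have "(\<Sum>d\<in>UNIV. partial a (\<lambda>w. h w $ e $ d) u * \<Gamma> u d b c) =
      (\<Sum>d\<in>UNIV. (\<Sum>f\<in>UNIV. h u $ e $ f * \<Gamma> u f a d * \<Gamma> u d b c)) + Q a b e c"
      by (simp add: metric_compatible[OF u] Q_def distrib_right sum.distrib sum_distrib_right)
    also have "(\<Sum>d\<in>UNIV. (\<Sum>f\<in>UNIV. h u $ e $ f * \<Gamma> u f a d * \<Gamma> u d b c)) =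
      (\<Sum>d\<in>UNIV. h u $ e $ d * (\<Sum>f\<in>UNIV. \<Gamma> u d a f * \<Gamma> u f b c))"
      by (subst sum.swap) (simp add: sum_distrib_left mult.assoc)
    finally show ?thesis .
  qed
  have low: "lowered u e c a b = (\<Sum>d\<in>UNIV. h u $ e $ d * partial a (\<lambda>w. \<Gamma> w d b c) u) - (\<Sum>d\<in>UNIV. h u $ e $ d * partial b (\<lambda>w. \<Gamma> w d a c) u)
    + (\<Sum>d\<in>UNIV. h u $ e $ d * (\<Sum>f\<in>UNIV. \<Gamma> u d a f * \<Gamma> u f b c)) - (\<Sum>d\<in>UNIV. h u $ e $ d * (\<Sum>f\<in>UNIV. \<Gamma> u d b f * \<Gamma> u f a c))" for e c
    unfolding lowered_def riemann_def by (simp add: sum_subtractf right_diff_distrib distrib_left sum.distrib)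
  have "partial a (partial b (\<lambda>w. h w $ c $ e)) u = partial b (partial a (\<lambda>w. h w $ c $ e)) u"
    by (rule partial_commute[OF open_S smooth_h u])
  then have "lowered u e c a b + lowered u c e a b = 0"
    unfolding pp low sum.distrib exp using Qs[of a b e c] Qs[of a b c e] by linarith
  then show ?thesis by simp
qed

text \<open>This is the inner product of \<open>R(z, w) y\<close> with x; note that the plane of the
  curvature operator is in the last two arguments.\<close>

definition curvature_form :: "real^'m \<Rightarrow> real^'m \<Rightarrow> real^'m \<Rightarrow> real^'m \<Rightarrow> real^'m \<Rightarrow> real" where
  "curvature_form u x y z w = (\<Sum>e\<in>UNIV. \<Sum>c\<in>UNIV. \<Sum>a\<in>UNIV. \<Sum>b\<in>UNIV. lowered u e c a b * x $ e * y $ c * z $ a * w $ b)"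

lemma sectional_curvature_eq:
  "sectional_curvature h u v w = curvature_form u v w v w
    / ((v \<bullet> (h u *v v)) * (w \<bullet> (h u *v w)) - (v \<bullet> (h u *v w))\<^sup>2)"
proof -
  have "(\<Sum>a\<in>UNIV. \<Sum>b\<in>UNIV. \<Sum>c\<in>UNIV. \<Sum>d\<in>UNIV. \<Sum>e\<in>UNIV. h u $ e $ d * riemann h u d c a b * v $ a * w $ b * w $ c * v $ e)
    = (\<Sum>a\<in>UNIV. \<Sum>b\<in>UNIV. \<Sum>c\<in>UNIV. \<Sum>e\<in>UNIV. lowered u e c a b * v $ a * w $ b * w $ c * v $ e)"
    unfolding lowered_def sum_distrib_right by (intro sum.cong refl sum.swap)
  also have "\<dots> = (\<Sum>e\<in>UNIV. \<Sum>a\<in>UNIV. \<Sum>b\<in>UNIV. \<Sum>c\<in>UNIV. lowered u e c a b * v $ a * w $ b * w $ c * v $ e)"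
  proof -
    have "(\<Sum>a\<in>UNIV. \<Sum>b\<in>UNIV. \<Sum>c\<in>UNIV. \<Sum>e\<in>UNIV. lowered u e c a b * v $ a * w $ b * w $ c * v $ e)
      = (\<Sum>a\<in>UNIV. \<Sum>b\<in>UNIV. \<Sum>e\<in>UNIV. \<Sum>c\<in>UNIV. lowered u e c a b * v $ a * w $ b * w $ c * v $ e)"
      by (intro sum.cong refl sum.swap)
    also have "\<dots> = (\<Sum>a\<in>UNIV. \<Sum>e\<in>UNIV. \<Sum>b\<in>UNIV. \<Sum>c\<in>UNIV. lowered u e c a b * v $ a * w $ b * w $ c * v $ e)"
      by (intro sum.cong refl sum.swap)
    finally show ?thesis by (rule trans[OF _ sum.swap])
  qed
  also have "\<dots> = curvature_form u v w v w"
    unfolding curvature_form_def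
    by (rule sum.cong[OF refl], rule trans[OF sum_rotate]) (simp add: ac_simps)
  finally show ?thesis by (simp add: sectional_curvature_def)
qed

text \<open>Lowering the index d loses nothing because h u is nondegenerate.\<close>

lemma riemann_eq_iff:
  assumes u: "u \<in> S"
  shows "(\<forall>d c a b. riemann h u d c a b = C * (h u $ b $ c * (if d = a then 1 else 0) - h u $ a $ c * (if d = b then 1 else 0)))
    \<longleftrightarrow> (\<forall>e c a b. lowered u e c a b = C * (h u $ b $ c * h u $ e $ a - h u $ a $ c * h u $ e $ b))" (is "?L \<longleftrightarrow> ?R")
proof -
  have r: "(\<Sum>d\<in>UNIV. h u $ e $ d * (C * (h u $ b $ c * (if d = a then 1 else 0) - h u $ a $ c * (if d = b then 1 else 0))))
    = C * (h u $ b $ c * h u $ e $ a - h u $ a $ c * h u $ e $ b)" for e c a b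
    by (simp add: right_diff_distrib sum_subtractf if_distrib[of "\<lambda>x. _ * x"] cong: if_cong)
  show ?thesis
  proof
    assume ?L then show ?R unfolding lowered_def r[symmetric] by simp
  next
    assume R: ?R
    show ?L
    proof (intro allI)
      fix d c a b
      let ?k = "\<lambda>d. C * (h u $ b $ c * (if d = a then 1 else 0) - h u $ a $ c * (if d = b then 1 else 0))"
      let ?v = "\<chi> d. riemann h u d c a b - ?k d"
      have "h u *v ?v = 0"
        using R[rule_format, of _ c a b]
        by (simp add: vec_eq_iff matrix_vector_mult_def right_diff_distrib[of _ "riemann _ _ _ _ _ _"] sum_subtractf r lowered_def[symmetric])
      then have "?v = 0" using pos_def_zero[OF pos[OF u], of ?v] by simp
      then show "riemann h u d c a b = ?k d" by (simp add: vec_eq_iff)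
    qed
  qed
qed

lemma curvature_form_linear:
  "curvature_form u (x + x') y z w = curvature_form u x y z w + curvature_form u x' y z w"
  "curvature_form u x (y + y') z w = curvature_form u x y z w + curvature_form u x y' z w"
  "curvature_form u x y (z + z') w = curvature_form u x y z w + curvature_form u x y z' w"
  "curvature_form u x y z (w + w') = curvature_form u x y z w + curvature_form u x y z w'"
  unfolding curvature_form_def by (simp_all add: distrib_left distrib_right sum.distrib)

lemma curvature_form_antisym1: "curvature_form u x y z w = - curvature_form u x y w z"
proof -
  have "curvature_form u x y w z = (\<Sum>e\<in>UNIV. \<Sum>c\<in>UNIV. \<Sum>a\<in>UNIV. \<Sum>b\<in>UNIV. lowered u e c b a * x $ e * y $ c * w $ b * z $ a)"
    unfolding curvature_form_def by (intro sum.cong refl sum.swap)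
  also have "\<dots> = - curvature_form u x y z w"
    unfolding curvature_form_def sum_negf[symmetric]
    by (intro sum.cong refl, subst lowered_antisym1) (simp add: ac_simps)
  finally show ?thesis by simp
qed

lemma curvature_form_antisym2:
  assumes "u \<in> S" shows "curvature_form u x y z w = - curvature_form u y x z w"
proof -
  have "curvature_form u y x z w = (\<Sum>e\<in>UNIV. \<Sum>c\<in>UNIV. \<Sum>a\<in>UNIV. \<Sum>b\<in>UNIV. lowered u c e a b * y $ c * x $ e * z $ a * w $ b)"
    unfolding curvature_form_def by (rule sum.swap)
  also have "\<dots> = - curvature_form u x y z w"
    unfolding curvature_form_def sum_negf[symmetric]
    by (intro sum.cong refl, subst lowered_antisym2[OF assms]) (simp add: ac_simps)
  finally show ?thesis by simp
qed

lemma curvature_form_bianchi: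
  assumes "u \<in> S"
  shows "curvature_form u x y z w + curvature_form u x z w y + curvature_form u x w y z = 0"
proof -
  have r: "curvature_form u x y z w = (\<Sum>e\<in>UNIV. \<Sum>c\<in>UNIV. \<Sum>a\<in>UNIV. \<Sum>b\<in>UNIV. lowered u e a b c * x $ e * y $ a * z $ b * w $ c)" for x y z w
    unfolding curvature_form_def by (rule sum.cong[OF refl], rule sum_rotate)
  have r2: "curvature_form u x y z w = (\<Sum>e\<in>UNIV. \<Sum>c\<in>UNIV. \<Sum>a\<in>UNIV. \<Sum>b\<in>UNIV. lowered u e b c a * x $ e * y $ b * z $ c * w $ a)" for x y z w
    unfolding r by (rule sum.cong[OF refl], rule sum_rotate)
  have "curvature_form u x y z w + curvature_form u x z w y + curvature_form u x w y z =
    (\<Sum>e\<in>UNIV. \<Sum>c\<in>UNIV. \<Sum>a\<in>UNIV. \<Sum>b\<in>UNIV. (lowered u e c a b + lowered u e a b c + lowered u e b c a) * x $ e * y $ c * z $ a * w $ b)"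
    unfolding curvature_form_def[of u x y z w] r[of x z w y] r2[of x w y z] sum.distrib[symmetric]
    by (intro sum.cong refl) (simp add: algebra_simps)
  then show ?thesis by (simp add: lowered_bianchi[OF assms])
qed

lemma curvature_form_axis: "curvature_form u (axis e 1) (axis c 1) (axis a 1) (axis b 1) = lowered u e c a b"
  unfolding curvature_form_def by (simp add: axis_def if_distrib[of "\<lambda>x. _ * x"] cong: if_cong)

text \<open>T is the difference to the model tensor of constant curvature C. It has the curvature
  symmetries and vanishing sectional values, so \<open>curvature_like_zero\<close> applies.\<close>

theorem constant_sectional_imp_riemann:
  assumes u: "u \<in> S" and sec: "\<And>v w. v \<noteq> w \<Longrightarrow> independent {v, w} \<Longrightarrow> sectional_curvature h u v w = C"
  shows "riemann h u d c a b = C * (h u $ b $ c * (if d = a then 1 else 0) - h u $ a $ c * (if d = b then 1 else 0))"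
proof -
  define H where "H v w = v \<bullet> (h u *v w)" for v w
  have Hs: "H v w = H w v" for v w
    unfolding H_def by (rule inner_mv_commute) (use pos[OF u] in \<open>simp add: pos_def_def\<close>)
  have Ha: "H (v + v') w = H v w + H v' w" "H v (w + w') = H v w + H v w'" for v v' w w'
    by (simp_all add: H_def inner_add_left inner_add_right matrix_vector_right_distrib)
  define T where "T x y z w = curvature_form u x y z w - C * (H w y * H x z - H z y * H x w)" for x y z w
  note lin = curvature_form_linear
  have a1: "T x y z w = - T x y w z" for x y z w
    using curvature_form_antisym1[of u x y z w] by (simp add: T_def algebra_simps)
  have a2: "T x y z w = - T y x z w" for x y z w
    using curvature_form_antisym2[OF u, of x y z w] Hs[of x z] Hs[of y w] Hs[of x w] Hs[of y z] by (simp add: T_def algebra_simps)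
  have sec0: "T v w v w = 0" for v w
  proof (cases "v \<noteq> w \<and> independent {v, w}")
    case True
    then have "H v v * H w w - (H v w)\<^sup>2 > 0" unfolding H_def using gram_pos[OF pos[OF u]] by blast
    moreover have "curvature_form u v w v w / (H v v * H w w - (H v w)\<^sup>2) = C"
      using sec[of v w] True unfolding sectional_curvature_eq H_def by blast
    ultimately have "curvature_form u v w v w = C * (H v v * H w w - (H v w)\<^sup>2)" by (simp add: field_simps)
    then show ?thesis by (simp add: T_def power2_eq_square algebra_simps)
  next
    case False
    \<comment> \<open>Dependent pairs are not covered by the curvature hypothesis; for them T
      vanishes because it is alternating.\<close>
    have z: "T v w v v = 0" "T v v v w = 0" for v w using a1[of v w v v] a2[of v v v w] by auto
    have hom: "T x y z (k *\<^sub>R w) = k * T x y z w" for x y z w k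
      unfolding T_def curvature_form_def H_def
      by (simp add: sum_distrib_left matrix_vector_mult_scaleR algebra_simps)
    have "v = 0 \<or> (\<exists>k. w = k *\<^sub>R v)"
    proof (rule ccontr)
      assume a: "\<not> ?thesis"
      then have "w \<notin> span {v}" by (auto simp: span_singleton)
      then have "independent {w, v}" using a independent_insert[of w "{v}"] by auto
      moreover have "v \<noteq> w" using a by (metis scaleR_one)
      ultimately show False using False by (simp add: insert_commute)
    qed
    then show ?thesis
    proof
      assume "v = 0"
      then show ?thesis by (simp add: T_def curvature_form_def H_def)
    next
      assume "\<exists>k. w = k *\<^sub>R v"
      then obtain k where "w = k *\<^sub>R v" by blast
      then show ?thesis using hom z by simp
    qed
  qed
  have "T x y z w = 0" for x y z w
  proof (rule curvature_like_zero[of T])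
    show "T x y z w + T x z w y + T x w y z = 0" for x y z w
      using curvature_form_bianchi[OF u, of x y z w] Hs[of z y] Hs[of w y] Hs[of w z] by (simp add: T_def algebra_simps)
  qed (use a1 a2 sec0 in \<open>auto simp: T_def lin Ha algebra_simps\<close>)
  then have "T (axis e 1) (axis c 1) (axis a 1) (axis b 1) = 0" for e c a b by blast
  moreover have "H (axis i 1) (axis j 1) = h u $ i $ j" for i j
    by (simp add: H_def inner_axis' matrix_vector_mul_component inner_axis)
  ultimately have "\<forall>e c a b. lowered u e c a b = C * (h u $ b $ c * h u $ e $ a - h u $ a $ c * h u $ e $ b)"
    by (simp add: T_def curvature_form_axis)
  then show ?thesis using riemann_eq_iff[OF u] by blast
qed

theorem riemann_imp_constant_sectional:
  assumes u: "u \<in> S" and R: "\<And>d c a b. riemann h u d c a b = C * (h u $ b $ c * (if d = a then 1 else 0) - h u $ a $ c * (if d = b then 1 else 0))"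
    and "v \<noteq> w" "independent {v, w}"
  shows "sectional_curvature h u v w = C"
proof -
  define H where "H v w = v \<bullet> (h u *v w)" for v w
  have l: "lowered u e c a b = C * (h u $ b $ c * h u $ e $ a - h u $ a $ c * h u $ e $ b)" for e c a b
    using riemann_eq_iff[OF u, of C] R by blast
  have "curvature_form u v w v w =
     C * ((\<Sum>e\<in>UNIV. \<Sum>c\<in>UNIV. \<Sum>a\<in>UNIV. \<Sum>b\<in>UNIV. (h u $ e $ a * v $ e * v $ a) * (h u $ c $ b * w $ c * w $ b))
      - (\<Sum>e\<in>UNIV. \<Sum>c\<in>UNIV. \<Sum>a\<in>UNIV. \<Sum>b\<in>UNIV. (h u $ e $ b * v $ e * w $ b) * (h u $ c $ a * w $ c * v $ a)))"
    unfolding curvature_form_def l sum_distrib_left sum_subtractf[symmetric]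
    by (intro sum.cong refl) (simp add: h_sym[OF u, of _ "_"] algebra_simps)
  also have "\<dots> = C * (H v v * H w w - H v w * H w v)"
    unfolding H_def inner_mv
    by (simp add: sum_distrib_left[symmetric] sum_distrib_right[symmetric])
  also have "H w v = H v w" unfolding H_def by (rule inner_mv_commute) (use pos[OF u] in \<open>simp add: pos_def_def\<close>)
  finally have "curvature_form u v w v w = C * (H v v * H w w - (H v w)\<^sup>2)" by (simp add: power2_eq_square)
  moreover have "H v v * H w w - (H v w)\<^sup>2 > 0" unfolding H_def using gram_pos[OF pos[OF u] assms(3,4)] .
  ultimately show ?thesis unfolding sectional_curvature_eq by (simp add: H_def[symmetric])
qed

end

section \<open>Metrics of constant curvature and maps to the unit sphere\<close>

text \<open>The type \<open>'m option\<close> will index frames along the sphere: None for the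
  position vector, Some b for its b-th partial derivative. The bijection says that such a frame has
  as many members as the ambient space has dimensions.\<close>

lemma card_option_eq:
  assumes "CARD('n::finite) = CARD('m::finite) + 1"
  obtains \<beta> :: "'n::finite \<Rightarrow> 'm::finite option" where "bij \<beta>"
proof -
  have "card (UNIV :: 'n set) = card (UNIV :: 'm option set)" using assms by (simp add: card_UNIV_option)
  then obtain \<beta> :: "'n \<Rightarrow> 'm option" where "bij_betw \<beta> UNIV UNIV"
    using finite_same_card_bij[of "UNIV :: 'n set" "UNIV :: 'm option set"] by auto
  then show ?thesis using that by blast
qed

lemma sum_option_UNIV: "(\<Sum>e\<in>UNIV. f e) = f None + (\<Sum>e\<in>UNIV. f (Some e))" for f :: "'m::finite option \<Rightarrow> 'a::comm_monoid_add"
  by (simp add: UNIV_option_conv sum.reindex inj_on_def)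

lemma bounded_bilinear_form: "bounded_bilinear (\<lambda>v w. v \<bullet> (A *v w))" for A :: "real^'n^'n"
  by (intro bilinear_conv_bounded_bilinear[THEN iffD1])
     (auto simp: bilinear_def inner_left_distrib inner_right_distrib matrix_vector_right_distrib
        matrix_vector_mult_scaleR intro!: linearI)

lemma smooth_bilinear_FD:
  assumes "bounded_bilinear pr" "smooth_map_on S f" "smooth_map_on S g" "u \<in> S"
  shows "FD (\<lambda>u. pr (f u) (g u)) u v = pr (f u) (FD g u v) + pr (FD f u v) (g u)"
  using FD_eqI[OF bounded_bilinear.FDERIV[OF assms(1) smooth_has_derivative[OF assms(2,4)] smooth_has_derivative[OF assms(3,4)]]]
  by simp

context coordinate_metric
begin

text \<open>Z together with its partial derivatives is a frame of the ambient space, so the second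
  derivatives of Z are determined by their products with the frame, all of which follow from
  \<open>unit\<close> and \<open>iso\<close>. The curvature appears on comparing frame coefficients
  of the commuting third derivatives.\<close>

theorem sphere_immersion_curvature:
  fixes A :: "real^'n^'n" and Z :: "real^'m \<Rightarrow> real^'n"
  assumes dim: "CARD('n) = CARD('m) + 1" and A: "pos_def A" and Z: "smooth_map_on S Z" and k: "k > 0"
    and unit: "\<And>u. u \<in> S \<Longrightarrow> Z u \<bullet> (A *v Z u) = 1"
    and iso: "\<And>u b c. u \<in> S \<Longrightarrow> FD Z u (axis b 1) \<bullet> (A *v FD Z u (axis c 1)) = k * h u $ b $ c"
    and u0: "u0 \<in> S"
  shows "riemann h u0 d c a b = k * (h u0 $ b $ c * (if d = a then 1 else 0) - h u0 $ a $ c * (if d = b then 1 else 0))"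
proof -
  define ip where "ip v w = v \<bullet> (A *v w)" for v w
  have bb: "bounded_bilinear ip" unfolding ip_def[abs_def] by (rule bounded_bilinear_form)
  interpret ip: bounded_bilinear ip by (rule bb)
  have ips: "ip v w = ip w v" for v w
    unfolding ip_def by (rule inner_mv_commute) (use A in \<open>simp add: pos_def_def\<close>)
  define Zd where "Zd b u = FD Z u (axis b 1)" for b u
  define Zdd where "Zdd b c u = FD (Zd b) u (axis c 1)" for b c u
  have sZd: "smooth_map_on S (Zd b)" for b unfolding Zd_def[abs_def] by (rule smooth_FD[OF Z])
  have sZdd: "smooth_map_on S (Zdd b c)" for b c unfolding Zdd_def[abs_def] by (rule smooth_FD[OF sZd])
  have Zdd_sym: "Zdd b c u = Zdd c b u" if "u \<in> S" for b c u
    unfolding Zdd_def Zd_def[abs_def] by (rule FD_FD_symmetric[OF open_S Z that])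
  have unit': "ip (Z u) (Z u) = 1" if "u \<in> S" for u using unit[OF that] by (simp add: ip_def)
  have iso': "ip (Zd b u) (Zd c u) = k * h u $ b $ c" if "u \<in> S" for u b c using iso[OF that] by (simp add: ip_def Zd_def)
  have orth: "ip (Z u) (Zd b u) = 0" if u: "u \<in> S" for u b
  proof -
    have "FD (\<lambda>u. ip (Z u) (Z u)) u (axis b 1) = FD (\<lambda>u. 1) u (axis b 1)"
      using FD_cong[OF open_S u unit'] by simp
    then show ?thesis using smooth_bilinear_FD[OF bb Z Z u, of "axis b 1"] ips[of "Z u" "Zd b u"] by (simp add: Zd_def)
  qed
  have ZZdd: "ip (Z u) (Zdd b c u) = - k * h u $ b $ c" if u: "u \<in> S" for u b c
  proof -
    have "FD (\<lambda>u. ip (Z u) (Zd b u)) u (axis c 1) = FD (\<lambda>u. 0) u (axis c 1)"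
      using FD_cong[OF open_S u orth] by simp
    then have "ip (Z u) (Zdd b c u) + ip (Zd c u) (Zd b u) = 0"
      using smooth_bilinear_FD[OF bb Z sZd u, of b "axis c 1"] by (simp add: Zd_def Zdd_def)
    then show ?thesis using iso'[OF u, of c b] h_sym[OF u, of c b] by simp
  qed
  have dh: "ip (Zd b u) (Zdd c a u) + ip (Zdd b a u) (Zd c u) = k * partial a (\<lambda>w. h w $ b $ c) u" if u: "u \<in> S" for u a b c
  proof -
    have "FD (\<lambda>u. ip (Zd b u) (Zd c u)) u (axis a 1) = FD (\<lambda>u. k * h u $ b $ c) u (axis a 1)"
      using FD_cong[OF open_S u iso'] by simp
    also have "\<dots> = k * partial a (\<lambda>w. h w $ b $ c) u"
      unfolding partial_eq by (subst FD_eqI[OF has_derivative_mult_right[OF smooth_has_derivative[OF smooth_h u]]]) simp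
    finally show ?thesis using smooth_bilinear_FD[OF bb sZd sZd u, of b c "axis a 1"] by (simp add: Zdd_def)
  qed
  \<comment> \<open>Of the derivatives of \<open>iso'\<close> in three index placements, two are
    added and one subtracted; by symmetry of \<open>Zdd\<close> twice the wanted product remains.
    The Christoffel symbols come from the same combination of derivatives of h.\<close>
  have koszul: "ip (Zdd a b u) (Zd c u) = k * (\<Sum>d\<in>UNIV. h u $ c $ d * \<Gamma> u d a b)" if u: "u \<in> S" for u a b c
    unfolding lower_\<Gamma>[OF u]
    using dh[OF u, of b c a] dh[OF u, of a c b] dh[OF u, of a b c] Zdd_sym[OF u] ips partial_h_sym[OF u]
    by (simp add: field_simps)
  have indep: "s = 0 \<and> (\<forall>d. y d = 0)" if u: "u \<in> S" and z: "s *\<^sub>R Z u + (\<Sum>d\<in>UNIV. y d *\<^sub>R Zd d u) = 0" for u s y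
  proof -
    have "ip (Z u) (s *\<^sub>R Z u + (\<Sum>d\<in>UNIV. y d *\<^sub>R Zd d u)) = s"
      by (simp add: ip.add_right ip.scaleR_right ip.sum_right unit'[OF u] orth[OF u])
    then have s: "s = 0" using z by (simp add: ip.zero_right)
    have "ip (Zd e u) (s *\<^sub>R Z u + (\<Sum>d\<in>UNIV. y d *\<^sub>R Zd d u)) = k * (\<Sum>d\<in>UNIV. h u $ e $ d * y d)" for e
      by (simp add: s ip.add_right ip.scaleR_right ip.sum_right iso'[OF u] sum_distrib_left ac_simps)
    then have "(\<Sum>d\<in>UNIV. h u $ e $ d * y d) = 0" for e using z k by (simp add: ip.zero_right)
    then have "h u *v (\<chi> d. y d) = 0" by (simp add: vec_eq_iff matrix_vector_mult_def)
    then have "(\<chi> d. y d) = 0" using pos_def_zero[OF pos[OF u], of "\<chi> d. y d"] by simp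
    then show ?thesis using s by (simp add: vec_eq_iff)
  qed
  \<comment> \<open>Independence plus the dimension count: the coefficient space has dimension
    \<open>CARD('m) + 1 = CARD('n)\<close>.\<close>
  have span: "\<exists>s y. v = s *\<^sub>R Z u + (\<Sum>d\<in>UNIV. y d *\<^sub>R Zd d u)" if u: "u \<in> S" for u and v :: "real^'n"
  proof -
    define f where "f q = fst q *\<^sub>R Z u + (\<Sum>d\<in>UNIV. (snd q $ d) *\<^sub>R Zd d u)" for q :: "real \<times> (real^'m)"
    have lf: "linear f" unfolding f_def by (rule linearI) (simp_all add: scaleR_add_left sum.distrib scaleR_add_right scaleR_sum_right)
    have "inj f" unfolding linear_injective_0[OF lf]
      using indep[OF u] by (auto simp: f_def prod_eq_iff vec_eq_iff)
    moreover have "dim (UNIV :: (real \<times> (real^'m)) set) = dim (UNIV :: (real^'n) set)"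
      using dim by (simp add: dim_UNIV)
    ultimately have "f ` UNIV = UNIV"
      using dim_image_eq[OF lf, of UNIV] lf
      by (intro subspace_dim_equal) (auto intro: linear_subspace_image subspace_UNIV simp: inj_on_def)
    then obtain q where "v = f q" by blast
    then show ?thesis unfolding f_def by blast
  qed
  have gauss: "Zdd a b u = (\<Sum>d\<in>UNIV. \<Gamma> u d a b *\<^sub>R Zd d u) - (k * h u $ a $ b) *\<^sub>R Z u" if u: "u \<in> S" for u a b
  proof -
    define D where "D = Zdd a b u - ((\<Sum>d\<in>UNIV. \<Gamma> u d a b *\<^sub>R Zd d u) - (k * h u $ a $ b) *\<^sub>R Z u)"
    have "ip D (Z u) = 0"
      unfolding ips[of D] unfolding D_def ip.diff_right ip.sum_right ip.scaleR_right
      by (simp add: ZZdd[OF u] orth[OF u] unit'[OF u])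
    moreover have "ip D (Zd c u) = 0" for c
      unfolding D_def ip.diff_left ip.sum_left ip.scaleR_left koszul[OF u]
      by (simp add: orth[OF u] iso'[OF u] sum_distrib_left h_sym[OF u, of c] ac_simps)
    ultimately have "ip D v = 0" for v
      using span[OF u, of v] by (auto simp: ip.add_right ip.sum_right ip.scaleR_right)
    then have "D = 0" using pos_def_zero[OF A] by (simp add: ip_def)
    then show ?thesis by (simp add: D_def)
  qed
  \<comment> \<open>The tangential frame coefficients of the third derivative. Their difference
    under exchange of a and b is the curvature tensor minus its constant curvature model; the
    coefficient of Z is irrelevant and stays existential in \<open>third\<close>.\<close>
  define R1 where "R1 a b c d = partial a (\<lambda>w. \<Gamma> w d b c) u0 + (\<Sum>e\<in>UNIV. \<Gamma> u0 d a e * \<Gamma> u0 e b c) - k * h u0 $ b $ c * (if d = a then 1 else 0)" for a b c d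
  have third: "\<exists>s. FD (Zdd b c) u0 (axis a 1) = s *\<^sub>R Z u0 + (\<Sum>d\<in>UNIV. R1 a b c d *\<^sub>R Zd d u0)" for a b c
  proof -
    let ?s = "- (k * partial a (\<lambda>w. h w $ b $ c) u0) - (\<Sum>e\<in>UNIV. \<Gamma> u0 e b c * (k * h u0 $ e $ a))"
    have hdG: "((\<lambda>u. \<Gamma> u d b c *\<^sub>R Zd d u) has_derivative (\<lambda>v. \<Gamma> u0 d b c *\<^sub>R FD (Zd d) u0 v + FD (\<lambda>u. \<Gamma> u d b c) u0 v *\<^sub>R Zd d u0)) (at u0)" for d
      by (intro has_derivative_scaleR smooth_has_derivative[OF smooth_\<Gamma> u0] smooth_has_derivative[OF sZd u0])
    have hdh: "((\<lambda>u. (k * h u $ b $ c) *\<^sub>R Z u) has_derivative (\<lambda>v. (k * h u0 $ b $ c) *\<^sub>R FD Z u0 v + (k * FD (\<lambda>u. h u $ b $ c) u0 v) *\<^sub>R Z u0)) (at u0)"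
      by (intro has_derivative_scaleR has_derivative_mult_right smooth_has_derivative[OF smooth_h u0] smooth_has_derivative[OF Z u0])
    have "FD (Zdd b c) u0 = FD (\<lambda>u. (\<Sum>d\<in>UNIV. \<Gamma> u d b c *\<^sub>R Zd d u) - (k * h u $ b $ c) *\<^sub>R Z u) u0"
      by (rule FD_cong[OF open_S u0 gauss])
    also have "\<dots> = (\<lambda>v. (\<Sum>d\<in>UNIV. \<Gamma> u0 d b c *\<^sub>R FD (Zd d) u0 v + FD (\<lambda>u. \<Gamma> u d b c) u0 v *\<^sub>R Zd d u0)
       - ((k * h u0 $ b $ c) *\<^sub>R FD Z u0 v + (k * FD (\<lambda>u. h u $ b $ c) u0 v) *\<^sub>R Z u0))"
      by (rule FD_eqI) (intro has_derivative_diff has_derivative_sum hdG hdh)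
    finally have "FD (Zdd b c) u0 (axis a 1) = (\<Sum>d\<in>UNIV. \<Gamma> u0 d b c *\<^sub>R Zdd d a u0 + partial a (\<lambda>u. \<Gamma> u d b c) u0 *\<^sub>R Zd d u0)
       - ((k * h u0 $ b $ c) *\<^sub>R Zd a u0 + (k * partial a (\<lambda>u. h u $ b $ c) u0) *\<^sub>R Z u0)"
      by (simp add: Zdd_def Zd_def partial_eq)
    also have "(\<Sum>d\<in>UNIV. \<Gamma> u0 d b c *\<^sub>R Zdd d a u0 + partial a (\<lambda>u. \<Gamma> u d b c) u0 *\<^sub>R Zd d u0) =
      (\<Sum>d\<in>UNIV. \<Sum>e\<in>UNIV. (\<Gamma> u0 e a d * \<Gamma> u0 d b c) *\<^sub>R Zd e u0) - (\<Sum>e\<in>UNIV. \<Gamma> u0 e b c * (k * h u0 $ e $ a)) *\<^sub>R Z u0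
      + (\<Sum>d\<in>UNIV. partial a (\<lambda>u. \<Gamma> u d b c) u0 *\<^sub>R Zd d u0)"
      by (simp add: gauss[OF u0] \<Gamma>_sym[OF u0, of _ _ a] sum.distrib scaleR_diff_right scaleR_sum_right sum_subtractf scaleR_sum_left mult.commute)
    also have "(\<Sum>d\<in>UNIV. \<Sum>e\<in>UNIV. (\<Gamma> u0 e a d * \<Gamma> u0 d b c) *\<^sub>R Zd e u0) = (\<Sum>d\<in>UNIV. (\<Sum>e\<in>UNIV. \<Gamma> u0 d a e * \<Gamma> u0 e b c) *\<^sub>R Zd d u0)"
      by (subst sum.swap) (simp add: scaleR_sum_left)
    finally have "FD (Zdd b c) u0 (axis a 1) = ?s *\<^sub>R Z u0 + ((\<Sum>d\<in>UNIV. partial a (\<lambda>u. \<Gamma> u d b c) u0 *\<^sub>R Zd d u0)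
       + (\<Sum>d\<in>UNIV. (\<Sum>e\<in>UNIV. \<Gamma> u0 d a e * \<Gamma> u0 e b c) *\<^sub>R Zd d u0) - (k * h u0 $ b $ c) *\<^sub>R Zd a u0)"
      by (simp add: scaleR_diff_left algebra_simps)
    also have "(k * h u0 $ b $ c) *\<^sub>R Zd a u0 = (\<Sum>d\<in>UNIV. (k * h u0 $ b $ c * (if d = a then 1 else 0)) *\<^sub>R Zd d u0)"
      by (simp add: if_distrib[of "\<lambda>x. _ * x"] if_distrib[of "\<lambda>x. x *\<^sub>R _"] cong: if_cong)
    finally show ?thesis
      by (intro exI[of _ ?s]) (simp add: R1_def scaleR_add_left scaleR_diff_left sum.distrib sum_subtractf)
  qed
  obtain s where s: "FD (Zdd b c) u0 (axis a 1) = s *\<^sub>R Z u0 + (\<Sum>d\<in>UNIV. R1 a b c d *\<^sub>R Zd d u0)" using third by blast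
  obtain s' where s': "FD (Zdd a c) u0 (axis b 1) = s' *\<^sub>R Z u0 + (\<Sum>d\<in>UNIV. R1 b a c d *\<^sub>R Zd d u0)" using third by blast
  have "FD (Zdd b c) u0 (axis a 1) = FD (Zdd c b) u0 (axis a 1)" for a b
    by (rule arg_cong[where f = "\<lambda>g. g (axis a 1)"], rule FD_cong[OF open_S u0 Zdd_sym])
  moreover have "FD (Zdd c b) u0 (axis a 1) = FD (Zdd c a) u0 (axis b 1)"
    unfolding Zdd_def[abs_def] by (rule FD_FD_symmetric[OF open_S sZd u0])
  ultimately have "FD (Zdd b c) u0 (axis a 1) = FD (Zdd a c) u0 (axis b 1)" by metis
  then have "(s - s') *\<^sub>R Z u0 + (\<Sum>d\<in>UNIV. (R1 a b c d - R1 b a c d) *\<^sub>R Zd d u0) = 0"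
    unfolding s s' by (simp add: scaleR_diff_left sum_subtractf algebra_simps)
  from indep[OF u0 this] have "R1 a b c d = R1 b a c d" by simp
  then show ?thesis
    by (simp add: R1_def riemann_def sum_subtractf algebra_simps)
qed

end

section \<open>Sphere maps with smooth dependence on a parameter\<close>

lemma smooth_riemann_param:
  fixes h :: "'p::euclidean_space \<Rightarrow> real^'m \<Rightarrow> real^'m^'m"
  assumes "open S" "smooth_map_on S (\<lambda>(x, u). h x u)" "\<And>x u. (x, u) \<in> S \<Longrightarrow> pos_def (h x u)"
  shows "smooth_map_on S (\<lambda>(x, u). riemann (h x) u d c a b)"
proof -
  have e: "smooth_map_on S (\<lambda>\<theta>. christoffel (h (fst \<theta>)) (snd \<theta>) d a b)" for d a b
    using smooth_christoffel_param[OF assms] by (simp add: case_prod_unfold)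
  have p: "smooth_map_on S (\<lambda>\<theta>. partial k (\<lambda>w. christoffel (h (fst \<theta>)) w d a b) (snd \<theta>))" for d a b k
  proof (rule smooth_cong[OF assms(1) _ smooth_FD[OF e[of d a b], of "(0, axis k 1)"]])
    fix \<theta> assume "\<theta> \<in> S"
    then show "FD (\<lambda>\<theta>. christoffel (h (fst \<theta>)) (snd \<theta>) d a b) \<theta> (0, axis k 1) = partial k (\<lambda>w. christoffel (h (fst \<theta>)) w d a b) (snd \<theta>)"
      using partial_slice[of "\<lambda>\<theta>. christoffel (h (fst \<theta>)) (snd \<theta>) d a b" _ "fst \<theta>" "snd \<theta>" k, unfolded prod.collapse,
          OF smooth_has_derivative[OF e]] by simp
  qed
  have "smooth_map_on S (\<lambda>\<theta>. riemann (h (fst \<theta>)) (snd \<theta>) d c a b)"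
    unfolding riemann_def by (intro smooth_mult smooth_sum smooth_add smooth_diff p e assms(1))
  then show ?thesis by (simp add: case_prod_unfold)
qed

context ray_equation
begin

text \<open>Along each ray from \<open>z = 0\<close> a total system restricts to a homogeneous
  linear ODE, so zero values on that slice propagate to the whole tube.\<close>

lemma total_system_zero:
  fixes A :: "'z \<Rightarrow> 'p::euclidean_space \<times> 'z::euclidean_space \<Rightarrow> 'l"
  assumes V: "\<And>\<theta>. \<theta> \<in> tube X \<rho> \<Longrightarrow> (V has_derivative V' \<theta>) (at \<theta>)"
    and A: "\<And>b. b \<in> Basis \<Longrightarrow> continuous_on (tube X \<rho>) (A b)"
    and eq: "\<And>\<theta> b. \<theta> \<in> tube X \<rho> \<Longrightarrow> b \<in> Basis \<Longrightarrow> V' \<theta> (0, b) = pr (A b \<theta>) (V \<theta>)"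
    and "\<And>x. x \<in> X \<Longrightarrow> V (x, 0) = 0" "\<theta> \<in> tube X \<rho>"
  shows "V \<theta> = 0"
proof -
  obtain x z where xz: "\<theta> = (x, z)" by (cases \<theta>)
  have T: "(x, s *\<^sub>R z) \<in> tube X \<rho>" if "s \<in> {0..1}" for s using ray_tube[OF that assms(5)] by (simp add: ray_def xz)
  define W where "W s = V (x, s *\<^sub>R z)" for s
  have "W 1 = 0"
  proof (rule ray_ode_zero[where W = W and A = A, OF A assms(5)[unfolded xz]])
    fix s :: real assume s: "s \<in> {0..1}"
    let ?\<theta> = "(x, s *\<^sub>R z)"
    have "((\<lambda>s. (x, s *\<^sub>R z)) has_derivative (\<lambda>t. (0, t *\<^sub>R z))) (at s)"
      by (auto intro!: derivative_eq_intros)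
    from has_derivative_compose[OF this V[OF T[OF s]]]
    have "(W has_derivative (\<lambda>t. V' ?\<theta> (0, t *\<^sub>R z))) (at s)" by (simp add: W_def[abs_def])
    moreover have "V' ?\<theta> (0, t *\<^sub>R z) = t *\<^sub>R V' ?\<theta> (0, z)" for t
      using linear_scale[OF has_derivative_linear[OF V[OF T[OF s]]], of t "(0, z)"] by simp
    moreover have "V' ?\<theta> (0, z) = pr (radial A ?\<theta> z) (W s)"
      unfolding pr_radial linear_snd_expansion[OF has_derivative_linear[OF V[OF T[OF s]]], of z]
      by (intro sum.cong refl) (simp add: eq[OF T[OF s]] W_def)
    ultimately show "(W has_vector_derivative pr (radial A ?\<theta> z) (W s)) (at s)"
      by (simp add: has_vector_derivative_def)
  qed (use assms(4,5) in \<open>auto simp: W_def xz tube_def\<close>)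
  then show ?thesis by (simp add: W_def xz)
qed

end

lemma bounded_bilinear_matrix_mult: "bounded_bilinear ((**) :: real^'n^'m \<Rightarrow> real^'k^'n \<Rightarrow> real^'k^'m)"
  by (intro bilinear_conv_bounded_bilinear[THEN iffD1])
     (auto simp: bilinear_def matrix_matrix_mult_def vec_eq_iff sum.distrib algebra_simps sum_distrib_left intro!: linearI)

lemma bounded_linear_transpose: "bounded_linear (transpose :: real^'n^'m \<Rightarrow> real^'m^'n)"
  by (intro linear_conv_bounded_linear[THEN iffD1]) (auto simp: transpose_def vec_eq_iff intro!: linearI)

text \<open>The action of a coefficient matrix on Gram matrices: if U has derivative
  \<open>l ** U\<close>, then \<open>U ** transpose U\<close> has the derivative given by this
  product.\<close>

lemma bounded_bilinear_lyapunov: "bounded_bilinear (\<lambda>(l :: real^'n^'n) e. l ** e + e ** transpose l)"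
proof -
  interpret m: bounded_bilinear "(**) :: real^'n^'n \<Rightarrow> real^'n^'n \<Rightarrow> _" by (rule bounded_bilinear_matrix_mult)
  interpret t: bounded_linear "transpose :: real^'n^'n \<Rightarrow> real^'n^'n" by (rule bounded_linear_transpose)
  show ?thesis
    by (intro bilinear_conv_bounded_bilinear[THEN iffD1])
       (auto simp: bilinear_def m.add_left m.add_right m.scaleR_left m.scaleR_right t.add t.scaleR scaleR_add_right intro!: linearI)
qed

text \<open>The orthonormal basis is produced by explicit formulas rather than by a pointwise
  existence statement, because it has to vary smoothly with x.\<close>

lemma smooth_gram_schmidt:
  fixes G :: "'p::euclidean_space \<Rightarrow> real^'k^'k"
  assumes "open X" "smooth_map_on X G" "\<And>x. x \<in> X \<Longrightarrow> pos_def (G x)"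
  obtains Q :: "'p \<Rightarrow> real^'k^'k" where "smooth_map_on X Q" "\<And>x. x \<in> X \<Longrightarrow> transpose (Q x) ** (G x ** Q x) = mat 1"
proof -
  define ip where "ip x v w = v \<bullet> (G x *v w)" for x v w
  have sip: "smooth_map_on X (\<lambda>x. ip x (v x) (w x))" if "smooth_map_on X v" "smooth_map_on X w" for v w
    unfolding ip_def inner_mv
    by (intro smooth_sum smooth_mult smooth_entries smooth_nth assms(1,2) that)
  \<comment> \<open>The vanishing of all coordinates outside I stands in for linear independence: it
    gives the vector w of the next step the k-th coordinate 1, so w is nonzero and can be
    normalised.\<close>
  have "\<exists>q. (\<forall>i\<in>I. smooth_map_on X (q i)) \<and> (\<forall>i\<in>I. \<forall>x\<in>X. \<forall>j. j \<notin> I \<longrightarrow> q i x $ j = 0) \<and>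
      (\<forall>i\<in>I. \<forall>j\<in>I. \<forall>x\<in>X. ip x (q i x) (q j x) = (if i = j then 1 else 0))" for I :: "'k set"
  proof (induction I rule: finite_induct[OF finite])
    case 1
    then show ?case by simp
  next
    case (2 k I)
    then obtain q where q: "\<And>i. i \<in> I \<Longrightarrow> smooth_map_on X (q i)" "\<And>i x j. i \<in> I \<Longrightarrow> x \<in> X \<Longrightarrow> j \<notin> I \<Longrightarrow> q i x $ j = 0"
      "\<And>i j x. i \<in> I \<Longrightarrow> j \<in> I \<Longrightarrow> x \<in> X \<Longrightarrow> ip x (q i x) (q j x) = (if i = j then 1 else 0)" by blast
    define w where "w x = axis k 1 - (\<Sum>i\<in>I. ip x (axis k 1) (q i x) *\<^sub>R q i x)" for x
    have sw: "smooth_map_on X w"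
      unfolding w_def by (intro smooth_diff smooth_sum smooth_scaleR sip smooth_const assms(1) q)
    have wk: "w x $ k = 1" if "x \<in> X" for x using q(2)[OF _ that 2(2)] by (simp add: w_def)
    have wpos: "ip x (w x) (w x) > 0" if "x \<in> X" for x
    proof -
      have "w x \<noteq> 0" using wk[OF that] by auto
      then show ?thesis using assms(3)[OF that] by (simp add: ip_def pos_def_def)
    qed
    have ips: "ip x v w = ip x w v" if "x \<in> X" for x v w
      unfolding ip_def by (rule inner_mv_commute) (use assms(3)[OF that] in \<open>simp add: pos_def_def\<close>)
    have worth: "ip x (w x) (q j x) = 0" if x: "x \<in> X" and j: "j \<in> I" for x j
    proof -
      interpret ip: bounded_bilinear "ip x" unfolding ip_def[abs_def] by (rule bounded_bilinear_form)
      have "(\<Sum>i\<in>I. ip x (axis k 1) (q i x) * (if i = j then 1 else 0)) = ip x (axis k 1) (q j x)"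
        using j by (simp add: if_distrib[of "\<lambda>x. _ * x"] cong: if_cong)
      then show ?thesis
        by (simp add: w_def ip.diff_left ip.sum_left ip.scaleR_left q(3)[OF _ j x])
    qed
    define q' where "q' = q (k := \<lambda>x. (1 / sqrt (ip x (w x) (w x))) *\<^sub>R w x)"
    have q'i: "q' i = q i" if "i \<in> I" for i using that 2(2) by (auto simp: q'_def)
    have q'k: "q' k x = (1 / sqrt (ip x (w x) (w x))) *\<^sub>R w x" for x by (simp add: q'_def)
    show ?case
    proof (intro exI[of _ q'] conjI ballI allI impI)
      fix i assume "i \<in> insert k I"
      moreover have "smooth_map_on X (q' k)"
        unfolding q'_def fun_upd_same
        by (intro smooth_scaleR smooth_divide smooth_sqrt smooth_const sip sw assms(1)) (use wpos in force)+
      ultimately show "smooth_map_on X (q' i)" using q(1) q'i by auto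
      fix x assume x: "x \<in> X"
      { fix j assume j: "j \<notin> insert k I"
        have "w x $ j = 0" using q(2)[OF _ x, of _ j] j by (simp add: w_def axis_def)
        then show "q' i x $ j = 0" using \<open>i \<in> insert k I\<close> q(2)[OF _ x, of _ j] j q'i q'k by auto }
      fix j assume j: "j \<in> insert k I"
      interpret ip: bounded_bilinear "ip x" unfolding ip_def[abs_def] by (rule bounded_bilinear_form)
      have kk: "ip x (q' k x) (q' k x) = 1"
        using wpos[OF x] by (simp add: q'k ip.scaleR_left ip.scaleR_right real_sqrt_mult_self field_simps)
      have ki: "ip x (q' k x) (q' i x) = 0" if "i \<in> I" for i
        using worth[OF x that] by (simp add: q'k q'i[OF that] ip.scaleR_left)
      have ik: "ip x (q' i x) (q' k x) = 0" if "i \<in> I" for i using ki[OF that] ips[OF x] by simp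
      show "ip x (q' i x) (q' j x) = (if i = j then 1 else 0)"
        using \<open>i \<in> insert k I\<close> j 2(2) kk ki ik q(3)[OF _ _ x] q'i by auto
    qed
  qed
  from this[of UNIV] obtain q :: "'k \<Rightarrow> 'p \<Rightarrow> real^'k" where q': "\<forall>i\<in>UNIV. smooth_map_on X (q i)"
    "\<forall>i\<in>UNIV. \<forall>j\<in>UNIV. \<forall>x\<in>X. ip x (q i x) (q j x) = (if i = j then 1 else 0)" by blast
  then have q: "\<And>i. smooth_map_on X (q i)" "\<And>i j x. x \<in> X \<Longrightarrow> ip x (q i x) (q j x) = (if i = j then 1 else 0)" by auto
  define Q where "Q x = (\<chi> r c. q c x $ r)" for x
  show ?thesis
  proof (rule that[of Q])
    show "smooth_map_on X Q"
      unfolding Q_def by (intro smooth_vec[OF assms(1)]) (simp add: smooth_nth[OF assms(1) q(1)])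
    fix x assume "x \<in> X"
    have "(transpose (Q x) ** (G x ** Q x)) $ i $ j = ip x (q i x) (q j x)" for i j
      unfolding ip_def inner_vec_def
      by (simp add: matrix_matrix_mult_def transpose_def Q_def matrix_vector_mult_def)
    then show "transpose (Q x) ** (G x ** Q x) = mat 1"
      using q(2)[OF \<open>x \<in> X\<close>] by (simp add: vec_eq_iff mat_def)
  qed
qed

text \<open>From \<open>Q^T G Q = 1\<close> follows \<open>Q Q^T G = 1\<close>, hence
  \<open>(G Q) (G Q)^T = G\<close>. E is \<open>G Q\<close> with its columns renamed by
  \<open>\<beta>\<close>, so that its rows become vectors of the ambient space.\<close>

lemma smooth_factorization:
  fixes G :: "'p::euclidean_space \<Rightarrow> real^'k^'k" and \<beta> :: "'n::finite \<Rightarrow> 'k"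
  assumes "open X" "smooth_map_on X G" "\<And>x. x \<in> X \<Longrightarrow> pos_def (G x)" "bij \<beta>"
  obtains E :: "'p \<Rightarrow> real^'n^'k" where "smooth_map_on X E" "\<And>x. x \<in> X \<Longrightarrow> E x ** transpose (E x) = G x"
proof -
  obtain Q :: "'p \<Rightarrow> real^'k^'k" where Q: "smooth_map_on X Q" "\<And>x. x \<in> X \<Longrightarrow> transpose (Q x) ** (G x ** Q x) = mat 1"
    using smooth_gram_schmidt[OF assms(1-3)] by blast
  define E where "E x = (\<chi> r n. (G x ** Q x) $ r $ \<beta> n)" for x
  have sGQ: "smooth_map_on X (\<lambda>x. G x ** Q x)"
    by (rule smooth_bilinear[OF bounded_bilinear_matrix_mult assms(1,2) Q(1)])
  show ?thesis
  proof (rule that[of E])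
    show "smooth_map_on X E"
      unfolding E_def by (intro smooth_vec[OF assms(1)]) (simp add: smooth_entries[OF assms(1) sGQ])
    fix x assume x: "x \<in> X"
    have "(transpose (Q x) ** G x) ** Q x = mat 1" using Q(2)[OF x] by (simp add: matrix_mul_assoc)
    then have "Q x ** (transpose (Q x) ** G x) = mat 1" using matrix_left_right_inverse by blast
    then have "G x ** (Q x ** (transpose (Q x) ** G x)) = G x" by simp
    moreover have "transpose (G x) = G x" using assms(3)[OF x] by (simp add: pos_def_def)
    ultimately have "(G x ** Q x) ** transpose (G x ** Q x) = G x"
      by (simp add: matrix_transpose_mul matrix_mul_assoc)
    moreover have "(E x ** transpose (E x)) $ i $ j = ((G x ** Q x) ** transpose (G x ** Q x)) $ i $ j" for i j
      unfolding E_def matrix_matrix_mult_def[of "\<chi> r n. _ r n"] matrix_matrix_mult_def[of "G x ** Q x"] transpose_def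
      using sum.reindex_bij_betw[OF assms(4), of "\<lambda>n. (G x ** Q x) $ i $ n * (G x ** Q x) $ j $ n"] by simp
    ultimately show "E x ** transpose (E x) = G x" by (simp add: vec_eq_iff)
  qed
qed

text \<open>Matrix form of \<open>d_i Z = Z_i\<close> and
  \<open>d_i Z_b = Gamma^c_ib Z_c - C H_ib Z\<close> for the frame with rows Z and
  \<open>Z_b\<close>. The argument G takes the upper Christoffel index first.\<close>

definition sphere_system :: "real \<Rightarrow> real^'m^'m \<Rightarrow> ('m \<Rightarrow> 'm \<Rightarrow> 'm \<Rightarrow> real) \<Rightarrow> 'm \<Rightarrow> real^('m::finite option)^('m option)" where
  "sphere_system C H G i = (\<chi> r c. case r of
     None \<Rightarrow> (case c of None \<Rightarrow> 0 | Some c \<Rightarrow> if c = i then 1 else 0)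
   | Some b \<Rightarrow> (case c of None \<Rightarrow> - C * H $ i $ b | Some c \<Rightarrow> G c i b))"

definition sphere_gram :: "real \<Rightarrow> real^'m^'m \<Rightarrow> real^('m::finite option)^('m option)" where
  "sphere_gram C H = (\<chi> r c. case r of
     None \<Rightarrow> (case c of None \<Rightarrow> 1 | Some c \<Rightarrow> 0)
   | Some b \<Rightarrow> (case c of None \<Rightarrow> 0 | Some c \<Rightarrow> C * H $ b $ c))"

lemma sphere_system_nth [simp]:
  "sphere_system C H G i $ None $ None = 0" "sphere_system C H G i $ None $ Some c = (if c = i then 1 else 0)"
  "sphere_system C H G i $ Some b $ None = - C * H $ i $ b" "sphere_system C H G i $ Some b $ Some c = G c i b"
  by (simp_all add: sphere_system_def)

lemma sphere_gram_nth [simp]: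
  "sphere_gram C H $ None $ None = 1" "sphere_gram C H $ None $ Some c = 0"
  "sphere_gram C H $ Some b $ None = 0" "sphere_gram C H $ Some b $ Some c = C * H $ b $ c"
  by (simp_all add: sphere_gram_def)

lemma pos_def_sphere_gram:
  assumes "C > 0" "pos_def H"
  shows "pos_def (sphere_gram C H)"
  unfolding pos_def_def
proof (intro conjI allI impI)
  have "sphere_gram C H $ r $ c = sphere_gram C H $ c $ r" for r c
    using pos_def_sym[OF assms(2)] by (cases r; cases c) auto
  then show "transpose (sphere_gram C H) = sphere_gram C H" by (simp add: vec_eq_iff transpose_def)
  fix v :: "real^('a option)" assume v: "v \<noteq> 0"
  let ?v = "\<chi> b. v $ Some b"
  have e: "v \<bullet> (sphere_gram C H *v v) = (v $ None)\<^sup>2 + C * (?v \<bullet> (H *v ?v))"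
    unfolding inner_mv sum_option_UNIV by (simp add: sum_distrib_left power2_eq_square ac_simps)
  show "0 < v \<bullet> (sphere_gram C H *v v)"
  proof (cases "?v = 0")
    case True
    then have "v $ Some b = 0" for b by (simp add: vec_eq_iff)
    then have "v $ None \<noteq> 0" using v by (metis not_None_eq vec_eq_iff zero_index)
    then show ?thesis unfolding e True by simp
  next
    case False
    then have "?v \<bullet> (H *v ?v) > 0" using assms(2) by (simp add: pos_def_def)
    then show ?thesis unfolding e using assms(1) by (simp add: add_nonneg_pos)
  qed
qed

text \<open>
  The rows of the matrix U solving \<open>\<partial>\<^sub>i U = sphere_system ** U\<close> are a map Z (the row None) and its partial
  derivatives; the system says that the Hessian of each component f of Z is \<open>- C f\<close> times the metric.
  The Gram matrix of the rows solves the same equation as \<open>sphere_gram\<close>, so it suffices that they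
  agree at 0.
\<close>

lemma open_Pair0_vimage:
  fixes S :: "('a::topological_space \<times> 'b::real_normed_vector) set"
  assumes "open S" shows "open {x. (x, 0) \<in> S}"
proof -
  have "open ((\<lambda>x. (x, 0)) -` S)" by (rule open_vimage[OF assms]) (auto intro!: continuous_intros)
  then show ?thesis unfolding vimage_def .
qed

theorem sphere_immersion_param:
  fixes h :: "'p::euclidean_space \<Rightarrow> real^'m \<Rightarrow> real^'m^'m" and C :: "'p \<Rightarrow> real"
  assumes dim: "CARD('n::finite) = CARD('m) + 1"
    and S: "open S" "(x0, 0) \<in> S" and X0: "open X0" "S \<subseteq> X0 \<times> UNIV"
    and h: "smooth_map_on S (\<lambda>(x, u). h x u)" "\<And>x u. (x, u) \<in> S \<Longrightarrow> pos_def (h x u)"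
    and C: "smooth_map_on X0 C" "\<And>x. x \<in> X0 \<Longrightarrow> C x > 0"
    and R: "\<And>x u d c a b. (x, u) \<in> S \<Longrightarrow> riemann (h x) u d c a b =
        C x * (h x u $ b $ c * (if d = a then 1 else 0) - h x u $ a $ c * (if d = b then 1 else 0))"
  obtains r and Z :: "'p \<times> (real^'m) \<Rightarrow> real^'n" where "r > 0" "tube (ball x0 r) r \<subseteq> S"
    "smooth_map_on (tube (ball x0 r) r) Z" "\<And>\<theta>. \<theta> \<in> tube (ball x0 r) r \<Longrightarrow> Z \<theta> \<bullet> Z \<theta> = 1"
    "\<And>\<theta> b c. \<theta> \<in> tube (ball x0 r) r \<Longrightarrow>
       FD Z \<theta> (0, axis b 1) \<bullet> FD Z \<theta> (0, axis c 1) = C (fst \<theta>) * h (fst \<theta>) (snd \<theta>) $ b $ c"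
    "\<And>\<theta> b. \<theta> \<in> tube (ball x0 r) r \<Longrightarrow> Z \<theta> \<bullet> FD Z \<theta> (0, axis b 1) = 0"
proof -
  interpret ray_equation "(**) :: real^('m option)^('m option) \<Rightarrow> real^'n^('m option) \<Rightarrow> _"
    unfolding ray_equation_def by (rule bounded_bilinear_matrix_mult)
  interpret ly: ray_equation "\<lambda>(l :: real^('m option)^('m option)) e. l ** e + e ** transpose l"
    unfolding ray_equation_def by (rule bounded_bilinear_lyapunov)
  define M where "M i \<theta> = sphere_system (C (fst \<theta>)) (h (fst \<theta>) (snd \<theta>)) (christoffel (h (fst \<theta>)) (snd \<theta>)) i" for i \<theta>
  define G where "G \<theta> = sphere_gram (C (fst \<theta>)) (h (fst \<theta>) (snd \<theta>))" for \<theta>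
  have slice: "coordinate_metric {u. (x, u) \<in> S} (h x)" for x
  proof
    have o: "open ((\<lambda>u. (x, u)) -` S)" by (rule open_vimage[OF S(1)]) (auto intro!: continuous_intros)
    then show "open {u. (x, u) \<in> S}" by (simp add: vimage_def)
    have "smooth_map_on {u. (x, u) \<in> S} (\<lambda>u. (\<lambda>(x, u). h x u) (x, u))"
      by (rule smooth_compose[OF _ S(1) _ _ h(1)])
         (use o in \<open>auto simp: vimage_def intro!: smooth_Pair smooth_const smooth_ident\<close>)
    then show "riemannian_metric {u. (x, u) \<in> S} (h x)" using h(2) by (simp add: riemannian_metric_iff)
  qed
  have sh: "smooth_map_on S (\<lambda>\<theta>. h (fst \<theta>) (snd \<theta>) $ i $ j)" for i j
    using smooth_entries[OF S(1) h(1)] by (simp add: case_prod_unfold)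
  have sC: "smooth_map_on S (\<lambda>\<theta>. C (fst \<theta>))"
    by (rule smooth_compose[OF S(1) X0(1) _ smooth_fst C(1)]) (use X0(2) in auto)
  have sG: "smooth_map_on S (\<lambda>\<theta>. christoffel (h (fst \<theta>)) (snd \<theta>) d a b)" for d a b
    using smooth_christoffel_param[OF S(1) h] by (simp add: case_prod_unfold)
  have sMe: "smooth_map_on S (\<lambda>\<theta>. M i \<theta> $ r $ c)" for i r c
    unfolding M_def
    by (cases r; cases c) (auto intro!: smooth_const smooth_mult smooth_minus S(1) sC sh sG)
  have sM: "smooth_map_on S (M i)" for i
    by (intro smooth_vec[OF S(1)] sMe)
  have sGe: "smooth_map_on S (\<lambda>\<theta>. G \<theta> $ r $ c)" for r c
    unfolding G_def by (cases r; cases c) (auto intro!: smooth_const smooth_mult S(1) sC sh)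
  have sG': "smooth_map_on S G" by (intro smooth_vec[OF S(1)] sGe)
  have entry: "FD F \<theta> (0, axis j 1) $ r $ c = partial j (\<lambda>w. F (fst \<theta>, w) $ r $ c) (snd \<theta>)"
    if "smooth_map_on S F" "\<theta> \<in> S" for F :: "_ \<Rightarrow> real^('m option)^('m option)" and \<theta> j r c
  proof -
    have hd: "((\<lambda>\<theta>. F \<theta> $ r $ c) has_derivative (\<lambda>v. FD F \<theta> v $ r $ c)) (at \<theta>)"
      by (intro bounded_linear.has_derivative[OF bounded_linear_vec_nth] smooth_has_derivative[OF that])
    show ?thesis
      using partial_slice[of "\<lambda>\<theta>. F \<theta> $ r $ c" _ "fst \<theta>" "snd \<theta>" j, unfolded prod.collapse, OF hd] FD_eqI[OF hd] by simp
  qed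
  \<comment> \<open>The integrability condition splits by rows and columns. The row None amounts to
    the symmetry of h and of the Christoffel symbols; row Some, column None is a Codazzi equation
    that follows from metric compatibility; row and column Some is a Gauss equation, and this is
    where the curvature hypothesis R is used.\<close>
  have flatM: "FD (M i) \<theta> (0, axis j 1) + M i \<theta> ** M j \<theta> = FD (M j) \<theta> (0, axis i 1) + M j \<theta> ** M i \<theta>" if \<theta>: "\<theta> \<in> S" for i j \<theta>
  proof -
    obtain x u where xu: "\<theta> = (x, u)" by (cases \<theta>)
    interpret cm: coordinate_metric "{u. (x, u) \<in> S}" "h x" by (rule slice)
    have u: "u \<in> {u. (x, u) \<in> S}" using \<theta> xu by simp
    have pm: "partial k (\<lambda>w. - (C x * h x w $ i $ b)) u = - (C x * partial k (\<lambda>w. h x w $ i $ b) u)" for k i b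
      unfolding partial_eq
      by (subst FD_eqI[OF has_derivative_minus[OF has_derivative_mult_right[OF smooth_has_derivative[OF cm.smooth_h u]]]]) simp
    have "(FD (M i) \<theta> (0, axis j 1) + M i \<theta> ** M j \<theta>) $ r $ c = (FD (M j) \<theta> (0, axis i 1) + M j \<theta> ** M i \<theta>) $ r $ c" for r c
    proof (cases r)
      case None
      then show ?thesis
        unfolding vector_add_component entry[OF sM \<theta>] matrix_matrix_mult_def
        by (cases c) (simp_all add: M_def xu sum_option_UNIV partial_const cm.\<Gamma>_sym[OF u, of _ i j] cm.h_sym[OF u, of i j]
            if_distrib[of "\<lambda>x. x * _"] cong: if_cong)
    next
      case (Some b)
      show ?thesis
      proof (cases c)
        case None
        have "partial j (\<lambda>w. h x w $ i $ b) u + (\<Sum>e\<in>UNIV. christoffel (h x) u e i b * h x u $ j $ e)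
          = partial i (\<lambda>w. h x w $ j $ b) u + (\<Sum>e\<in>UNIV. christoffel (h x) u e j b * h x u $ i $ e)"
          unfolding cm.metric_compatible[OF u] using cm.\<Gamma>_sym[OF u, of _ i j] by (simp add: mult.commute)
        then have "C x * partial j (\<lambda>w. h x w $ i $ b) u + (\<Sum>e\<in>UNIV. christoffel (h x) u e i b * (C x * h x u $ j $ e))
          = C x * partial i (\<lambda>w. h x w $ j $ b) u + (\<Sum>e\<in>UNIV. christoffel (h x) u e j b * (C x * h x u $ i $ e))"
          by (auto dest: arg_cong[where f = "\<lambda>y. C x * y"] simp: distrib_left sum_distrib_left ac_simps)
        then show ?thesis
          unfolding vector_add_component entry[OF sM \<theta>] matrix_matrix_mult_def
          by (simp add: M_def xu sum_option_UNIV Some None pm sum_negf)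
      next
        case (Some c')
        have "partial j (\<lambda>w. christoffel (h x) w c' i b) u - partial i (\<lambda>w. christoffel (h x) w c' j b) u +
          (\<Sum>e\<in>UNIV. christoffel (h x) u c' j e * christoffel (h x) u e i b - christoffel (h x) u c' i e * christoffel (h x) u e j b)
          = C x * (h x u $ i $ b * (if c' = j then 1 else 0) - h x u $ j $ b * (if c' = i then 1 else 0))"
          using R[of x u c' b j i] \<theta> xu by (simp add: riemann_def)
        then show ?thesis
          unfolding vector_add_component entry[OF sM \<theta>] matrix_matrix_mult_def
          by (simp add: M_def xu sum_option_UNIV Some \<open>r = Some b\<close> sum_subtractf algebra_simps)
      qed
    qed
    then show ?thesis by (simp add: vec_eq_iff)
  qed
  \<comment> \<open>In the block of Some indices this is metric compatibility scaled by C; in the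
    mixed entries the contribution \<open>C h\<close> of the first row cancels against
    \<open>- C h\<close> from the first column of the system.\<close>
  have dG: "FD G \<theta> (0, axis i 1) = M i \<theta> ** G \<theta> + G \<theta> ** transpose (M i \<theta>)" if \<theta>: "\<theta> \<in> S" for i \<theta>
  proof -
    obtain x u where xu: "\<theta> = (x, u)" by (cases \<theta>)
    interpret cm: coordinate_metric "{u. (x, u) \<in> S}" "h x" by (rule slice)
    have u: "u \<in> {u. (x, u) \<in> S}" using \<theta> xu by simp
    have pm: "partial k (\<lambda>w. C x * h x w $ i $ b) u = C x * partial k (\<lambda>w. h x w $ i $ b) u" for k i b
      unfolding partial_eq
      by (subst FD_eqI[OF has_derivative_mult_right[OF smooth_has_derivative[OF cm.smooth_h u]]]) simp
    have "FD G \<theta> (0, axis i 1) $ r $ c = (M i \<theta> ** G \<theta> + G \<theta> ** transpose (M i \<theta>)) $ r $ c" for r c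
      unfolding vector_add_component entry[OF sG' \<theta>] matrix_matrix_mult_def transpose_def
      by (cases r; cases c)
         (simp_all add: M_def G_def xu sum_option_UNIV partial_const pm cm.metric_compatible[OF u] cm.h_sym[OF u, of _ i]
           sum_distrib_left distrib_left ac_simps if_distrib[of "\<lambda>x. _ * x"] cong: if_cong,
          simp_all add: cm.h_sym[OF u] mult_if_delta if_distrib[of "\<lambda>x. _ * x"] ac_simps cong: if_cong)
    then show ?thesis by (simp add: vec_eq_iff)
  qed
  obtain \<beta> :: "'n \<Rightarrow> 'm option" where \<beta>: "bij \<beta>" by (rule card_option_eq[OF dim])
  define X1 where "X1 = {x. (x, 0) \<in> S}"
  have oX1: "open X1"
    unfolding X1_def by (rule open_Pair0_vimage[OF S(1)])
  have sG1: "smooth_map_on X1 (\<lambda>x. G (x, 0))"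
    by (rule smooth_compose[OF oX1 S(1) _ _ sG']) (use oX1 in \<open>auto simp: X1_def intro!: smooth_Pair smooth_const smooth_ident\<close>)
  have pG: "pos_def (G \<theta>)" if "\<theta> \<in> S" for \<theta>
    unfolding G_def by (rule pos_def_sphere_gram) (use C(2) X0(2) h(2) that in \<open>auto simp: mem_Times_iff\<close>)
  obtain E :: "'p \<Rightarrow> real^'n^('m option)" where E: "smooth_map_on X1 E" "\<And>x. x \<in> X1 \<Longrightarrow> E x ** transpose (E x) = G (x, 0)"
    by (rule smooth_factorization[OF oX1 sG1 _ \<beta>]) (use pG in \<open>simp add: X1_def\<close>, rule that, assumption)
  \<comment> \<open>\<open>total_linear_system\<close> labels coefficients by basis vectors,
    \<open>sphere_system\<close> by indices; A translates.\<close>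
  define A where "A v \<theta> = (\<Sum>i\<in>UNIV. v $ i *\<^sub>R M i \<theta>)" for v \<theta>
  have Aax: "A (axis i 1) = M i" for i
    by (rule ext) (simp add: A_def axis_def if_distrib[of "\<lambda>x. x *\<^sub>R _"] cong: if_cong)
  have bas: "\<exists>i. b = axis i 1" if "b \<in> Basis" for b :: "real^'m" using that by (auto simp: Basis_vec_def)
  have sA: "smooth_map_on S (A b)" if "b \<in> Basis" for b using bas[OF that] sM by (auto simp: Aax)
  have flat: "FD (A a) \<theta> (0, b) ** v + A a \<theta> ** (A b \<theta> ** v) = FD (A b) \<theta> (0, a) ** v + A b \<theta> ** (A a \<theta> ** v)"
    if t: "\<theta> \<in> S" "a \<in> Basis" "b \<in> Basis" for \<theta> a b and v :: "real^'n^('m option)"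
  proof -
    obtain i j where ij: "a = axis i 1" "b = axis j 1" using bas t(2,3) by metis
    show ?thesis
      unfolding ij Aax using arg_cong[OF flatM[OF t(1), of i j], of "\<lambda>W. W ** v"]
      by (simp add: add_left matrix_mul_assoc)
  qed
  have x0: "x0 \<in> X1" using S(2) by (simp add: X1_def)
  show ?thesis
  proof (rule total_linear_system[where A = A and e = E, OF S oX1 x0 sA E(1) flat])
    fix r U assume r: "r > 0" "tube (ball x0 r) r \<subseteq> S" "ball x0 r \<subseteq> X1" and Us: "smooth_map_on (tube (ball x0 r) r) U"
      and U0: "\<And>x. x \<in> ball x0 r \<Longrightarrow> U (x, 0) = E x"
      and U: "\<And>\<theta> b. \<theta> \<in> tube (ball x0 r) r \<Longrightarrow> b \<in> Basis \<Longrightarrow> FD U \<theta> (0, b) = A b \<theta> ** U \<theta>"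
    let ?T = "tube (ball x0 r) r :: ('p \<times> (real^'m)) set"
    have UM: "FD U \<theta> (0, axis i 1) = M i \<theta> ** U \<theta>" if "\<theta> \<in> ?T" for \<theta> i
      using U[OF that, of "axis i 1"] by (simp add: Aax axis_in_Basis_iff)
    have bbT: "bounded_bilinear (\<lambda>(V :: real^'n^('m option)) W. V ** transpose W)"
      by (rule bounded_bilinear.comp[OF bounded_bilinear_matrix_mult bounded_linear_ident bounded_linear_transpose])
    \<comment> \<open>E was chosen to give the required Gram matrix at \<open>u = 0\<close>, and
      both sides obey the same equation in u; uniqueness extends the equality. Entries of G then
      read off unit length, orthogonality and the pullback metric.\<close>
    have gram: "U \<theta> ** transpose (U \<theta>) = G \<theta>" if \<theta>: "\<theta> \<in> ?T" for \<theta>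
    proof -
      have "U \<theta> ** transpose (U \<theta>) - G \<theta> = 0"
      proof -
        have cA: "continuous_on ?T (A b)" if "b \<in> Basis" for b
          by (rule continuous_on_subset[OF smooth_continuous[OF sA[OF that]] r(2)])
        show ?thesis
        proof (rule ly.total_system_zero[where V = "\<lambda>\<theta>. U \<theta> ** transpose (U \<theta>) - G \<theta>" and A = A, OF _ _ _ _ \<theta>])
          fix \<theta> assume \<theta>: "\<theta> \<in> ?T"
          then have \<theta>S: "\<theta> \<in> S" using r(2) by blast
          show "((\<lambda>\<theta>. U \<theta> ** transpose (U \<theta>) - G \<theta>) has_derivative
            (\<lambda>v. (U \<theta> ** transpose (FD U \<theta> v) + FD U \<theta> v ** transpose (U \<theta>)) - FD G \<theta> v)) (at \<theta>)"
            by (intro has_derivative_diff bounded_bilinear.FDERIV[OF bbT] smooth_has_derivative[OF Us \<theta>] smooth_has_derivative[OF sG' \<theta>S])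
          fix b :: "real^'m" assume "b \<in> Basis"
          then obtain i where i: "b = axis i 1" using bas by blast
          show "(U \<theta> ** transpose (FD U \<theta> (0, b)) + FD U \<theta> (0, b) ** transpose (U \<theta>)) - FD G \<theta> (0, b) =
            A b \<theta> ** (U \<theta> ** transpose (U \<theta>) - G \<theta>) + (U \<theta> ** transpose (U \<theta>) - G \<theta>) ** transpose (A b \<theta>)"
            unfolding ly.diff_right
            by (simp add: i UM[OF \<theta>] Aax dG[OF \<theta>S] matrix_transpose_mul matrix_mul_assoc add.commute)
        qed (use r(2,3) U0 E(2) cA in \<open>auto simp: subset_iff\<close>)
      qed
      then show ?thesis by simp
    qed
    have rows: "U \<theta> $ i \<bullet> U \<theta> $ j = G \<theta> $ i $ j" if "\<theta> \<in> ?T" for \<theta> i j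
      using gram[OF that] by (simp add: vec_eq_iff matrix_matrix_mult_def transpose_def inner_vec_def)
    have oT: "open ?T" by (rule open_tube) simp
    have dZ: "FD (\<lambda>\<theta>. U \<theta> $ None) \<theta> (0, axis b 1) = U \<theta> $ Some b" if "\<theta> \<in> ?T" for \<theta> b
    proof -
      have "FD (\<lambda>\<theta>. U \<theta> $ None) \<theta> = (\<lambda>v. FD U \<theta> v $ None)"
        by (intro FD_eqI bounded_linear.has_derivative[OF bounded_linear_vec_nth] smooth_has_derivative[OF Us that])
      then show ?thesis
        by (simp add: UM[OF that] vec_eq_iff matrix_matrix_mult_def sum_option_UNIV M_def if_distrib[of "\<lambda>x. x * _"] cong: if_cong)
    qed
    show ?thesis
      by (rule that[of r "\<lambda>\<theta>. U \<theta> $ None"])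
         (use r smooth_nth[OF oT Us] rows dZ in \<open>auto simp: G_def\<close>)
  qed (use sA flat in auto)
qed

section \<open>Finsler metric functions and their indicatrices\<close>

lemma open_punctured: "open (UNIV - {0 :: 'a::real_normed_vector})"
  by (simp add: open_delete)

lemma linear_axis:
  fixes f :: "real^'n \<Rightarrow> 'b::real_vector"
  assumes "linear f"
  shows "f v = (\<Sum>i\<in>UNIV. v $ i *\<^sub>R f (axis i 1))"
proof -
  have "f (\<Sum>i\<in>UNIV. v $ i *\<^sub>R axis i 1) = (\<Sum>i\<in>UNIV. v $ i *\<^sub>R f (axis i 1))"
    using assms by (simp add: linear_sum linear_scale)
  moreover have "(\<Sum>i\<in>UNIV. v $ i *\<^sub>R axis i 1) = v"
    using basis_expansion[of v] by (simp add: scalar_mult_eq_scaleR)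
  ultimately show ?thesis by simp
qed

lemma FD_homogeneous:
  fixes f :: "'a::euclidean_space \<Rightarrow> 'b::euclidean_space"
  assumes k: "k > 0" and y: "y \<noteq> 0" and f: "smooth_map_on (UNIV - {0}) f"
    and hom: "\<And>z. z \<noteq> 0 \<Longrightarrow> f (k *\<^sub>R z) = c *\<^sub>R f z"
  shows "FD f (k *\<^sub>R y) v = (c / k) *\<^sub>R FD f y v"
proof -
  have h1: "(f has_derivative FD f (k *\<^sub>R y)) (at (k *\<^sub>R y))" using smooth_has_derivative[OF f] k y by simp
  have h2: "(f has_derivative FD f y) (at y)" using smooth_has_derivative[OF f] y by simp
  have "((\<lambda>z. k *\<^sub>R z) has_derivative (\<lambda>v. k *\<^sub>R v)) (at y)" by (auto intro!: derivative_eq_intros)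
  from has_derivative_compose[OF this h1] have "FD (\<lambda>z. f (k *\<^sub>R z)) y = (\<lambda>v. FD f (k *\<^sub>R y) (k *\<^sub>R v))" by (rule FD_eqI)
  moreover have "FD (\<lambda>z. f (k *\<^sub>R z)) y = FD (\<lambda>z. c *\<^sub>R f z) y"
    by (rule FD_cong[of "UNIV - {0}"]) (use y hom in auto)
  moreover have "FD (\<lambda>z. c *\<^sub>R f z) y = (\<lambda>v. c *\<^sub>R FD f y v)"
    by (intro FD_eqI has_derivative_scaleR_right h2)
  ultimately have "FD f (k *\<^sub>R y) (k *\<^sub>R v) = c *\<^sub>R FD f y v" by metis
  then have "k *\<^sub>R FD f (k *\<^sub>R y) v = c *\<^sub>R FD f y v"
    using linear_scale[OF has_derivative_linear[OF h1]] by simp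
  then have "(1 / k) *\<^sub>R k *\<^sub>R FD f (k *\<^sub>R y) v = (1 / k) *\<^sub>R c *\<^sub>R FD f y v" by simp
  then show ?thesis using k by simp
qed

text \<open>Compare the derivatives of \<open>f (k *\<^sub>R y)\<close> and
  \<open>\<phi> k *\<^sub>R f y\<close> at \<open>k = 1\<close>. The factor \<open>\<phi>\<close> is
  general so as to cover degree 1 for F and degree \<open>H x\<close> for t.\<close>

lemma FD_euler:
  fixes f :: "'a::real_normed_vector \<Rightarrow> 'b::real_normed_vector"
  assumes f: "f differentiable (at y)" and hom: "\<And>k. k > 0 \<Longrightarrow> f (k *\<^sub>R y) = \<phi> k *\<^sub>R f y"
    and \<phi>: "(\<phi> has_real_derivative \<phi>') (at 1)"
  shows "FD f y y = \<phi>' *\<^sub>R f y"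
proof -
  have h1: "(f has_derivative FD f y) (at (1 *\<^sub>R y))" using FD_has_derivative[OF f] by simp
  have "((\<lambda>k::real. k *\<^sub>R y) has_derivative (\<lambda>k. k *\<^sub>R y)) (at 1)" by (auto intro!: derivative_eq_intros)
  from has_derivative_compose[OF this h1] have "FD (\<lambda>k::real. f (k *\<^sub>R y)) 1 = (\<lambda>k. FD f y (k *\<^sub>R y))" by (rule FD_eqI)
  moreover have "FD (\<lambda>k::real. f (k *\<^sub>R y)) 1 = FD (\<lambda>k. \<phi> k *\<^sub>R f y) 1"
    by (rule FD_cong[of "{0<..}"]) (use hom in auto)
  moreover have "FD (\<lambda>k. \<phi> k *\<^sub>R f y) 1 = (\<lambda>k. (\<phi>' * k) *\<^sub>R f y)"
    by (intro FD_eqI has_derivative_scaleR_left) (use \<phi> in \<open>simp add: has_field_derivative_def\<close>)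
  ultimately have "(\<lambda>k. FD f y (k *\<^sub>R y)) = (\<lambda>k. (\<phi>' * k) *\<^sub>R f y)" by simp
  from fun_cong[OF this, of 1] show ?thesis by simp
qed

lemma second_derivative_form:
  fixes f :: "real^'n \<Rightarrow> real"
  assumes "open S" "smooth_map_on S f" "y \<in> S"
  shows "(\<Sum>i\<in>UNIV. \<Sum>j\<in>UNIV. partial i (partial j f) y * v $ i * w $ j) = FD (\<lambda>z. FD f z w) y v"
proof -
  have "FD (\<lambda>z. FD f z w) y = FD (\<lambda>z. \<Sum>j\<in>UNIV. w $ j *\<^sub>R partial j f z) y"
    unfolding partial_eq
    by (rule FD_cong[OF assms(1,3)], rule linear_axis[OF has_derivative_linear[OF smooth_has_derivative[OF assms(2)]]])
  also have "\<dots> = (\<lambda>v. \<Sum>j\<in>UNIV. w $ j *\<^sub>R FD (partial j f) y v)"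
    by (intro FD_eqI has_derivative_sum has_derivative_scaleR_right smooth_has_derivative[OF smooth_partial[OF assms(2)] assms(3)])
  also have "\<dots> = (\<lambda>v. \<Sum>j\<in>UNIV. w $ j *\<^sub>R (\<Sum>i\<in>UNIV. v $ i *\<^sub>R partial i (partial j f) y))"
    by (subst linear_axis[OF has_derivative_linear[OF smooth_has_derivative[OF smooth_partial[OF assms(2)] assms(3)]]])
       (simp add: partial_eq[of _ "partial _ f"])
  finally have "FD (\<lambda>z. FD f z w) y v = (\<Sum>j\<in>UNIV. w $ j *\<^sub>R (\<Sum>i\<in>UNIV. v $ i *\<^sub>R partial i (partial j f) y))" by simp
  also have "\<dots> = (\<Sum>j\<in>UNIV. \<Sum>i\<in>UNIV. partial i (partial j f) y * v $ i * w $ j)"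
    by (simp add: sum_distrib_left ac_simps)
  also have "\<dots> = (\<Sum>i\<in>UNIV. \<Sum>j\<in>UNIV. partial i (partial j f) y * v $ i * w $ j)" by (rule sum.swap)
  finally show ?thesis by simp
qed

section \<open>Homogeneity of the Finsler metric and the induced metric\<close>

locale finsler =
  fixes D :: "(real^'n) set" and F :: "real^'n \<Rightarrow> real^'n::finite \<Rightarrow> real"
  assumes open_D: "open D" and finsler: "finsler_function D F"
begin

abbreviation "slit \<equiv> D \<times> (UNIV - {0 :: real^'n})"

lemma open_slit: "open slit" using open_D by (intro open_Times) auto

lemma smooth_F: "smooth_map_on slit (\<lambda>\<theta>. F (fst \<theta>) (snd \<theta>))"
  using finsler by (simp add: finsler_function_def case_prod_unfold)

lemma F_pos: "x \<in> D \<Longrightarrow> y \<noteq> 0 \<Longrightarrow> F x y > 0"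
  and F_hom: "x \<in> D \<Longrightarrow> y \<noteq> 0 \<Longrightarrow> k > 0 \<Longrightarrow> F x (k *\<^sub>R y) = k * F x y"
  using finsler by (auto simp: finsler_function_def)

lemma smooth_Fx: "x \<in> D \<Longrightarrow> smooth_map_on (UNIV - {0}) (F x)"
proof -
  assume x: "x \<in> D"
  have "smooth_map_on (UNIV - {0}) (\<lambda>y. (\<lambda>\<theta>. F (fst \<theta>) (snd \<theta>)) (x, y))"
    by (rule smooth_compose[OF _ open_slit _ _ smooth_F]) (use x in \<open>auto intro!: smooth_Pair smooth_const smooth_ident\<close>)
  then show ?thesis by simp
qed

lemma smooth_energy: "smooth_map_on slit (\<lambda>\<theta>. (F (fst \<theta>) (snd \<theta>))\<^sup>2)"
  by (intro smooth_power open_slit smooth_F)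

lemma smooth_energy_x: "x \<in> D \<Longrightarrow> smooth_map_on (UNIV - {0}) (\<lambda>y. (F x y)\<^sup>2)"
  by (intro smooth_power smooth_Fx) auto

lemma metric_form:
  assumes "x \<in> D" "y \<noteq> 0"
  shows "v \<bullet> (finsler_metric F x y *v w) = 1/2 * FD (\<lambda>z. FD (\<lambda>z. (F x z)\<^sup>2) z w) y v"
proof -
  have "y \<in> UNIV - {0}" using assms(2) by simp
  from second_derivative_form[OF open_punctured smooth_energy_x[OF assms(1)] this, of v w, symmetric]
  show ?thesis unfolding inner_mv by (simp add: finsler_metric_def sum_distrib_left mult.assoc sum_divide_distrib)
qed

lemma metric_pos_def:
  assumes "x \<in> D" "y \<noteq> 0"
  shows "pos_def (finsler_metric F x y)"
proof -
  have "finsler_metric F x y $ i $ j = finsler_metric F x y $ j $ i" for i j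
    using partial_commute[OF open_punctured smooth_energy_x[OF assms(1)], of y i j] assms(2) by (simp add: finsler_metric_def)
  then show ?thesis using finsler assms by (simp add: pos_def_def finsler_function_def vec_eq_iff transpose_def)
qed

lemma smooth_metric: "smooth_map_on slit (\<lambda>\<theta>. finsler_metric F (fst \<theta>) (snd \<theta>) $ i $ j)"
proof -
  have 1: "smooth_map_on slit (\<lambda>\<theta>. partial j (\<lambda>z. (F (fst \<theta>) z)\<^sup>2) (snd \<theta>))" for j
  proof (rule smooth_cong[OF open_slit _ smooth_FD[OF smooth_energy, of "(0, axis j 1)"]])
    fix \<theta> assume "\<theta> \<in> slit"
    then show "FD (\<lambda>\<theta>. (F (fst \<theta>) (snd \<theta>))\<^sup>2) \<theta> (0, axis j 1) = partial j (\<lambda>z. (F (fst \<theta>) z)\<^sup>2) (snd \<theta>)"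
      using partial_slice[of "\<lambda>\<theta>. (F (fst \<theta>) (snd \<theta>))\<^sup>2" _ "fst \<theta>" "snd \<theta>" j, unfolded prod.collapse,
          OF smooth_has_derivative[OF smooth_energy]] by simp
  qed
  have 2: "smooth_map_on slit (\<lambda>\<theta>. partial i (partial j (\<lambda>z. (F (fst \<theta>) z)\<^sup>2)) (snd \<theta>))"
  proof (rule smooth_cong[OF open_slit _ smooth_FD[OF 1[of j], of "(0, axis i 1)"]])
    fix \<theta> assume "\<theta> \<in> slit"
    then show "FD (\<lambda>\<theta>. partial j (\<lambda>z. (F (fst \<theta>) z)\<^sup>2) (snd \<theta>)) \<theta> (0, axis i 1) = partial i (partial j (\<lambda>z. (F (fst \<theta>) z)\<^sup>2)) (snd \<theta>)"
      using partial_slice[of "\<lambda>\<theta>. partial j (\<lambda>z. (F (fst \<theta>) z)\<^sup>2) (snd \<theta>)" _ "fst \<theta>" "snd \<theta>" i, unfolded prod.collapse,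
          OF smooth_has_derivative[OF 1]] by simp
  qed
  show ?thesis
    unfolding finsler_metric_def vec_lambda_beta by (intro smooth_mult smooth_const open_slit 2)
qed

lemma FD_energy:
  assumes "x \<in> D" "y \<noteq> 0"
  shows "FD (\<lambda>z. (F x z)\<^sup>2) y v = 2 * F x y * FD (F x) y v"
proof -
  have "((\<lambda>z. (F x z)\<^sup>2) has_derivative (\<lambda>v. 2 * F x y * FD (F x) y v)) (at y)"
    using smooth_has_derivative[OF smooth_Fx[OF assms(1)], of y] assms(2) by (auto intro!: derivative_eq_intros)
  from FD_eqI[OF this] show ?thesis by simp
qed

text \<open>Euler's relation for the first derivatives of \<open>F^2\<close>, which are homogeneous
  of degree 1. It makes y orthogonal to directions in which F is stationary, that is, to the
  indicatrix.\<close>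

lemma metric_radial:
  assumes "x \<in> D" "y \<noteq> 0"
  shows "y \<bullet> (finsler_metric F x y *v w) = F x y * FD (F x) y w"
proof -
  have "FD (\<lambda>z. FD (\<lambda>z. (F x z)\<^sup>2) z w) y y = 1 *\<^sub>R FD (\<lambda>z. (F x z)\<^sup>2) y w"
  proof (rule FD_euler)
    show "(\<lambda>z. FD (\<lambda>z. (F x z)\<^sup>2) z w) differentiable at y"
      using smooth_differentiable[OF smooth_FD[OF smooth_energy_x[OF assms(1)]]] assms(2) by simp
    show "FD (\<lambda>z. (F x z)\<^sup>2) (k *\<^sub>R y) w = k *\<^sub>R FD (\<lambda>z. (F x z)\<^sup>2) y w" if "k > 0" for k
      using FD_homogeneous[OF that assms(2) smooth_energy_x[OF assms(1)], of "k\<^sup>2" w] that F_hom[OF assms(1)]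
      by (simp add: power_mult_distrib power2_eq_square)
  qed (auto intro!: derivative_eq_intros)
  then show ?thesis by (simp add: metric_form[OF assms] FD_energy[OF assms])
qed

lemma F_euler: "x \<in> D \<Longrightarrow> y \<noteq> 0 \<Longrightarrow> FD (F x) y y = F x y"
  using FD_euler[OF smooth_differentiable[OF smooth_Fx], of x y "\<lambda>k. k" 1] F_hom by (auto intro!: derivative_eq_intros)

text \<open>Each differentiation lowers the degree of homogeneity by one, from 2 for
  \<open>F^2\<close> to 0 for the metric.\<close>

lemma metric_scale:
  assumes "x \<in> D" "y \<noteq> 0" "k > 0"
  shows "v \<bullet> (finsler_metric F x (k *\<^sub>R y) *v w) = v \<bullet> (finsler_metric F x y *v w)"
proof -
  have 1: "FD (\<lambda>z. (F x z)\<^sup>2) (k *\<^sub>R z) w = k *\<^sub>R FD (\<lambda>z. (F x z)\<^sup>2) z w" if "z \<noteq> 0" for z w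
    using FD_homogeneous[OF assms(3) that smooth_energy_x[OF assms(1)], of "k\<^sup>2" w] assms(3) F_hom[OF assms(1) _ assms(3)]
    by (simp add: power_mult_distrib power2_eq_square)
  have "k *\<^sub>R y \<noteq> 0" using assms by simp
  then show ?thesis
    using FD_homogeneous[OF assms(3,2) smooth_FD[OF smooth_energy_x[OF assms(1)]] 1, of w v] assms
    by (simp add: metric_form)
qed

lemma induced_metric_eq:
  fixes Y :: "real^'m \<Rightarrow> real^'n"
  assumes "Y differentiable (at u)"
  shows "induced_metric F x Y u $ b $ c = FD Y u (axis b 1) \<bullet> (finsler_metric F x (Y u) *v FD Y u (axis c 1))"
proof -
  have "partial b (\<lambda>w. Y w $ i) u = FD Y u (axis b 1) $ i" for b i
    by (rule partial_eqI[OF bounded_linear.has_derivative[OF bounded_linear_vec_nth FD_has_derivative[OF assms]]])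
  then show ?thesis by (simp add: induced_metric_def inner_mv)
qed

lemma induced_metric_form:
  fixes Y :: "real^'m \<Rightarrow> real^'n"
  assumes "Y differentiable (at u)"
  shows "v \<bullet> (induced_metric F x Y u *v w) = FD Y u v \<bullet> (finsler_metric F x (Y u) *v FD Y u w)"
proof -
  interpret ip: bounded_bilinear "\<lambda>v w. v \<bullet> (finsler_metric F x (Y u) *v w)" by (rule bounded_bilinear_form)
  have l: "FD Y u v = (\<Sum>i\<in>UNIV. v $ i *\<^sub>R FD Y u (axis i 1))" for v
    by (rule linear_axis[OF linear_frechet_derivative[OF assms]])
  show ?thesis
    unfolding l[of v] l[of w] inner_mv[of v] induced_metric_eq[OF assms] ip.sum_left ip.sum_right ip.scaleR_left ip.scaleR_right
    by (simp add: sum_distrib_left ac_simps) (rule sum.swap)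
qed

lemma parametrization_metric:
  assumes "x \<in> D" "indicatrix_parametrization F x \<Omega> Y"
  shows "coordinate_metric \<Omega> (induced_metric F x Y)"
proof
  show o: "open \<Omega>" using assms(2) by (simp add: indicatrix_parametrization_def)
  have Y: "smooth_map_on \<Omega> Y" "\<And>u. u \<in> \<Omega> \<Longrightarrow> inj (FD Y u)" "\<And>u. u \<in> \<Omega> \<Longrightarrow> Y u \<noteq> 0"
    using assms(2) by (auto simp: indicatrix_parametrization_def indicatrix_def)
  have "smooth_map_on \<Omega> (\<lambda>u. induced_metric F x Y u $ b $ c)" for b c
  proof -
    have sg: "smooth_map_on \<Omega> (\<lambda>u. finsler_metric F x (Y u) $ i $ j)" for i j
    proof -
      have "smooth_map_on \<Omega> (\<lambda>u. (\<lambda>\<theta>. finsler_metric F (fst \<theta>) (snd \<theta>) $ i $ j) (x, Y u))"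
        by (rule smooth_compose[OF o open_slit _ _ smooth_metric]) (use assms(1) Y in \<open>auto intro!: smooth_Pair smooth_const o\<close>)
      then show ?thesis by simp
    qed
    have "smooth_map_on \<Omega> (\<lambda>u. partial b (\<lambda>w. Y w $ i) u)" for b i
      by (rule smooth_partial[OF smooth_nth[OF o Y(1)]])
    then show ?thesis
      unfolding induced_metric_def vec_lambda_beta by (intro smooth_sum smooth_mult o sg)
  qed
  moreover have "pos_def (induced_metric F x Y u)" if u: "u \<in> \<Omega>" for u
  proof -
    have d: "Y differentiable (at u)" using smooth_differentiable[OF Y(1) u] .
    have p: "pos_def (finsler_metric F x (Y u))" using metric_pos_def[OF assms(1) Y(3)[OF u]] .
    have "induced_metric F x Y u $ b $ c = induced_metric F x Y u $ c $ b" for b c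
      unfolding induced_metric_eq[OF d] by (rule inner_mv_commute) (use p in \<open>simp add: pos_def_def\<close>)
    moreover have "v \<bullet> (induced_metric F x Y u *v v) > 0" if "v \<noteq> 0" for v
    proof -
      have "FD Y u v \<noteq> 0" using Y(2)[OF u] that linear_injective_0[OF linear_frechet_derivative[OF d]] by blast
      then show ?thesis using p by (simp add: induced_metric_form[OF d] pos_def_def)
    qed
    ultimately show ?thesis by (simp add: pos_def_def vec_eq_iff transpose_def)
  qed
  ultimately show "riemannian_metric \<Omega> (induced_metric F x Y)"
    unfolding riemannian_metric_iff by (auto intro!: smooth_vec o)
qed

end

lemma sectional_curvature_cong:
  assumes "open S" "u \<in> S" "\<And>w. w \<in> S \<Longrightarrow> h w = h' w"
  shows "sectional_curvature h u v w = sectional_curvature h' u v w"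
proof -
  have c: "christoffel h z d a b = christoffel h' z d a b" if "z \<in> S" for z d a b
  proof -
    have "partial k (\<lambda>w. h w $ i $ j) z = partial k (\<lambda>w. h' w $ i $ j) z" for k i j
      by (rule partial_cong[OF assms(1) that]) (simp add: assms(3))
    then show ?thesis by (simp add: christoffel_def assms(3)[OF that])
  qed
  have "riemann h u d e a b = riemann h' u d e a b" for d e a b
    unfolding riemann_def c[OF assms(2)]
    by (intro arg_cong2[where f = "(+)"] arg_cong2[where f = "(-)"] refl partial_cong[OF assms(1,2)] c)
  then show ?thesis by (simp add: sectional_curvature_def assms(3)[OF assms(2)])
qed

text \<open>A linear map that matches the Finsler functions matches the second derivatives of their
  squares, so Y and its image under J have equal induced metrics. With J the Jacobian of a
  coordinate change this makes the curvature independent of the chart.\<close>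

lemma indicatrix_constant_curvature_linear_image:
  fixes J :: "real^'n \<Rightarrow> real^'n"
  assumes f1: "finsler D1 F1" "x1 \<in> D1" and f2: "finsler D2 F2" "x2 \<in> D2"
    and J: "linear J" "inj J" "\<And>y. y \<noteq> 0 \<Longrightarrow> F1 x1 (J y) = F2 x2 y"
    and c: "indicatrix_constant_curvature TYPE('m::finite) F1 x1 C"
  shows "indicatrix_constant_curvature TYPE('m) F2 x2 C"
  unfolding indicatrix_constant_curvature_def
proof (intro allI impI ballI)
  interpret f1: finsler D1 F1 by (rule f1)
  interpret f2: finsler D2 F2 by (rule f2)
  fix \<Omega> :: "(real^'m) set" and Y u and v w :: "real^'m"
  assume Y: "indicatrix_parametrization F2 x2 \<Omega> Y" and u: "u \<in> \<Omega>" and vw: "v \<noteq> w \<and> independent {v, w}"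
  have o: "open \<Omega>" and sY: "smooth_map_on \<Omega> Y" and iY: "inj_on Y \<Omega>" "\<And>u. u \<in> \<Omega> \<Longrightarrow> inj (FD Y u)"
    and Y1: "\<And>u. u \<in> \<Omega> \<Longrightarrow> Y u \<noteq> 0 \<and> F2 x2 (Y u) = 1"
    using Y by (auto simp: indicatrix_parametrization_def indicatrix_def)
  have blJ: "bounded_linear J" using J(1) by (simp add: linear_conv_bounded_linear)
  have J0: "J y \<noteq> 0" if "y \<noteq> 0" for y using that J(1,2) linear_injective_0 by blast
  have dJY: "FD (\<lambda>u. J (Y u)) u = (\<lambda>v. J (FD Y u v))" "(\<lambda>u. J (Y u)) differentiable (at u)" if "u \<in> \<Omega>" for u
    using bounded_linear.has_derivative[OF blJ smooth_has_derivative[OF sY that]] FD_eqI differentiableI by blast+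
  have "indicatrix_parametrization F1 x1 \<Omega> (\<lambda>u. J (Y u))"
    unfolding indicatrix_parametrization_def
  proof (intro conjI ballI o smooth_bounded_linear_compose[OF blJ o sY])
    show "inj_on (\<lambda>u. J (Y u)) \<Omega>" using iY(1) J(2) by (auto simp: inj_on_def)
    show "inj (FD (\<lambda>u. J (Y u)) u)" if "u \<in> \<Omega>" for u
      unfolding dJY[OF that] using iY(2)[OF that] J(2) by (auto simp: inj_on_def)
    show "(\<lambda>u. J (Y u)) ` \<Omega> \<subseteq> indicatrix F1 x1"
      using Y1 J(3) J0 by (auto simp: indicatrix_def)
  qed
  then have "sectional_curvature (induced_metric F1 x1 (\<lambda>u. J (Y u))) u v w = C"
    using c u vw by (auto simp: indicatrix_constant_curvature_def)
  moreover have "induced_metric F1 x1 (\<lambda>u. J (Y u)) u = induced_metric F2 x2 Y u" if u: "u \<in> \<Omega>" for u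
  proof -
    have y: "Y u \<noteq> 0" using Y1[OF u] by simp
    let ?E1 = "\<lambda>z. (F1 x1 z)\<^sup>2" and ?E2 = "\<lambda>z. (F2 x2 z)\<^sup>2"
    have hJ: "(J has_derivative J) (at z)" for z by (rule bounded_linear_imp_has_derivative[OF blJ])
    have d1: "FD ?E2 z w = FD ?E1 (J z) (J w)" if "z \<noteq> 0" for z w
    proof -
      have "FD ?E2 z = FD (\<lambda>z. ?E1 (J z)) z"
        by (rule FD_cong[of "UNIV - {0}"]) (use that J(3) in auto)
      also have "\<dots> = (\<lambda>w. FD ?E1 (J z) (J w))"
        by (rule FD_eqI[OF has_derivative_compose[OF hJ smooth_has_derivative[OF f1.smooth_energy_x[OF f1(2)]]]]) (use J0[OF that] in simp)
      finally show ?thesis by simp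
    qed
    have "FD (\<lambda>z. FD ?E2 z w) (Y u) v = FD (\<lambda>z. FD ?E1 z (J w)) (J (Y u)) (J v)" for v w
    proof -
      have "FD (\<lambda>z. FD ?E2 z w) (Y u) = FD (\<lambda>z. FD ?E1 (J z) (J w)) (Y u)"
        by (rule FD_cong[of "UNIV - {0}"]) (use y d1 in auto)
      also have "\<dots> = (\<lambda>v. FD (\<lambda>z. FD ?E1 z (J w)) (J (Y u)) (J v))"
        by (rule FD_eqI[OF has_derivative_compose[OF hJ smooth_has_derivative[OF smooth_FD[OF f1.smooth_energy_x[OF f1(2)]]]]]) (use J0[OF y] in simp)
      finally show ?thesis by simp
    qed
    then show ?thesis
      unfolding vec_eq_iff f1.induced_metric_eq[OF dJY(2)[OF u]] f2.induced_metric_eq[OF smooth_differentiable[OF sY u]] dJY(1)[OF u]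
        f1.metric_form[OF f1(2) J0[OF y]] f2.metric_form[OF f2(2) y] by simp
  qed
  ultimately show "sectional_curvature (induced_metric F2 x2 Y) u v w = C"
    using sectional_curvature_cong[OF o u, of "induced_metric F1 x1 (\<lambda>u. J (Y u))" "induced_metric F2 x2 Y"] by simp
qed

section \<open>The curvature and the multiplier forced by a conformal automorphism\<close>

context finsler
begin

context
  fixes W a H t p
  assumes ca: "conformal_automorphism W F a H t p" and WD: "fst ` W \<subseteq> D"
begin

lemma W_open: "open W" using ca by (simp add: conformal_automorphism_def)

lemma automorphism_facts:
  assumes "(x, y) \<in> W"
  shows "x \<in> D" "y \<noteq> 0" "H x > 0" "p x y > 0" "pos_def (a x)" "t x y \<noteq> 0"
    "\<And>k. k > 0 \<Longrightarrow> (x, k *\<^sub>R y) \<in> W" "\<And>k. k > 0 \<Longrightarrow> t x (k *\<^sub>R y) = (k powr H x) *\<^sub>R t x y"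
    "F x y = 1 \<longleftrightarrow> t x y \<bullet> (a x *v t x y) = 1"
    "\<And>m n. finsler_metric F x y $ m $ n = (p x y)\<^sup>2 * (\<Sum>i\<in>UNIV. \<Sum>j\<in>UNIV.
       a x $ i $ j * jacobian (t x) (at y) $ i $ m * jacobian (t x) (at y) $ j $ n)"
proof -
  have 1: "case (x, y) of (x, y) \<Rightarrow> y \<noteq> 0 \<and> (\<forall>k>0. (x, k *\<^sub>R y) \<in> W)"
    using ca assms unfolding conformal_automorphism_def by blast
  have 2: "case (x, y) of (x, y) \<Rightarrow> t x y \<noteq> 0 \<and> invertible (jacobian (t x) (at y)) \<and>
        H x > 0 \<and> (\<forall>k>0. t x (k *\<^sub>R y) = (k powr H x) *\<^sub>R t x y) \<and>
        (F x y = 1 \<longleftrightarrow> riemannian_function a x (t x y) = 1) \<and> p x y > 0 \<and>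
        (\<forall>m n. finsler_metric F x y $ m $ n =
           (p x y)\<^sup>2 * (\<Sum>i\<in>UNIV. \<Sum>j\<in>UNIV.
              a x $ i $ j * jacobian (t x) (at y) $ i $ m * jacobian (t x) (at y) $ j $ n))"
    using ca assms unfolding conformal_automorphism_def by blast
  have x: "x \<in> fst ` W" using assms by force
  then show "x \<in> D" "pos_def (a x)"
    using WD ca unfolding conformal_automorphism_def riemannian_metric_iff by blast+
  show "y \<noteq> 0" "H x > 0" "p x y > 0" "t x y \<noteq> 0"
    "\<And>k. k > 0 \<Longrightarrow> (x, k *\<^sub>R y) \<in> W" "\<And>k. k > 0 \<Longrightarrow> t x (k *\<^sub>R y) = (k powr H x) *\<^sub>R t x y"
    "F x y = 1 \<longleftrightarrow> t x y \<bullet> (a x *v t x y) = 1"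
    "finsler_metric F x y $ m $ n = (p x y)\<^sup>2 * (\<Sum>i\<in>UNIV. \<Sum>j\<in>UNIV.
       a x $ i $ j * jacobian (t x) (at y) $ i $ m * jacobian (t x) (at y) $ j $ n)" for m n
    using 1 2 by (simp_all add: riemannian_function_def inner_mv)
qed

lemma t_differentiable:
  assumes "(x, y) \<in> W"
  shows "t x differentiable (at y)"
proof -
  have "((\<lambda>(x, y). t x y) has_derivative FD (\<lambda>(x, y). t x y) (x, y)) (at (x, y))"
    using ca assms by (intro smooth_has_derivative) (auto simp: conformal_automorphism_def)
  moreover have "((\<lambda>y. (x, y)) has_derivative (\<lambda>v. (0, v))) (at y)" by (auto intro!: derivative_eq_intros)
  ultimately have "((\<lambda>y. (\<lambda>(x, y). t x y) (x, y)) has_derivative (\<lambda>v. FD (\<lambda>(x, y). t x y) (x, y) (0, v))) (at y)"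
    by (rule has_derivative_compose[rotated])
  then show ?thesis by (auto simp: differentiable_def)
qed

lemma conformal_form:
  assumes "(x, y) \<in> W"
  shows "v \<bullet> (finsler_metric F x y *v w) = (p x y)\<^sup>2 * (FD (t x) y v \<bullet> (a x *v FD (t x) y w))"
proof -
  interpret ip: bounded_bilinear "\<lambda>v w. v \<bullet> (a x *v w)" by (rule bounded_bilinear_form)
  have l: "FD (t x) y v = (\<Sum>i\<in>UNIV. v $ i *\<^sub>R FD (t x) y (axis i 1))" for v
    by (rule linear_axis[OF linear_frechet_derivative[OF t_differentiable[OF assms]]])
  have j: "jacobian (t x) (at y) $ i $ m = FD (t x) y (axis m 1) $ i" for i m
    by (simp add: jacobian_def matrix_def)
  have "finsler_metric F x y $ m $ n = (p x y)\<^sup>2 * (FD (t x) y (axis m 1) \<bullet> (a x *v FD (t x) y (axis n 1)))" for m n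
    unfolding automorphism_facts(10)[OF assms] inner_mv j ..
  then show ?thesis
    unfolding l[of v] l[of w] inner_mv[of v] ip.sum_left ip.sum_right ip.scaleR_left ip.scaleR_right
    by (simp add: sum_distrib_left ac_simps) (rule sum.swap)
qed

lemma image_norm:
  assumes "(x, y) \<in> W"
  shows "t x y \<bullet> (a x *v t x y) = (F x y powr H x)\<^sup>2"
proof -
  note f = automorphism_facts[OF assms]
  have Fp: "F x y > 0" using F_pos f by blast
  let ?k = "1 / F x y"
  have k: "?k > 0" using Fp by simp
  have "F x (?k *\<^sub>R y) = 1" using F_hom[OF f(1,2) k] Fp by simp
  then have "t x (?k *\<^sub>R y) \<bullet> (a x *v t x (?k *\<^sub>R y)) = 1"
    using automorphism_facts(9)[OF f(7)[OF k]] by blast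
  then have "(?k powr H x) * ((?k powr H x) * (t x y \<bullet> (a x *v t x y))) = 1"
    unfolding f(8)[OF k] by (simp add: matrix_vector_mult_scaleR)
  moreover have "?k powr H x = inverse (F x y powr H x)" using Fp by (simp add: powr_divide field_simps)
  moreover have "F x y powr H x > 0" using Fp by simp
  ultimately show ?thesis by (simp add: field_simps power2_eq_square)
qed

lemma multiplier_eq:
  assumes "(x, y) \<in> W"
  shows "p x y = 1 / H x * F x y powr (1 - H x)"
proof -
  note f = automorphism_facts[OF assms]
  have Fp: "F x y > 0" using F_pos f by blast
  have "FD (t x) y y = H x *\<^sub>R t x y"
  proof (rule FD_euler[OF t_differentiable[OF assms] f(8)])
    show "((\<lambda>k. k powr H x) has_real_derivative H x) (at 1)" by (auto intro!: derivative_eq_intros)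
  qed
  then have "y \<bullet> (finsler_metric F x y *v y) = (p x y)\<^sup>2 * (H x * (H x * (t x y \<bullet> (a x *v t x y))))"
    unfolding conformal_form[OF assms] by (simp add: matrix_vector_mult_scaleR)
  then have "F x y * F x y = (p x y * H x * F x y powr H x)\<^sup>2"
    unfolding metric_radial[OF f(1,2)] F_euler[OF f(1,2)] image_norm[OF assms] by (simp add: power2_eq_square ac_simps)
  then have "(F x y)\<^sup>2 = (p x y * H x * F x y powr H x)\<^sup>2" by (simp add: power2_eq_square)
  then have "F x y = p x y * H x * F x y powr H x" using Fp f(3,4) by (simp add: power2_eq_iff_nonneg)
  then show ?thesis using Fp f(3) by (simp add: powr_diff field_simps)
qed

lemma automorphism_curvature:
  fixes Y :: "real^'m::finite \<Rightarrow> real^'n"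
  assumes dim: "CARD('n) = CARD('m) + 1" and Y: "indicatrix_parametrization F x \<Omega> Y" and u0: "u0 \<in> \<Omega>" "(x, Y u0) \<in> W"
    and vw: "v \<noteq> w" "independent {v, w}"
  shows "sectional_curvature (induced_metric F x Y) u0 v w = (H x)\<^sup>2"
proof -
  have o: "open \<Omega>" and sY: "smooth_map_on \<Omega> Y" and Y1: "\<And>u. u \<in> \<Omega> \<Longrightarrow> F x (Y u) = 1"
    using Y by (auto simp: indicatrix_parametrization_def indicatrix_def)
  have x: "x \<in> D" using automorphism_facts[OF u0(2)] by blast
  interpret big: coordinate_metric \<Omega> "induced_metric F x Y" by (rule parametrization_metric[OF x Y])
  \<comment> \<open>The transformation exists only on W, so the parametrization is restricted to the
    part that lands there; an open neighbourhood of u0 is enough, curvature being local.\<close>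
  define S where "S = \<Omega> \<inter> (\<lambda>u. (x, Y u)) -` W"
  have oS: "open S"
    unfolding S_def by (rule continuous_open_preimage[OF _ o W_open])
      (intro continuous_intros smooth_continuous[OF sY])
  interpret coordinate_metric S "induced_metric F x Y"
    using oS big.metric unfolding coordinate_metric_def riemannian_metric_iff S_def by (auto intro: smooth_subset)
  have inW: "(x, Y u) \<in> W" "u \<in> \<Omega>" if "u \<in> S" for u using that by (auto simp: S_def)
  have Zs: "smooth_map_on S (\<lambda>u. t x (Y u))"
  proof -
    have "smooth_map_on S (\<lambda>u. (\<lambda>(x, y). t x y) (x, Y u))"
      by (rule smooth_compose[OF oS W_open])
         (use ca inW in \<open>auto simp: conformal_automorphism_def S_def intro!: smooth_Pair smooth_const oS[unfolded S_def] smooth_subset[OF sY]\<close>)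
    then show ?thesis by simp
  qed
  have dZ: "FD (\<lambda>u. t x (Y u)) u = (\<lambda>v. FD (t x) (Y u) (FD Y u v))" if "u \<in> S" for u
    by (rule FD_eqI[OF has_derivative_compose[OF smooth_has_derivative[OF sY inW(2)[OF that]]
        FD_has_derivative[OF t_differentiable[OF inW(1)[OF that]]]]])
  have f0: "H x > 0" "pos_def (a x)" using automorphism_facts[OF u0(2)] by blast+
  have "riemann (induced_metric F x Y) u0 d c a' b = (H x)\<^sup>2 * (induced_metric F x Y u0 $ b $ c * (if d = a' then 1 else 0) - induced_metric F x Y u0 $ a' $ c * (if d = b then 1 else 0))" for d c a' b
  proof (rule sphere_immersion_curvature[OF dim f0(2) Zs])
    show "(H x)\<^sup>2 > 0" using f0(1) by simp
    fix u assume u: "u \<in> S"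
    show "t x (Y u) \<bullet> (a x *v t x (Y u)) = 1" using image_norm[OF inW(1)[OF u]] Y1[OF inW(2)[OF u]] by simp
    fix b c
    have "p x (Y u) = 1 / H x" using multiplier_eq[OF inW(1)[OF u]] Y1[OF inW(2)[OF u]] by simp
    then show "FD (\<lambda>u. t x (Y u)) u (axis b 1) \<bullet> (a x *v FD (\<lambda>u. t x (Y u)) u (axis c 1)) = (H x)\<^sup>2 * induced_metric F x Y u $ b $ c"
      unfolding induced_metric_eq[OF smooth_differentiable[OF sY inW(2)[OF u]]] conformal_form[OF inW(1)[OF u]] dZ[OF u]
      using f0(1) by (simp add: power_divide)
  qed (use u0 in \<open>simp add: S_def\<close>)
  then show ?thesis using riemann_imp_constant_sectional[OF _ _ vw] u0 by (simp add: S_def)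
qed

end

end

section \<open>Central projection charts of the indicatrix\<close>

text \<open>Injectivity on a ball whose radius serves all x near x0. There the derivative in u stays
  within \<open>c / 2\<close> of L, so \<open>Z (x, u) - L u\<close> has Lipschitz constant
  \<open>c / 2\<close> while L stretches by at least c.\<close>

lemma locally_injective_param:
  fixes Z :: "'p::euclidean_space \<times> 'z::euclidean_space \<Rightarrow> 'b::euclidean_space"
  assumes T: "open T" "(x0, 0) \<in> T" and Z: "smooth_map_on T Z" and inj: "\<And>v. FD Z (x0, 0) (0, v) = 0 \<Longrightarrow> v = 0"
  obtains \<rho> where "\<rho> > 0" "tube (ball x0 \<rho>) \<rho> \<subseteq> T" "\<And>x. x \<in> ball x0 \<rho> \<Longrightarrow> inj_on (\<lambda>u. Z (x, u)) (ball 0 \<rho>)"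
proof -
  define L where "L v = FD Z (x0, 0) (0, v)" for v
  have hd: "(Z has_derivative FD Z \<theta>) (at \<theta>)" if "\<theta> \<in> T" for \<theta> using smooth_has_derivative[OF Z that] .
  have linL: "linear L"
    using linear_add[OF has_derivative_linear[OF hd[OF T(2)]], of "(0, _)" "(0, _)"]
      linear_scale[OF has_derivative_linear[OF hd[OF T(2)]], of _ "(0, _)"]
    unfolding L_def by (intro linearI) auto
  then have "inj L" unfolding linear_injective_0[OF linL] using inj by (simp add: L_def)
  then obtain c where c: "c > 0" "\<And>v. c * norm v \<le> norm (L v)" using linear_inj_bounded_below_pos[OF linL] by metis
  \<comment> \<open>A continuous majorant of the operator norm of the deviation from L, built from
    basis directions because only directional derivatives are known to be continuous.\<close>
  define \<sigma> where "\<sigma> \<theta> = (\<Sum>b\<in>Basis. norm (FD Z \<theta> (0, b) - L b))" for \<theta>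
  have "continuous_on T \<sigma>"
    unfolding \<sigma>_def by (intro continuous_intros smooth_continuous[OF smooth_FD[OF Z]])
  then have "open (T \<inter> \<sigma> -` {..<c/2})" by (intro continuous_open_preimage T) auto
  moreover have "(x0, 0) \<in> T \<inter> \<sigma> -` {..<c/2}" using T c by (simp add: \<sigma>_def L_def)
  ultimately obtain X Y where XY: "open X" "open Y" "x0 \<in> X" "0 \<in> Y" "X \<times> Y \<subseteq> T \<inter> \<sigma> -` {..<c/2}"
    by (metis open_prod_elim mem_Sigma_iff)
  obtain r1 where r1: "r1 > 0" "ball x0 r1 \<subseteq> X" using XY open_contains_ball by blast
  obtain r2 where r2: "r2 > 0" "ball 0 r2 \<subseteq> Y" using XY open_contains_ball by blast
  define \<rho> where "\<rho> = min r1 r2"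
  have sub: "tube (ball x0 \<rho>) \<rho> \<subseteq> T \<inter> \<sigma> -` {..<c/2}"
    using XY(5) r1 r2 by (force simp: tube_def \<rho>_def)
  show ?thesis
  proof (rule that[of \<rho>])
    show "\<rho> > 0" using r1 r2 by (simp add: \<rho>_def)
    show "tube (ball x0 \<rho>) \<rho> \<subseteq> T" using sub by blast
    fix x assume x: "x \<in> ball x0 \<rho>"
    show "inj_on (\<lambda>u. Z (x, u)) (ball 0 \<rho>)"
    proof (rule inj_onI)
      fix u u' assume u: "u \<in> ball 0 \<rho>" "u' \<in> ball 0 \<rho>" and e: "Z (x, u) = Z (x, u')"
      have "norm ((Z (x, u) - L u) - (Z (x, u') - L u')) \<le> c / 2 * norm (u - u')"
      proof (rule differentiable_bound[of "ball 0 \<rho>" "\<lambda>u. Z (x, u) - L u" "\<lambda>u v. FD Z (x, u) (0, v) - L v"])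
        fix w :: 'z assume w: "w \<in> ball 0 \<rho>"
        then have xw: "(x, w) \<in> T" "\<sigma> (x, w) < c/2" using sub x by (auto simp: tube_def subset_iff)
        have "((\<lambda>u. (x, u)) has_derivative (\<lambda>v. (0, v))) (at w)" by (auto intro!: derivative_eq_intros)
        from has_derivative_compose[OF this hd[OF xw(1)]]
        have "((\<lambda>u. Z (x, u) - L u) has_derivative (\<lambda>v. FD Z (x, w) (0, v) - L v)) (at w)"
          by (intro has_derivative_diff) (auto intro: bounded_linear_imp_has_derivative simp: linear_conv_bounded_linear[symmetric] linL)
        then show "((\<lambda>u. Z (x, u) - L u) has_derivative (\<lambda>v. FD Z (x, w) (0, v) - L v)) (at w within ball 0 \<rho>)"
          by (rule has_derivative_at_withinI)
        show "onorm (\<lambda>v. FD Z (x, w) (0, v) - L v) \<le> c / 2"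
        proof (rule onorm_le)
          fix v
          have "FD Z (x, w) (0, v) - L v = (\<Sum>b\<in>Basis. (v \<bullet> b) *\<^sub>R (FD Z (x, w) (0, b) - L b))"
            unfolding L_def linear_snd_expansion[OF has_derivative_linear[OF hd[OF xw(1)]], of v] linear_snd_expansion[OF has_derivative_linear[OF hd[OF T(2)]], of v]
            by (simp add: scaleR_diff_right sum_subtractf)
          also have "norm \<dots> \<le> (\<Sum>b\<in>Basis. norm v * norm (FD Z (x, w) (0, b) - L b))"
            by (rule sum_norm_le) (simp add: Basis_le_norm mult_right_mono)
          also have "\<dots> = norm v * \<sigma> (x, w)" by (simp add: \<sigma>_def sum_distrib_left)
          also have "\<dots> \<le> norm v * (c / 2)" using xw(2) by (intro mult_left_mono) auto
          finally show "norm (FD Z (x, w) (0, v) - L v) \<le> c / 2 * norm v" by (simp add: mult.commute)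
        qed
      qed (use u in auto)
      then have "norm (L (u' - u)) \<le> c / 2 * norm (u - u')"
        using e linear_diff[OF linL] by simp
      then have "c * norm (u - u') \<le> c / 2 * norm (u - u')" using c(2)[of "u' - u"] by (simp add: norm_minus_commute)
      then show "u = u'" using c(1) by simp
    qed
  qed
qed

text \<open>
  The indicatrix is projected from the origin to the hyperplane through \<open>y0\<close> on which the coordinate
  \<open>i0\<close> is constant; \<open>\<beta>\<close> lists the remaining coordinates.
\<close>

locale central_chart = finsler D F
  for D :: "(real^'n::finite) set" and F +
  fixes y0 :: "real^'n" and i0 :: 'n and \<beta> :: "'m::finite \<Rightarrow> 'n"
  assumes y0: "y0 $ i0 \<noteq> 0" and inj_\<beta>: "inj \<beta>" and range_\<beta>: "range \<beta> = UNIV - {i0}"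
begin

definition lift_pt :: "real^'m \<Rightarrow> real^'n" where
  "lift_pt u = (\<chi> i. y0 $ i + (if i = i0 then 0 else u $ inv \<beta> i))"

text \<open>Normalised to be 1 at y0. Positive height singles out the open half space containing y0,
  on which the central projection gives polar coordinates.\<close>

definition height :: "real^'n \<Rightarrow> real" where "height y = y $ i0 / y0 $ i0"

text \<open>The shift by y0 sends y0 to the origin, which is where the tubes of the linear system
  are centred.\<close>

definition proj :: "real^'n \<Rightarrow> real^'m" where "proj y = (\<chi> a. y $ \<beta> a / height y - y0 $ \<beta> a)"

definition central_param :: "real^'n \<Rightarrow> real^'m \<Rightarrow> real^'n" where "central_param x u = (1 / F x (lift_pt u)) *\<^sub>R lift_pt u"

definition central_metric :: "real^'n \<Rightarrow> real^'m \<Rightarrow> real^'m^'m" where "central_metric x = induced_metric F x (central_param x)"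

lemma \<beta>_i0: "\<beta> a \<noteq> i0" using range_\<beta> by blast

lemma lift_pt_nth [simp]: "lift_pt u $ i0 = y0 $ i0" "lift_pt u $ \<beta> a = y0 $ \<beta> a + u $ a"
  by (simp_all add: lift_pt_def \<beta>_i0 inj_\<beta>)

lemma lift_pt_nz: "lift_pt u \<noteq> 0" using y0 by (metis lift_pt_nth(1) zero_index)

lemma eq_by_\<beta>: "y $ i0 = y' $ i0 \<Longrightarrow> (\<And>a. y $ \<beta> a = y' $ \<beta> a) \<Longrightarrow> y = y'"
  unfolding vec_eq_iff using range_\<beta> by (metis DiffI UNIV_I imageE singletonD)

lemma proj_scale_lift: "k \<noteq> 0 \<Longrightarrow> proj (k *\<^sub>R lift_pt u) = u"
  using y0 by (simp add: proj_def height_def vec_eq_iff)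

lemma lift_proj: "y $ i0 \<noteq> 0 \<Longrightarrow> lift_pt (proj y) = (1 / height y) *\<^sub>R y"
  by (rule eq_by_\<beta>) (use y0 in \<open>simp_all add: proj_def height_def\<close>)

lemma proj_scale: "k \<noteq> 0 \<Longrightarrow> proj (k *\<^sub>R y) = proj y"
  by (simp add: proj_def height_def)

lemma height_scale: "height (k *\<^sub>R y) = k * height y"
  by (simp add: height_def)

lemma smooth_lift: "open S \<Longrightarrow> smooth_map_on S lift_pt"
proof (rule smooth_vec)
  assume o: "open S"
  show "smooth_map_on S (\<lambda>u. lift_pt u $ i)" for i
    unfolding lift_pt_def vec_lambda_beta
    by (cases "i = i0")
       (simp_all add: smooth_const smooth_add[OF o smooth_const smooth_bounded_linear[OF bounded_linear_vec_nth]])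
qed

lemma open_i0: "open {y :: real^'n. y $ i0 \<noteq> 0}"
  by (intro open_Collect_neq continuous_intros)

lemma smooth_proj: "smooth_map_on {y. y $ i0 \<noteq> 0} proj"
proof (rule smooth_vec[OF open_i0])
  show "smooth_map_on {y. y $ i0 \<noteq> 0} (\<lambda>y. proj y $ a)" for a
    unfolding proj_def height_def vec_lambda_beta
    by (intro smooth_diff smooth_divide smooth_const open_i0 smooth_bounded_linear bounded_linear_vec_nth) (use y0 in auto)
qed

lemma smooth_central_param: "smooth_map_on (D \<times> UNIV) (\<lambda>\<theta>. central_param (fst \<theta>) (snd \<theta>))"
proof -
  have o: "open (D \<times> (UNIV :: (real^'m) set))" using open_D by (intro open_Times) auto
  have l: "smooth_map_on (D \<times> UNIV) (\<lambda>\<theta>. lift_pt (snd \<theta>))"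
    by (rule smooth_compose[OF o open_UNIV _ smooth_snd smooth_lift[OF open_UNIV]]) auto
  have "smooth_map_on (D \<times> UNIV) (\<lambda>\<theta>. (\<lambda>\<theta>. F (fst \<theta>) (snd \<theta>)) (fst \<theta>, lift_pt (snd \<theta>)))"
    by (rule smooth_compose[OF o open_slit _ _ smooth_F]) (use lift_pt_nz l o in \<open>auto intro!: smooth_Pair smooth_fst\<close>)
  then show ?thesis
    unfolding central_param_def using F_pos lift_pt_nz
    by (intro smooth_scaleR smooth_divide smooth_const l o) (force simp: less_le)+
qed

lemma smooth_central_param_x: "x \<in> D \<Longrightarrow> smooth_map_on UNIV (central_param x)"
proof -
  assume x: "x \<in> D"
  have o: "open (D \<times> (UNIV :: (real^'m) set))" using open_D by (intro open_Times) auto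
  have "smooth_map_on UNIV (\<lambda>u. (\<lambda>\<theta>. central_param (fst \<theta>) (snd \<theta>)) (x, u))"
    by (rule smooth_compose[OF open_UNIV o _ _ smooth_central_param]) (use x in \<open>auto intro!: smooth_Pair smooth_const smooth_ident\<close>)
  then show ?thesis by simp
qed

lemma F_lift_pos: "x \<in> D \<Longrightarrow> F x (lift_pt u) > 0" using F_pos lift_pt_nz by blast

lemma central_param_facts:
  assumes "x \<in> D"
  shows "proj (central_param x u) = u" "central_param x u \<noteq> 0" "F x (central_param x u) = 1" "central_param x u $ i0 \<noteq> 0"
  using proj_scale_lift[of "1 / F x (lift_pt u)" u] F_lift_pos[OF assms, of u] lift_pt_nz[of u] y0
    F_hom[OF assms lift_pt_nz, of "1 / F x (lift_pt u)" u]
  by (auto simp: central_param_def)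

lemma polar:
  assumes "x \<in> D" "height y > 0"
  shows "y = F x y *\<^sub>R central_param x (proj y)"
proof -
  have y: "y $ i0 \<noteq> 0" "y \<noteq> 0" using assms(2) by (auto simp: height_def)
  have "F x ((1 / height y) *\<^sub>R y) = 1 / height y * F x y" using F_hom[OF assms(1) y(2)] assms(2) by simp
  then show ?thesis using assms(2) F_pos[OF assms(1) y(2)] by (simp add: central_param_def lift_proj[OF y(1)])
qed

lemma central_param_parametrization: "x \<in> D \<Longrightarrow> indicatrix_parametrization F x UNIV (central_param x)"
  unfolding indicatrix_parametrization_def
proof (intro conjI ballI)
  assume x: "x \<in> D"
  show "smooth_map_on UNIV (central_param x)" by (rule smooth_central_param_x[OF x])
  show "inj (central_param x)" using central_param_facts(1)[OF x] by (metis injI)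
  show "inj (FD (central_param x) u)" for u
  proof -
    have "(proj has_derivative FD proj (central_param x u)) (at (central_param x u))"
      using smooth_has_derivative[OF smooth_proj] central_param_facts(4)[OF x] by simp
    from FD_eqI[OF has_derivative_compose[OF smooth_has_derivative[OF smooth_central_param_x[OF x]] this]]
    have "(\<lambda>v. FD proj (central_param x u) (FD (central_param x) u v)) = (\<lambda>v. v)"
      by (simp add: central_param_facts(1)[OF x])
    then show ?thesis by (metis injI)
  qed
  show "central_param x ` UNIV \<subseteq> indicatrix F x" using central_param_facts[OF x] by (auto simp: indicatrix_def)
qed simp

lemma central_metric_metric: "x \<in> D \<Longrightarrow> coordinate_metric UNIV (central_metric x)"
  unfolding central_metric_def by (rule parametrization_metric[OF _ central_param_parametrization])

lemma central_metric_pos_def: "x \<in> D \<Longrightarrow> pos_def (central_metric x u)"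
  using coordinate_metric.pos[OF central_metric_metric] by blast

lemma smooth_central_metric: "smooth_map_on (D \<times> UNIV) (\<lambda>(x, u). central_metric x u)"
proof -
  have o: "open (D \<times> (UNIV :: (real^'m) set))" using open_D by (intro open_Times) auto
  have sg: "smooth_map_on (D \<times> UNIV) (\<lambda>\<theta>. finsler_metric F (fst \<theta>) (central_param (fst \<theta>) (snd \<theta>)) $ i $ j)" for i j
  proof -
    have "smooth_map_on (D \<times> UNIV) (\<lambda>\<theta>. (\<lambda>\<theta>. finsler_metric F (fst \<theta>) (snd \<theta>) $ i $ j) (fst \<theta>, central_param (fst \<theta>) (snd \<theta>)))"
      by (rule smooth_compose[OF o open_slit _ _ smooth_metric]) (use central_param_facts(2) o in \<open>auto intro!: smooth_Pair smooth_fst smooth_central_param\<close>)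
    then show ?thesis by simp
  qed
  have sY: "smooth_map_on (D \<times> UNIV) (\<lambda>\<theta>. central_param (fst \<theta>) (snd \<theta>) $ i)" for i
    by (rule smooth_nth[OF o smooth_central_param])
  have sp: "smooth_map_on (D \<times> UNIV) (\<lambda>\<theta>. partial a (\<lambda>w. central_param (fst \<theta>) w $ i) (snd \<theta>))" for a i
  proof (rule smooth_cong[OF o _ smooth_FD[OF sY[of i], of "(0, axis a 1)"]])
    fix \<theta> :: "(real^'n) \<times> (real^'m)" assume "\<theta> \<in> D \<times> UNIV"
    then show "FD (\<lambda>\<theta>. central_param (fst \<theta>) (snd \<theta>) $ i) \<theta> (0, axis a 1) = partial a (\<lambda>w. central_param (fst \<theta>) w $ i) (snd \<theta>)"
      using partial_slice[of "\<lambda>\<theta>. central_param (fst \<theta>) (snd \<theta>) $ i" _ "fst \<theta>" "snd \<theta>" a, unfolded prod.collapse,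
          OF smooth_has_derivative[OF sY]] by simp
  qed
  have "smooth_map_on (D \<times> UNIV) (\<lambda>\<theta>. central_metric (fst \<theta>) (snd \<theta>))"
    by (intro smooth_vec[OF o]) (simp add: central_metric_def induced_metric_def, intro smooth_sum smooth_mult o sg sp)
  then show ?thesis by (simp add: case_prod_unfold)
qed

lemma central_metric_riemann:
  assumes "x \<in> D" "indicatrix_constant_curvature TYPE('m) F x C"
  shows "riemann (central_metric x) u d c a b = C * (central_metric x u $ b $ c * (if d = a then 1 else 0) - central_metric x u $ a $ c * (if d = b then 1 else 0))"
proof (rule coordinate_metric.constant_sectional_imp_riemann[OF central_metric_metric[OF assms(1)]])
  show "sectional_curvature (central_metric x) u v w = C" if "v \<noteq> w" "independent {v, w}" for v w
    using assms(2) central_param_parametrization[OF assms(1)] that unfolding indicatrix_constant_curvature_def central_metric_def by blast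
qed simp

lemma central_metric_diag_pos: "x \<in> D \<Longrightarrow> central_metric x u $ b $ b > 0"
proof -
  assume x: "x \<in> D"
  have "axis b (1::real) \<noteq> 0" by (simp add: axis_eq_0_iff)
  then have "axis b 1 \<bullet> (central_metric x u *v axis b 1) > 0" using central_metric_pos_def[OF x] by (simp add: pos_def_def)
  then show ?thesis by (simp add: inner_axis' matrix_vector_mul_component inner_axis)
qed

text \<open>Nothing is assumed about how C varies with x. For \<open>a \<noteq> b\<close> the
  component \<open>riemann h u a b a b\<close> equals C times the entry \<open>h u $ b $ b\<close>,
  which is positive, and both depend smoothly on x.\<close>

lemma smooth_curvature:
  assumes "CARD('m) \<ge> 2" "\<And>x. x \<in> D \<Longrightarrow> indicatrix_constant_curvature TYPE('m) F x (C x)"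
  shows "smooth_map_on D C"
proof -
  obtain a b :: 'm where ab: "a \<noteq> b"
    using assms(1) card_le_Suc0_iff_eq[of "UNIV :: 'm set"] by force
  have o: "open (D \<times> (UNIV :: (real^'m) set))" using open_D by (intro open_Times) auto
  have "smooth_map_on D (\<lambda>x. (\<lambda>(x, u). riemann (central_metric x) u a b a b) (x, 0))"
    by (rule smooth_compose[OF open_D o _ _ smooth_riemann_param[OF o smooth_central_metric]])
       (auto intro!: smooth_Pair smooth_const smooth_ident open_D central_metric_pos_def)
  moreover have "smooth_map_on D (\<lambda>x. (\<lambda>(x, u). central_metric x u) (x, 0) $ b $ b)"
    by (rule smooth_entries[OF open_D smooth_compose[OF open_D o _ _ smooth_central_metric]])
       (auto intro!: smooth_Pair smooth_const smooth_ident open_D)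
  ultimately have "smooth_map_on D (\<lambda>x. riemann (central_metric x) 0 a b a b / central_metric x 0 $ b $ b)"
    using central_metric_diag_pos by (intro smooth_divide open_D) (auto simp: less_le)
  moreover have "riemann (central_metric x) 0 a b a b / central_metric x 0 $ b $ b = C x" if "x \<in> D" for x
    using central_metric_riemann[OF that assms(2)[OF that], of 0 a b a b] central_metric_diag_pos[OF that, of 0 b] ab by simp
  ultimately show ?thesis by (rule smooth_cong[OF open_D, rotated])
qed

text \<open>The cone form \<open>dF^2 + F^2 h\<close> of the Finsler metric. There is no mixed term
  because the radial direction is orthogonal to the indicatrix.\<close>

lemma metric_polar:
  assumes x: "x \<in> D" and y: "height y > 0"
  shows "v \<bullet> (finsler_metric F x y *v w) = FD (F x) y v * FD (F x) y w
     + (F x y)\<^sup>2 * (FD proj y v \<bullet> (central_metric x (proj y) *v FD proj y w))"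
proof -
  have i: "y $ i0 \<noteq> 0" "y \<noteq> 0" using y by (auto simp: height_def)
  have Fp: "F x y > 0" using F_pos[OF x i(2)] .
  let ?u = "proj y" and ?Y = "central_param x (proj y)"
  note Yf = central_param_facts[OF x]
  have hF: "(F x has_derivative FD (F x) z) (at z)" if "z \<noteq> 0" for z using smooth_has_derivative[OF smooth_Fx[OF x]] that by simp
  have hY: "(central_param x has_derivative FD (central_param x) u) (at u)" for u using smooth_has_derivative[OF smooth_central_param_x[OF x]] by simp
  have hp: "(proj has_derivative FD proj y) (at y)" using smooth_has_derivative[OF smooth_proj] i by simp
  have oh: "open {y. height y > 0}" unfolding height_def by (intro open_Collect_less continuous_intros) (use y0 in auto)
  \<comment> \<open>The identity \<open>y = F x y *\<^sub>R central_param x (proj y)\<close> is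
    differentiated, which splits v into a radial and a tangential part.\<close>
  have ex: "v = FD (F x) y v *\<^sub>R ?Y + F x y *\<^sub>R FD (central_param x) ?u (FD proj y v)" for v
  proof -
    have "((\<lambda>y. F x y *\<^sub>R central_param x (proj y)) has_derivative (\<lambda>v. F x y *\<^sub>R FD (central_param x) ?u (FD proj y v) + FD (F x) y v *\<^sub>R ?Y)) (at y)"
      by (intro has_derivative_scaleR hF i has_derivative_compose[OF hp hY])
    note e = FD_eqI[OF this]
    have "FD (\<lambda>y. F x y *\<^sub>R central_param x (proj y)) y = FD (\<lambda>y. y) y"
      by (rule FD_cong[OF oh]) (use y polar[OF x] in simp_all)
    from fun_cong[OF this, of v] show ?thesis unfolding e frechet_derivative_ident by (simp add: add.commute)
  qed
  have g: "v \<bullet> (finsler_metric F x y *v w) = v \<bullet> (finsler_metric F x ?Y *v w)" for v w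
  proof -
    have "v \<bullet> (finsler_metric F x (F x y *\<^sub>R ?Y) *v w) = v \<bullet> (finsler_metric F x ?Y *v w)"
      by (rule metric_scale[OF x Yf(2) Fp])
    then show ?thesis using polar[OF x y] by simp
  qed
  interpret ip: bounded_bilinear "\<lambda>v w. v \<bullet> (finsler_metric F x ?Y *v w)" by (rule bounded_bilinear_form)
  have sym: "v \<bullet> (finsler_metric F x ?Y *v w) = w \<bullet> (finsler_metric F x ?Y *v v)" for v w
    by (rule inner_mv_commute) (use metric_pos_def[OF x Yf(2)] in \<open>simp add: pos_def_def\<close>)
  have g1: "?Y \<bullet> (finsler_metric F x ?Y *v ?Y) = 1"
    using metric_radial[OF x Yf(2)] F_euler[OF x Yf(2)] Yf(3) by simp
  \<comment> \<open>F is constant along the parametrization, so its differential kills tangential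
    vectors; \<open>metric_radial\<close> turns this into orthogonality to ?Y.\<close>
  have g0: "?Y \<bullet> (finsler_metric F x ?Y *v FD (central_param x) ?u \<eta>) = 0" for \<eta>
  proof -
    have "FD (\<lambda>u. F x (central_param x u)) ?u = (\<lambda>v. FD (F x) ?Y (FD (central_param x) ?u v))"
      by (rule FD_eqI[OF has_derivative_compose[OF hY hF[OF Yf(2)]]])
    then have "FD (F x) ?Y (FD (central_param x) ?u \<eta>) = 0" using Yf(3) by (simp add: fun_eq_iff)
    then show ?thesis using metric_radial[OF x Yf(2)] by simp
  qed
  have gh: "FD (central_param x) ?u \<eta> \<bullet> (finsler_metric F x ?Y *v FD (central_param x) ?u \<zeta>) = \<eta> \<bullet> (central_metric x ?u *v \<zeta>)" for \<eta> \<zeta>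
    unfolding central_metric_def by (rule induced_metric_form[symmetric]) (use hY differentiableI in blast)
  have "v \<bullet> (finsler_metric F x ?Y *v w) =
    (FD (F x) y v *\<^sub>R ?Y + F x y *\<^sub>R FD (central_param x) ?u (FD proj y v)) \<bullet> (finsler_metric F x ?Y *v
    (FD (F x) y w *\<^sub>R ?Y + F x y *\<^sub>R FD (central_param x) ?u (FD proj y w)))"
    using ex[of v] ex[of w] by simp
  also have "\<dots> = FD (F x) y v * FD (F x) y w + (F x y)\<^sup>2 * (FD proj y v \<bullet> (central_metric x ?u *v FD proj y w))"
    using g0[of "FD proj y w"] g0[of "FD proj y v"] sym[of "FD (central_param x) ?u (FD proj y v)" ?Y]
    unfolding ip.add_left ip.add_right ip.scaleR_left ip.scaleR_right g1 gh
    by (simp add: power2_eq_square)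
  finally show ?thesis unfolding g .
qed

theorem local_conformal_automorphism:
  assumes dim: "CARD('n) = CARD('m) + 1" and C: "smooth_map_on D C" "\<And>x. x \<in> D \<Longrightarrow> C x > 0"
    and cc: "\<And>x. x \<in> D \<Longrightarrow> indicatrix_constant_curvature TYPE('m) F x (C x)"
    and x1: "x1 \<in> D"
  shows "\<exists>W t p. (x1, y0) \<in> W \<and> W \<subseteq> D \<times> UNIV \<and> conformal_automorphism W F (\<lambda>x. mat 1) (\<lambda>x. sqrt (C x)) t p"
proof -
  have o: "open (D \<times> (UNIV :: (real^'m) set))" using open_D by (intro open_Times) auto
  obtain r0 and Z :: "(real^'n) \<times> (real^'m) \<Rightarrow> real^'n" where r0: "r0 > 0" "tube (ball x1 r0) r0 \<subseteq> D \<times> (UNIV :: (real^'m) set)"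
    and Zs: "smooth_map_on (tube (ball x1 r0) r0) Z" and Z1: "\<And>\<theta>. \<theta> \<in> tube (ball x1 r0) r0 \<Longrightarrow> Z \<theta> \<bullet> Z \<theta> = 1"
    and Z2: "\<And>\<theta> b c. \<theta> \<in> tube (ball x1 r0) r0 \<Longrightarrow>
       FD Z \<theta> (0, axis b 1) \<bullet> FD Z \<theta> (0, axis c 1) = C (fst \<theta>) * central_metric (fst \<theta>) (snd \<theta>) $ b $ c"
    and Z3: "\<And>\<theta> b. \<theta> \<in> tube (ball x1 r0) r0 \<Longrightarrow> Z \<theta> \<bullet> FD Z \<theta> (0, axis b 1) = 0"
    using sphere_immersion_param[OF dim o _ open_D _ smooth_central_metric _ C(1) C(2), of x1]
      x1 central_metric_pos_def central_metric_riemann[OF _ cc] by (auto simp: mem_Times_iff)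
  let ?T0 = "tube (ball x1 r0) r0 :: ((real^'n) \<times> (real^'m)) set"
  have oT0: "open ?T0" by (rule open_tube) simp
  have T0D: "fst \<theta> \<in> D" if "\<theta> \<in> ?T0" for \<theta> using that r0(2) by (auto simp: mem_Times_iff)
  have hZ: "(Z has_derivative FD Z \<theta>) (at \<theta>)" if "\<theta> \<in> ?T0" for \<theta> by (rule smooth_has_derivative[OF Zs that])
  have dZ: "FD Z \<theta> (0, v) = (\<Sum>b\<in>UNIV. v $ b *\<^sub>R FD Z \<theta> (0, axis b 1))" if "\<theta> \<in> ?T0" for \<theta> v
  proof -
    have "linear (\<lambda>v. FD Z \<theta> (0, v))"
      using linear_add[OF has_derivative_linear[OF hZ[OF that]], of "(0, _)" "(0, _)"]
        linear_scale[OF has_derivative_linear[OF hZ[OF that]], of _ "(0, _)"]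
      by (intro linearI) auto
    then show ?thesis by (rule linear_axis)
  qed
  have Z2': "FD Z \<theta> (0, v) \<bullet> FD Z \<theta> (0, w) = C (fst \<theta>) * (v \<bullet> (central_metric (fst \<theta>) (snd \<theta>) *v w))" if "\<theta> \<in> ?T0" for \<theta> v w
    unfolding dZ[OF that, of v] dZ[OF that, of w] inner_mv
    by (simp add: inner_sum_left inner_sum_right Z2[OF that] sum_distrib_left ac_simps) (rule sum.swap)
  have Z3': "Z \<theta> \<bullet> FD Z \<theta> (0, v) = 0" if "\<theta> \<in> ?T0" for \<theta> v
    unfolding dZ[OF that, of v] by (simp add: inner_sum_right Z3[OF that])
  have Z3'': "FD Z \<theta> (0, v) \<bullet> Z \<theta> = 0" if "\<theta> \<in> ?T0" for \<theta> v
    using Z3'[OF that, of v] by (simp add: inner_commute)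
  have x1T: "(x1, 0) \<in> ?T0" using r0(1) by (simp add: tube_def)
  \<comment> \<open>An immersion into the sphere, because the pullback metric \<open>C h\<close> is
    positive definite; this feeds the local injectivity of Z.\<close>
  have injd: "v = 0" if "FD Z (x1, 0) (0, v) = 0" for v
    using Z2'[OF x1T, of v v] that C(2)[OF x1] pos_def_zero[OF central_metric_pos_def[OF x1]] by auto
  obtain \<rho> where \<rho>: "\<rho> > 0" "tube (ball x1 \<rho>) \<rho> \<subseteq> ?T0" "\<And>x. x \<in> ball x1 \<rho> \<Longrightarrow> inj_on (\<lambda>u. Z (x, u)) (ball 0 \<rho>)"
    using locally_injective_param[OF oT0 x1T Zs injd] by blast
  define H where "H x = sqrt (C x)" for x
  \<comment> \<open>A cone, since \<open>proj\<close> ignores scaling: smallness is imposed on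
    directions only, as the homogeneity of t in y requires.\<close>
  define V where "V = {y. height y > 0} \<inter> proj -` ball 0 \<rho>"
  define W where "W = ball x1 \<rho> \<times> V"
  define t where "t x y = (F x y powr H x) *\<^sub>R Z (x, proj y)" for x y
  define p where "p x y = 1 / H x * F x y powr (1 - H x)" for x y
  have oh: "open {y. height y > 0}" unfolding height_def by (intro open_Collect_less continuous_intros) (use y0 in auto)
  have oV: "open V"
    unfolding V_def
    by (rule continuous_open_preimage[OF continuous_on_subset[OF smooth_continuous[OF smooth_proj]] oh])
       (auto simp: height_def)
  have oW: "open W" unfolding W_def by (intro open_Times oV) simp
  have inW: "(x, proj y) \<in> ?T0" "x \<in> D" "y \<noteq> 0" "height y > 0" "proj y \<in> ball 0 \<rho>" "y $ i0 \<noteq> 0" "F x y > 0" "H x > 0" "(H x)\<^sup>2 = C x"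
    if "(x, y) \<in> W" for x y
  proof -
    have "(x, proj y) \<in> tube (ball x1 \<rho>) \<rho>" using that by (simp add: W_def V_def tube_def)
    then show 1: "(x, proj y) \<in> ?T0" using \<rho>(2) by blast
    show x: "x \<in> D" using T0D[OF 1] by simp
    show h: "height y > 0" "proj y \<in> ball 0 \<rho>" using that by (auto simp: W_def V_def)
    then show "y $ i0 \<noteq> 0" and y: "y \<noteq> 0" by (auto simp: height_def)
    show "F x y > 0" by (rule F_pos[OF x y])
    show "H x > 0" "(H x)\<^sup>2 = C x" using C(2)[OF x] by (auto simp: H_def)
  qed
  have ht: "(t x has_derivative (\<lambda>v. (F x y powr H x) *\<^sub>R FD Z (x, proj y) (0, FD proj y v)
      + (H x * F x y powr (H x - 1) * FD (F x) y v) *\<^sub>R Z (x, proj y))) (at y)" if "(x, y) \<in> W" for x y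
  proof -
    note f = inW[OF that]
    have hF: "(F x has_derivative FD (F x) y) (at y)" using smooth_has_derivative[OF smooth_Fx[OF f(2)]] f(3) by simp
    have hp: "(proj has_derivative FD proj y) (at y)" using smooth_has_derivative[OF smooth_proj] f(6) by simp
    have "((\<lambda>r. r powr H x) has_real_derivative H x * F x y powr (H x - 1)) (at (F x y))"
      using f(7) by (auto intro!: derivative_eq_intros)
    then have "((\<lambda>r. r powr H x) has_derivative (\<lambda>h. H x * F x y powr (H x - 1) * h)) (at (F x y))"
      by (simp add: has_field_derivative_def)
    from has_derivative_compose[OF hF this]
    have 1: "((\<lambda>y. F x y powr H x) has_derivative (\<lambda>v. H x * F x y powr (H x - 1) * FD (F x) y v)) (at y)" .
    have "((\<lambda>y. (x, proj y)) has_derivative (\<lambda>v. (0, FD proj y v))) (at y)"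
      by (intro has_derivative_Pair has_derivative_const hp)
    from has_derivative_compose[OF this hZ[OF f(1)]]
    have "((\<lambda>y. Z (x, proj y)) has_derivative (\<lambda>v. FD Z (x, proj y) (0, FD proj y v))) (at y)" .
    from has_derivative_scaleR[OF 1 this] show ?thesis by (simp add: t_def[abs_def])
  qed
  have tt: "t x y \<bullet> t x y = (F x y powr H x)\<^sup>2" if "(x, y) \<in> W" for x y
    using Z1[OF inW(1)[OF that]] by (simp add: t_def power2_eq_square)
  have nt: "norm (t x y) = F x y powr H x" if "(x, y) \<in> W" for x y
    using tt[OF that] by (simp add: norm_eq_sqrt_inner)
  have rf: "riemannian_function (\<lambda>x. mat 1) x v = norm v" for x v :: "real^'n"
    unfolding riemannian_function_def inner_mv[symmetric] by (simp add: norm_eq_sqrt_inner)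
  have conf: "v \<bullet> (finsler_metric F x y *v w) = (p x y)\<^sup>2 * (FD (t x) y v \<bullet> FD (t x) y w)" if "(x, y) \<in> W" for x y v w
  proof -
    note f = inW[OF that]
    \<comment> \<open>?a is the radial stretch of t, and \<open>?b * H x\<close> times the
      indicatrix metric gives the spherical one. The equations \<open>pa\<close> and
      \<open>pb\<close> say that p brings them to 1 and F, the two coefficients in
      \<open>metric_polar\<close>.\<close>
    let ?a = "H x * F x y powr (H x - 1)" and ?b = "F x y powr H x"
    have b: "?b = F x y * F x y powr (H x - 1)" using f(7) by (simp add: powr_diff)
    have pa: "p x y * ?a = 1"
    proof -
      have "p x y * ?a = F x y powr (1 - H x) * F x y powr (H x - 1)" using f(8) by (simp add: p_def)
      also have "\<dots> = F x y powr 0" by (subst powr_add[symmetric]) simp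
      finally show ?thesis using f(7) by simp
    qed
    have pb: "p x y * ?b * H x = F x y"
    proof -
      have "p x y * ?b * H x = F x y powr (1 - H x) * F x y powr H x" using f(8) by (simp add: p_def)
      also have "\<dots> = F x y powr 1" by (subst powr_add[symmetric]) simp
      finally show ?thesis using f(7) by simp
    qed
    have "FD (t x) y v \<bullet> FD (t x) y w = ?b * ?b * (C x * (FD proj y v \<bullet> (central_metric x (proj y) *v FD proj y w))) + ?a * ?a * (FD (F x) y v * FD (F x) y w)"
      unfolding FD_eqI[OF ht[OF that]] inner_add_left inner_add_right inner_scaleR_left inner_scaleR_right
        Z1[OF f(1)] Z3'[OF f(1)] Z3''[OF f(1)] Z2'[OF f(1)] by simp
    then have "(p x y)\<^sup>2 * (FD (t x) y v \<bullet> FD (t x) y w) = (p x y * ?b * H x)\<^sup>2 * (FD proj y v \<bullet> (central_metric x (proj y) *v FD proj y w))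
       + (p x y * ?a)\<^sup>2 * (FD (F x) y v * FD (F x) y w)"
      unfolding f(9)[symmetric] by (simp add: power2_eq_square algebra_simps)
    then show ?thesis unfolding pa pb metric_polar[OF f(2,4)] by simp
  qed
  have "conformal_automorphism W F (\<lambda>x. mat 1) H t p"
    unfolding conformal_automorphism_def
  proof (intro conjI oW)
    have cone: "(x, k *\<^sub>R y) \<in> W" if "(x, y) \<in> W" "k > 0" for x y k
      using that by (simp add: W_def V_def proj_scale height_scale)
    then show "\<forall>(x, y)\<in>W. y \<noteq> 0 \<and> (\<forall>k>0. (x, k *\<^sub>R y) \<in> W)" using inW(3) by blast
    have "pos_def (mat 1 :: real^'n^'n)" by (simp add: pos_def_def transpose_mat)
    then show "riemannian_metric (fst ` W) (\<lambda>x. mat 1)" by (simp add: riemannian_metric_iff smooth_const)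
    have sF: "smooth_map_on W (\<lambda>\<theta>. F (fst \<theta>) (snd \<theta>))"
      by (rule smooth_subset[OF smooth_F], rule subrelI) (use inW(2,3) in blast)
    have sH: "smooth_map_on W (\<lambda>\<theta>. H (fst \<theta>))"
      unfolding H_def
      by (intro smooth_sqrt oW smooth_compose[OF oW open_D _ smooth_fst C(1)]) (use inW(2) C(2) in auto)
    have sp: "smooth_map_on W (\<lambda>\<theta>. proj (snd \<theta>))"
      by (rule smooth_compose[OF oW open_i0 _ smooth_snd smooth_proj]) (use inW(6) in auto)
    have sZ: "smooth_map_on W (\<lambda>\<theta>. Z (fst \<theta>, proj (snd \<theta>)))"
      by (rule smooth_compose[OF oW oT0 _ _ Zs]) (use inW(1) sp oW in \<open>auto intro!: smooth_Pair smooth_fst\<close>)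
    show "smooth_map_on W (\<lambda>(x, y). t x y)"
      unfolding case_prod_unfold t_def
      by (intro smooth_scaleR smooth_powr oW sF sH sZ) (use inW(7) in auto)
    \<comment> \<open>The norm of \<open>t x y\<close> recovers F because \<open>H x > 0\<close>;
      after division the point Z on the sphere recovers the direction.\<close>
    show "\<forall>x. inj_on (t x) {y. (x, y) \<in> W}"
    proof (intro allI inj_onI)
      fix x y y' assume "y \<in> {y. (x, y) \<in> W}" "y' \<in> {y. (x, y) \<in> W}" and e: "t x y = t x y'"
      then have y: "(x, y) \<in> W" and y': "(x, y') \<in> W" by auto
      have "F x y powr H x = F x y' powr H x" using nt[OF y] nt[OF y'] e by simp
      then have Fe: "F x y = F x y'" using inW(7,8)[OF y] inW(7)[OF y'] by (metis less_irrefl powr_less_mono2 less_imp_le linorder_neqE_linordered_idom)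
      have "Z (x, proj y) = Z (x, proj y')" using e Fe inW(7)[OF y] by (simp add: t_def)
      moreover have "x \<in> ball x1 \<rho>" using y by (simp add: W_def)
      ultimately have "proj y = proj y'" using \<rho>(3) inW(5)[OF y] inW(5)[OF y'] by (meson inj_onD)
      then show "y = y'" using polar[OF inW(2,4)[OF y]] polar[OF inW(2,4)[OF y']] Fe by simp
    qed
    show "\<forall>(x, y)\<in>W. t x y \<noteq> 0 \<and> invertible (jacobian (t x) (at y)) \<and> H x > 0 \<and>
      (\<forall>k>0. t x (k *\<^sub>R y) = (k powr H x) *\<^sub>R t x y) \<and>
      (F x y = 1 \<longleftrightarrow> riemannian_function (\<lambda>x. mat 1) x (t x y) = 1) \<and> p x y > 0 \<and>
      (\<forall>m n. finsler_metric F x y $ m $ n = (p x y)\<^sup>2 * (\<Sum>i\<in>UNIV. \<Sum>j\<in>UNIV.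
        mat 1 $ i $ j * jacobian (t x) (at y) $ i $ m * jacobian (t x) (at y) $ j $ n))"
    proof (safe, goal_cases)
      case (1 x y)
      then show ?case using nt[OF 1(1)] inW(7)[OF 1(1)] by simp
    next
      case (2 x y)
      have lin: "linear (FD (t x) y)"
        unfolding FD_eqI[OF ht[OF 2]] by (rule has_derivative_linear[OF ht[OF 2]])
      \<comment> \<open>By conformality a kernel vector of the Jacobian would be a null vector of
        the positive definite Finsler metric.\<close>
      have "v = 0" if "jacobian (t x) (at y) *v v = 0" for v
      proof -
        have "FD (t x) y v = 0" using that fun_cong[OF matrix_vector_mul(2)[OF lin], of v] by (simp add: jacobian_def)
        then have "v \<bullet> (finsler_metric F x y *v v) = 0" using conf[OF 2, of v v] by simp
        then show ?thesis using pos_def_zero metric_pos_def inW[OF 2] by blast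
      qed
      then show ?case unfolding invertible_left_inverse matrix_left_invertible_ker by blast
    next
      case (3 x y)
      then show ?case by (rule inW(8))
    next
      case (4 x y k)
      then show ?case using inW[OF 4(1)] F_hom[of x y k] by (simp add: t_def proj_scale powr_mult)
    next
      case (5 x y)
      then show ?case using nt[OF 5(1)] by (simp add: rf)
    next
      case (6 x y)
      then have "F x y powr H x = 1" using nt[OF 6(1)] by (simp add: rf)
      \<comment> \<open>Taking logarithms gives \<open>H x * ln (F x y) = 0\<close>, and
        \<open>H x > 0\<close> then leaves only F equal to 1.\<close>
      then have "ln (F x y powr H x) = 0" by simp
      then show ?case using inW(7,8)[OF 6(1)] by (simp add: ln_powr)
    next
      case (7 x y)
      then show ?case using inW(7,8)[OF 7] by (simp add: p_def)
    next
      case (8 x y m n)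
      have j: "jacobian (t x) (at y) $ i $ m = FD (t x) y (axis m 1) $ i" for i m
        by (simp add: jacobian_def matrix_def)
      have "axis m 1 \<bullet> (finsler_metric F x y *v axis n 1) = finsler_metric F x y $ m $ n"
        by (simp add: inner_axis' matrix_vector_mul_component inner_axis)
      then show ?case
        using conf[OF 8, of "axis m 1" "axis n 1"] unfolding j inner_mv[symmetric] by simp
    qed
  qed
  moreover have "proj y0 = 0" "height y0 = 1" using y0 by (auto simp: proj_def height_def vec_eq_iff)
  then have "(x1, y0) \<in> W" using \<rho>(1) by (simp add: W_def V_def)
  moreover have "W \<subseteq> D \<times> UNIV" using inW(2) by auto
  ultimately show ?thesis unfolding H_def[abs_def] by blast
qed

end

section \<open>From local statements to the whole indicatrix\<close>

lemma (in finsler) central_chart_exists: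
  assumes "CARD('n) = CARD('m::finite) + 1" "y0 \<noteq> 0"
  obtains i0 and \<beta> :: "'m::finite \<Rightarrow> 'n" where "central_chart D F y0 i0 \<beta>"
proof -
  obtain i0 where i0: "y0 $ i0 \<noteq> 0" using assms(2) by (auto simp: vec_eq_iff)
  have "card (UNIV :: 'm set) = card (UNIV - {i0} :: 'n set)" using assms(1) by simp
  then obtain \<beta> :: "'m \<Rightarrow> 'n" where "bij_betw \<beta> UNIV (UNIV - {i0})"
    using finite_same_card_bij[of "UNIV :: 'm set" "UNIV - {i0}"] by auto
  then have "central_chart D F y0 i0 \<beta>"
    using i0 finsler_axioms by (auto simp: central_chart_def central_chart_axioms_def bij_betw_def)
  then show ?thesis by (rule that)
qed

text \<open>W need not contain the whole indicatrix, but being a cone it contains the point of the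
  indicatrix on the ray of y. One plane at that point fixes the constant, and
  \<open>CARD('m) \<ge> 2\<close> provides two independent vectors to span it.\<close>

lemma (in finsler) automorphism_curvature_unique:
  assumes dim: "CARD('n) = CARD('m::finite) + 1" "CARD('m) \<ge> 2"
    and ca: "conformal_automorphism W F a H t p" "fst ` W \<subseteq> D" "(x, y) \<in> W"
    and cc: "indicatrix_constant_curvature TYPE('m) F x C"
  shows "C = (H x)\<^sup>2"
proof -
  note f = automorphism_facts[OF ca]
  obtain i0 and \<beta> :: "'m \<Rightarrow> 'n" where "central_chart D F y i0 \<beta>" by (rule central_chart_exists[OF dim(1) f(2)])
  then interpret ch: central_chart D F y i0 \<beta> .
  have "ch.lift_pt 0 = y" by (simp add: ch.lift_pt_def vec_eq_iff)
  then have "(x, ch.central_param x 0) \<in> W" using f(7)[of "1 / F x y"] F_pos[OF f(1,2)] by (simp add: ch.central_param_def)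
  moreover obtain i j :: 'm where ij: "i \<noteq> j" using dim(2) card_le_Suc0_iff_eq[of "UNIV :: 'm set"] by force
  have "axis i (1::real) \<in> Basis" "axis j (1::real) \<in> Basis" by (simp_all add: axis_in_Basis_iff)
  then have "independent {axis i 1 :: real^'m, axis j 1}" by (intro independent_mono[OF independent_Basis]) auto
  moreover have "axis i 1 \<noteq> (axis j 1 :: real^'m)" using ij by (simp add: axis_eq_axis)
  ultimately show ?thesis
    using automorphism_curvature[OF ca(1,2) dim(1) ch.central_param_parametrization[OF f(1)], of 0 "axis i 1" "axis j 1"]
      cc ch.central_param_parametrization[OF f(1)] unfolding indicatrix_constant_curvature_def by auto
qed

text \<open>The degree H is shared by all local transformations over V, so the curvature values
  found separately near each point of the indicatrix agree.\<close>

lemma (in finsler) automorphic_imp_constant_curvature: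
  assumes dim: "CARD('n) = CARD('m::finite) + 1" and V: "V \<subseteq> D" "x \<in> V"
    and ca: "\<And>y. y \<noteq> 0 \<Longrightarrow> \<exists>W t p. (x, y) \<in> W \<and> W \<subseteq> V \<times> UNIV \<and> conformal_automorphism W F a H t p"
  shows "H x > 0" "indicatrix_constant_curvature TYPE('m) F x ((H x)\<^sup>2)"
proof -
  have sub: "fst ` W \<subseteq> D" if "W \<subseteq> V \<times> UNIV" for W :: "((real^'n) \<times> (real^'n)) set" using that V(1) by auto
  have "(axis undefined 1 :: real^'n) \<noteq> 0" by (simp add: axis_eq_0_iff)
  from ca[OF this] obtain W t p where "(x, axis undefined 1) \<in> W" "W \<subseteq> V \<times> UNIV" "conformal_automorphism W F a H t p" by blast
  then show "H x > 0" using automorphism_facts(3) sub by blast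
  show "indicatrix_constant_curvature TYPE('m) F x ((H x)\<^sup>2)"
    unfolding indicatrix_constant_curvature_def
  proof (intro allI impI ballI)
    fix \<Omega> :: "(real^'m) set" and Y u and v w :: "real^'m"
    assume Y: "indicatrix_parametrization F x \<Omega> Y" and u: "u \<in> \<Omega>" and vw: "v \<noteq> w \<and> independent {v, w}"
    then have "Y u \<noteq> 0" by (auto simp: indicatrix_parametrization_def indicatrix_def)
    from ca[OF this] obtain W t p where W: "(x, Y u) \<in> W" "W \<subseteq> V \<times> UNIV" "conformal_automorphism W F a H t p" by blast
    show "sectional_curvature (induced_metric F x Y) u v w = (H x)\<^sup>2"
      using automorphism_curvature[OF W(3) sub[OF W(2)] dim Y u W(1)] vw by blast
  qed
qed

section \<open>Changes of charts\<close>

lemma smooth_manifold_chart: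
  assumes "smooth_manifold M A" "c \<in> A" "d \<in> A"
  shows "open (snd c ` fst c)" "inj_on (snd c) (fst c)" "open (snd c ` (fst c \<inter> fst d))"
    "smooth_map_on (snd c ` (fst c \<inter> fst d)) (transition c d)" "fst c \<subseteq> topspace M"
proof -
  obtain U \<phi> V \<psi> where cd: "c = (U, \<phi>)" "d = (V, \<psi>)" by (metis prod.collapse)
  have U: "openin M U" "open (\<phi> ` U)" "homeomorphic_map (subtopology M U) (top_of_set (\<phi> ` U)) \<phi>" and V: "openin M V"
    using assms unfolding cd smooth_manifold_def by blast+
  show "open (snd c ` fst c)" using U by (simp add: cd)
  have t: "topspace (subtopology M U) = U" using openin_subset[OF U(1)] by auto
  show "inj_on (snd c) (fst c)" using U(3) homeomorphic_imp_injective_map t by (fastforce simp: cd)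
  have "openin (subtopology M U) (U \<inter> V)" using V by (auto simp: openin_subtopology)
  then have "openin (top_of_set (\<phi> ` U)) (\<phi> ` (U \<inter> V))"
    using homeomorphic_imp_open_map[OF U(3)] unfolding open_map_def by blast
  then show "open (snd c ` (fst c \<inter> fst d))" using U(2) by (simp add: cd openin_open_eq)
  show "smooth_map_on (snd c ` (fst c \<inter> fst d)) (transition c d)"
  proof -
    have "\<forall>(U, \<phi>)\<in>A. \<forall>(V, \<psi>)\<in>A. smooth_map_on (\<phi> ` (U \<inter> V)) (transition (U, \<phi>) (V, \<psi>))"
      using assms(1) unfolding smooth_manifold_def by blast
    from bspec[OF this assms(2)] assms(3) show ?thesis unfolding cd by auto
  qed
  show "fst c \<subseteq> topspace M" using openin_subset[OF U(1)] by (simp add: cd)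
qed

lemma transition_eq:
  assumes "smooth_manifold M A" "c \<in> A" "q \<in> fst c"
  shows "transition c d (snd c q) = snd d q"
  using smooth_manifold_chart(2)[OF assms(1,2,2)] assms(3) by (simp add: transition_def)

text \<open>The chain rule applied to the two mutually inverse coordinate changes gives a left
  inverse of the Jacobian.\<close>

lemma transition_derivative:
  assumes m: "smooth_manifold M A" and c: "c \<in> A" and d: "d \<in> A" and q: "q \<in> fst c \<inter> fst d"
  shows "linear (FD (transition c d) (snd c q))" "inj (FD (transition c d) (snd c q))"
proof -
  have h: "(transition c d has_derivative FD (transition c d) (snd c q)) (at (snd c q))"
    using smooth_has_derivative[OF smooth_manifold_chart(4)[OF m c d]] q by blast
  have "(transition d c has_derivative FD (transition d c) (snd d q)) (at (transition c d (snd c q)))"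
    using smooth_has_derivative[OF smooth_manifold_chart(4)[OF m d c]] q transition_eq[OF m c] by auto
  from FD_eqI[OF has_derivative_compose[OF h this]]
  have e: "FD (\<lambda>z. transition d c (transition c d z)) (snd c q) = (\<lambda>v. FD (transition d c) (snd d q) (FD (transition c d) (snd c q) v))" .
  have "FD (\<lambda>z. transition d c (transition c d z)) (snd c q) = FD (\<lambda>z. z) (snd c q)"
    by (rule FD_cong[OF smooth_manifold_chart(3)[OF m c d]]) (use q transition_eq[OF m c, of _ d] transition_eq[OF m d, of _ c] in auto)
  then have "FD (transition d c) (snd d q) (FD (transition c d) (snd c q) v) = v" for v
    unfolding e by (simp add: fun_eq_iff)
  then show "inj (FD (transition c d) (snd c q))" by (metis injI)
  show "linear (FD (transition c d) (snd c q))" using h has_derivative_linear by blast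
qed

theorem proposition2p1:
  fixes M :: "'a topology"
    and A :: "('a, 'n::finite) chart set"
    and F :: "('a, 'n) chart \<Rightarrow> real^'n \<Rightarrow> real^'n \<Rightarrow> real"
  assumes "CARD('n) \<ge> 3"
    and "CARD('n) = CARD('m::finite) + 1"
    and "finsler_space M A F"
  shows "(locally_conformally_automorphic M A F \<longleftrightarrow>
            (\<forall>q \<in> topspace M. \<exists>C>0. \<forall>c\<in>A. q \<in> fst c \<longrightarrow>
               indicatrix_constant_curvature TYPE('m) (F c) (snd c q) C)) \<and>
         (locally_conformally_automorphic M A F \<longrightarrow>
            (\<forall>c\<in>A. \<forall>W a H t p.
               W \<subseteq> (snd c ` fst c) \<times> UNIV \<and> conformal_automorphism W (F c) a H t p \<longrightarrow>
               (\<forall>(x, y)\<in>W.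
                  (\<forall>C. indicatrix_constant_curvature TYPE('m) (F c) x C \<longleftrightarrow> C = (H x)\<^sup>2) \<and>
                  p x y = 1 / H x * F c x y powr (1 - H x))))"
proof -
  have m: "smooth_manifold M A" and ff: "\<And>c. c \<in> A \<Longrightarrow> finsler_function (snd c ` fst c) (F c)"
    and compat: "\<And>c d q y. c \<in> A \<Longrightarrow> d \<in> A \<Longrightarrow> q \<in> fst c \<inter> fst d \<Longrightarrow> y \<noteq> 0 \<Longrightarrow>
      F d (snd d q) (FD (transition c d) (snd c q) y) = F c (snd c q) y"
    using assms(3) unfolding finsler_space_def by blast+
  have fl: "finsler (snd c ` fst c) (F c)" if "c \<in> A" for c
    using smooth_manifold_chart(1)[OF m that that] ff[OF that] by (simp add: finsler_def)
  have m2: "CARD('m) \<ge> 2" using assms(1,2) by simp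
  have cover: "\<exists>c\<in>A. q \<in> fst c" if "q \<in> topspace M" for q
    using m that unfolding smooth_manifold_def by blast
  \<comment> \<open>The Jacobian of the change from c to d carries the indicatrix in c to that in d,
    so the constant found in one chart around q is valid in all of them.\<close>
  have change: "indicatrix_constant_curvature TYPE('m) (F c) (snd c q) C"
    if c: "c \<in> A" and d: "d \<in> A" and q: "q \<in> fst c" "q \<in> fst d"
      and cc: "indicatrix_constant_curvature TYPE('m) (F d) (snd d q) C" for c d q C
  proof -
    have q2: "q \<in> fst c \<inter> fst d" using q by blast
    show ?thesis
      by (rule indicatrix_constant_curvature_linear_image[OF fl[OF d] _ fl[OF c] _ transition_derivative[OF m c d q2] compat[OF c d q2] cc])
         (use q in auto)
  qed
  have forward: "\<exists>C>0. \<forall>c\<in>A. q \<in> fst c \<longrightarrow> indicatrix_constant_curvature TYPE('m) (F c) (snd c q) C"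
    if l: "locally_conformally_automorphic M A F" and q: "q \<in> topspace M" for q
  proof -
    obtain c V a H where c: "c \<in> A" "q \<in> fst c" and V: "snd c q \<in> V" "V \<subseteq> snd c ` fst c"
      and W: "\<forall>x\<in>V. \<forall>y. y \<noteq> 0 \<longrightarrow> (\<exists>W t p. (x, y) \<in> W \<and> W \<subseteq> V \<times> UNIV \<and> conformal_automorphism W (F c) a H t p)"
      using bspec[OF l[unfolded locally_conformally_automorphic_def] q] by (elim bexE exE conjE) (rule that)
    note k = finsler.automorphic_imp_constant_curvature[OF fl[OF c(1)] assms(2) V(2,1) W[rule_format, OF V(1)]]
    show ?thesis
    proof (intro exI[of _ "(H (snd c q))\<^sup>2"] conjI ballI impI)
      show "(H (snd c q))\<^sup>2 > 0" using k(1) by simp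
      fix d assume "d \<in> A" "q \<in> fst d"
      then show "indicatrix_constant_curvature TYPE('m) (F d) (snd d q) ((H (snd c q))\<^sup>2)"
        by (rule change[OF _ c(1) _ c(2) k(2)])
    qed
  qed
  have backward: "locally_conformally_automorphic M A F"
    if cc: "\<forall>q \<in> topspace M. \<exists>C>0. \<forall>c\<in>A. q \<in> fst c \<longrightarrow> indicatrix_constant_curvature TYPE('m) (F c) (snd c q) C"
    unfolding locally_conformally_automorphic_def
  proof
    fix q assume "q \<in> topspace M"
    then obtain c where c: "c \<in> A" "q \<in> fst c" using cover by blast
    let ?D = "snd c ` fst c"
    interpret finsler ?D "F c" by (rule fl[OF c(1)])
    have "\<forall>x\<in>?D. \<exists>C>0. indicatrix_constant_curvature TYPE('m) (F c) x C"
      using cc c(1) smooth_manifold_chart(5)[OF m c(1) c(1)] by blast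
    from bchoice[OF this] obtain C where
      C: "\<And>x. x \<in> ?D \<Longrightarrow> C x > 0" "\<And>x. x \<in> ?D \<Longrightarrow> indicatrix_constant_curvature TYPE('m) (F c) x (C x)" by blast
    \<comment> \<open>C comes from a pointwise choice. Its smoothness is read off in a central chart
      around an arbitrary nonzero vector, the same for all x.\<close>
    have sC: "smooth_map_on ?D C"
    proof -
      have "(axis undefined 1 :: real^'n) \<noteq> 0" by (simp add: axis_eq_0_iff)
      then obtain i0 and \<beta> :: "'m \<Rightarrow> 'n" where "central_chart ?D (F c) (axis undefined 1) i0 \<beta>"
        by (rule central_chart_exists[OF assms(2)])
      then show ?thesis by (rule central_chart.smooth_curvature[OF _ m2 C(2)])
    qed
    show "\<exists>c\<in>A. q \<in> fst c \<and> (\<exists>V a H. open V \<and> snd c q \<in> V \<and> V \<subseteq> snd c ` fst c \<and> riemannian_metric V a \<and>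
       (\<forall>x\<in>V. \<forall>y. y \<noteq> 0 \<longrightarrow> (\<exists>W t p. (x, y) \<in> W \<and> W \<subseteq> V \<times> UNIV \<and> conformal_automorphism W (F c) a H t p)))"
    \<comment> \<open>The neighbourhood V is the whole chart domain and the Riemannian metric the
      constant Euclidean one; only the transformations are local, one for each tangent
      vector.\<close>
    proof (intro bexI[of _ c] conjI c exI[of _ ?D] exI[of _ "\<lambda>x. mat 1"] exI[of _ "\<lambda>x. sqrt (C x)"] open_D ballI allI impI)
      show "snd c q \<in> ?D" using c(2) by blast
      have "pos_def (mat 1 :: real^'n^'n)" by (simp add: pos_def_def transpose_mat)
      then show "riemannian_metric ?D (\<lambda>x. mat 1)" by (simp add: riemannian_metric_iff smooth_const)
      fix x y assume x: "x \<in> ?D" and y: "y \<noteq> (0 :: real^'n)"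
      obtain i0 and \<beta> :: "'m \<Rightarrow> 'n" where "central_chart ?D (F c) y i0 \<beta>"
        by (rule central_chart_exists[OF assms(2) y])
      then show "\<exists>W t p. (x, y) \<in> W \<and> W \<subseteq> ?D \<times> UNIV \<and> conformal_automorphism W (F c) (\<lambda>x. mat 1) (\<lambda>x. sqrt (C x)) t p"
        by (rule central_chart.local_conformal_automorphism[OF _ assms(2) sC C x])
    qed simp
  qed
  have second: "(\<forall>C. indicatrix_constant_curvature TYPE('m) (F c) x C \<longleftrightarrow> C = (H x)\<^sup>2) \<and> p x y = 1 / H x * F c x y powr (1 - H x)"
    if l: "locally_conformally_automorphic M A F" and c: "c \<in> A" and W: "W \<subseteq> (snd c ` fst c) \<times> UNIV"
      and ca: "conformal_automorphism W (F c) a H t p" and xy: "(x, y) \<in> W" for c W a H t p x y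
  proof -
    interpret finsler "snd c ` fst c" "F c" by (rule fl[OF c])
    have sub: "fst ` W \<subseteq> snd c ` fst c" using W by auto
    obtain q where q: "q \<in> fst c" "x = snd c q" using sub xy by force
    then obtain C where "indicatrix_constant_curvature TYPE('m) (F c) x C"
      using forward[OF l, of q] smooth_manifold_chart(5)[OF m c c] c by blast
    \<comment> \<open>Some constant exists by the first part, and any valid constant equals
      \<open>(H x)^2\<close>; together these give the equivalence.\<close>
    then have "indicatrix_constant_curvature TYPE('m) (F c) x C' \<longleftrightarrow> C' = (H x)\<^sup>2" for C'
      using automorphism_curvature_unique[OF assms(2) m2 ca sub xy] by metis
    then show ?thesis using multiplier_eq[OF ca sub xy] by blast
  qed
  show ?thesis
    using forward backward second by (intro conjI iffI impI ballI allI) auto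
qed

end
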